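(* Let $\mathbf A\in\mathbb R^{n\times n}$. The following are equivalent: (1) both $\mathbf A$ and $\mathbf A^T$ have the Gantmacher--Krein property; (2) for every $j=1,\dots,n$, both $\mathbf A^{(j)}$ and $(\mathbf A^{(j)})^T$ have the strong Perron--Frobenius property; (3) for every $j=1,\dots,n$, $\mathbf A^{(j)}$ is eventually positive; (4) $\mathbf A$ is eventually strictly totally positive.
   Context: The $j$th compound matrix $\mathbf A^{(j)}$ is the $\binom nj\times\binom nj$ matrix of all $j\times j$ minors of $\mathbf A$ with row and column index sets in lexicographic order. A square matrix has the strong Perron--Frobenius property if it has a simple positive eigenvalue strictly larger in absolute value than all other eigenvalues, with a corresponding eigenvector having all coordinates positive. A matrix $\mathbf B$ is eventually positive if there is $k_0$ with $\mathbf B^k$ entrywise positive for all $k\ge k_0$. $\mathbf A$ is strictly totally positive (STP) if all its minors of all orders are positive, and eventually strictly totally positive (ESTP) if there is $k_0$ with $\mathbf A^k$ STP for all $k\ge k_0$. For $x\in\mathbb R^n$, $S^+(x)$ is the maximal number of sign changes in $(x^1,\dots,x^n)$ when zero coordinates are assigned values $\pm1$ arbitrarily. Nonzero vectors $x_1,\dots,x_n$ form a Markov system if $S^+(\sum_{i=1}^j c_ix_i)\le j-1$ for every $1\le j\le n$ and all real $c_i$ not all zero. $\mathbf A$ has the Gantmacher--Krein property if it has $n$ positive simple eigenvalues $\lambda_1>\dots>\lambda_n>0$ whose corresponding eigenvectors $x_1,\dots,x_n$ (in this order) form a Markov system. *)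

theory Defs
  imports "Jordan_Normal_Form.Jordan_Normal_Form" "Jordan_Normal_Form.DL_Submatrix"
begin

fun combs_lex :: "nat list \<Rightarrow> nat \<Rightarrow> nat list list" where
  "combs_lex xs 0 = [[]]"
| "combs_lex [] (Suc k) = []"
| "combs_lex (x # xs) (Suc k) = map ((#) x) (combs_lex xs k) @ combs_lex xs (Suc k)"

definition index_sets :: "nat \<Rightarrow> nat \<Rightarrow> nat set list" where
  "index_sets n j = map set (combs_lex [0..<n] j)"

definition compound_mat :: "real mat \<Rightarrow> nat \<Rightarrow> real mat" where
  "compound_mat A j =
     (let R = index_sets (dim_row A) j; C = index_sets (dim_col A) j
      in mat (length R) (length C) (\<lambda>(r, c). det (submatrix A (R ! r) (C ! c))))"

definition strong_PF :: "real mat \<Rightarrow> bool" where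
  "strong_PF B \<longleftrightarrow>
     (\<exists>r::real. r > 0 \<and> eigenvalue B r \<and> order r (char_poly B) = 1 \<and>
        (\<forall>\<mu>::complex. eigenvalue (map_mat complex_of_real B) \<mu> \<and> \<mu> \<noteq> complex_of_real r
            \<longrightarrow> cmod \<mu> < r) \<and>
        (\<exists>v. eigenvector B v r \<and> (\<forall>i < dim_vec v. v $ i > 0)))"

definition positive_mat :: "real mat \<Rightarrow> bool" where
  "positive_mat B \<longleftrightarrow> (\<forall>i < dim_row B. \<forall>j < dim_col B. B $$ (i, j) > 0)"

definition eventually_positive :: "real mat \<Rightarrow> bool" where
  "eventually_positive B \<longleftrightarrow> (\<exists>k0. \<forall>k \<ge> k0. positive_mat (B ^\<^sub>m k))"

definition STP :: "real mat \<Rightarrow> bool" where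
  "STP A \<longleftrightarrow> (\<forall>I J. I \<subseteq> {0..<dim_row A} \<and> J \<subseteq> {0..<dim_col A} \<and>
      card I = card J \<and> card I \<ge> 1 \<longrightarrow> det (submatrix A I J) > 0)"

definition ESTP :: "real mat \<Rightarrow> bool" where
  "ESTP A \<longleftrightarrow> (\<exists>k0. \<forall>k \<ge> k0. STP (A ^\<^sub>m k))"

text \<open>Number of sign changes of a vector all of whose entries are nonzero.\<close>
definition sign_changes_nz :: "real vec \<Rightarrow> nat" where
  "sign_changes_nz y = card {i. Suc i < dim_vec y \<and> y $ i * y $ Suc i < 0}"

definition S_plus :: "real vec \<Rightarrow> nat" where
  "S_plus x = Max {sign_changes_nz y | y. dim_vec y = dim_vec x \<and>
      (\<forall>i < dim_vec x. (x $ i \<noteq> 0 \<longrightarrow> y $ i = x $ i) \<and> (x $ i = 0 \<longrightarrow> y $ i \<in> {-1, 1}))}"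

text \<open>Nonzero vectors x_1..x_n (here x 0 .. x (n-1), all of dimension d) form a Markov system.\<close>
definition markov_system :: "nat \<Rightarrow> nat \<Rightarrow> (nat \<Rightarrow> real vec) \<Rightarrow> bool" where
  "markov_system d n x \<longleftrightarrow>
     (\<forall>i < n. x i \<in> carrier_vec d \<and> x i \<noteq> 0\<^sub>v d) \<and>
     (\<forall>j \<in> {1..n}. \<forall>c :: nat \<Rightarrow> real. (\<exists>i < j. c i \<noteq> 0) \<longrightarrow>
        S_plus (vec d (\<lambda>l. \<Sum>i<j. c i * x i $ l)) \<le> j - 1)"

definition GK_property :: "real mat \<Rightarrow> bool" where
  "GK_property A \<longleftrightarrow>
     (\<exists>(lam :: nat \<Rightarrow> real) (x :: nat \<Rightarrow> real vec).
        (\<forall>i j. i < j \<and> j < dim_row A \<longrightarrow> lam i > lam j) \<and>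
        (\<forall>i < dim_row A. lam i > 0 \<and> order (lam i) (char_poly A) = 1 \<and>
                         eigenvector A (x i) (lam i)) \<and>
        markov_system (dim_row A) (dim_row A) x)"

end

theory Submission
  imports Defs "HOL-Library.FuncSet" "Jordan_Normal_Form.Spectral_Radius"
    "Jordan_Normal_Form.Schur_Decomposition"
begin

text \<open>
  By the Cauchy--Binet formula the compound is multiplicative, so the \<open>k\<close>-th power of \<open>A\<^sup>(\<^sup>j\<^sup>)\<close> is the
  \<open>j\<close>-th compound of \<open>A\<^sup>k\<close>; this gives (3) \<open>\<longleftrightarrow>\<close> (4).

  For (2) \<open>\<longleftrightarrow>\<close> (3), let \<open>v\<close>, \<open>w\<close> be positive right and left eigenvectors of \<open>B\<close> for \<open>r\<close> with
  \<open>w \<bullet> v = 1\<close>. The deflated matrix \<open>C = B - r v w\<^sup>T\<close> satisfies \<open>B\<^sup>k = C\<^sup>k + r\<^sup>k v w\<^sup>T\<close> for \<open>k \<ge> 1\<close>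
  and \<open>x \<chi>\<^sub>B = (x - r) \<chi>\<^sub>C\<close>. Hence \<open>r\<close> is a simple root for \<open>B\<close> iff it is no eigenvalue of \<open>C\<close>, and
  if it dominates then \<open>C\<^sup>k / r\<^sup>k \<rightarrow> 0\<close>, so that \<open>B\<^sup>k\<close> is eventually positive. Conversely, a positive
  power of \<open>B\<close> has a Perron vector, which \<open>B\<close> inherits.

  For (1) \<open>\<longleftrightarrow>\<close> (2), triangularise \<open>A\<close>. The compound of an upper triangular matrix is again upper
  triangular in the lexicographic order, so the eigenvalues of \<open>A\<^sup>(\<^sup>j\<^sup>)\<close> are the \<open>j\<close>-fold products of
  those of \<open>A\<close>, and dominance of a positive simple eigenvalue for every \<open>j\<close> means that
  \<open>\<lambda>\<^sub>1 > \<dots> > \<lambda>\<^sub>n > 0\<close>. The dominant eigenvector of \<open>A\<^sup>(\<^sup>j\<^sup>)\<close> is \<open>x\<^sub>1 \<and> \<dots> \<and> x\<^sub>j\<close>, whose coordinates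
  are the \<open>j \<times> j\<close> minors of the matrix with columns \<open>x\<^sub>1, \<dots>, x\<^sub>j\<close>. All of these have the same strict
  sign iff \<open>S\<^sup>+\<close> is at most \<open>j - 1\<close> on the nonzero combinations of \<open>x\<^sub>1, \<dots>, x\<^sub>j\<close>.
\<close>

declare pick.simps [simp del]

section \<open>Compound matrices\<close>

lemma bij_betw_pick:
  assumes "finite K"
  shows "bij_betw (pick K) {0..<card K} K"
proof -
  have inj: "inj_on (pick K) {0..<card K}"
    by (rule linorder_inj_onI) (auto dest: pick_mono_le)
  have sub: "pick K ` {0..<card K} \<subseteq> K"
    using pick_in_set_le by auto
  have "card (pick K ` {0..<card K}) = card K"
    using card_image[OF inj] by simp
  with sub inj assms show ?thesis
    by (metis bij_betw_def card_subset_eq)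
qed

text \<open>Exactly the \<open>i\<close> earlier entries of a strictly increasing list lie below
  \<open>xs ! i\<close>, and this count determines \<open>pick\<close>. It links the lists of
  \<open>combs_lex\<close> with the sets of \<open>submatrix\<close>.\<close>

lemma pick_sorted_list:
  assumes "sorted_wrt (<) xs" "i < length xs"
  shows "pick (set xs) i = xs ! i"
proof -
  have "{a \<in> set xs. a < xs ! i} = (\<lambda>k. xs ! k) ` {0..<i}"
  proof (intro equalityI subsetI)
    fix a assume "a \<in> {a \<in> set xs. a < xs ! i}"
    then obtain k where "k < length xs" "a = xs ! k" "a < xs ! i"
      by (auto simp: in_set_conv_nth)
    moreover from this have "k < i"
      using assms sorted_wrt_nth_less[OF assms(1), of i k]
      by (metis less_asym' linorder_neqE_nat)
    ultimately show "a \<in> (\<lambda>k. xs ! k) ` {0..<i}" by auto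
  next
    fix a assume "a \<in> (\<lambda>k. xs ! k) ` {0..<i}"
    then show "a \<in> {a \<in> set xs. a < xs ! i}"
      using assms sorted_wrt_nth_less[OF assms(1)] by auto
  qed
  moreover have "inj_on (\<lambda>k. xs ! k) {0..<i}"
    using assms by (intro inj_on_nth) (auto simp: strict_sorted_iff)
  ultimately have "card {a \<in> set xs. a < xs ! i} = i"
    by (simp add: card_image)
  then show ?thesis
    using pick_card_in_set[of "xs ! i" "set xs"] assms(2) by simp
qed

lemma set_combs_lex:
  assumes "sorted_wrt (<) xs"
  shows "set (combs_lex xs k) = {ys. sorted_wrt (<) ys \<and> set ys \<subseteq> set xs \<and> length ys = k}"
  using assms
proof (induction xs k rule: combs_lex.induct)
  case (3 x xs k)
  show ?case
  proof (intro equalityI subsetI)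
    fix ys assume "ys \<in> set (combs_lex (x # xs) (Suc k))"
    then show "ys \<in> {ys. sorted_wrt (<) ys \<and> set ys \<subseteq> set (x # xs) \<and> length ys = Suc k}"
      using 3 by (fastforce dest: subsetD)
  next
    fix ys assume ys: "ys \<in> {ys. sorted_wrt (<) ys \<and> set ys \<subseteq> set (x # xs) \<and> length ys = Suc k}"
    then obtain z zs where yz: "ys = z # zs" by (cases ys) auto
    show "ys \<in> set (combs_lex (x # xs) (Suc k))"
    proof (cases "z = x")
      case True
      then have "set zs \<subseteq> set xs" using ys yz by auto
      then show ?thesis using ys yz True 3 by auto
    next
      case False
      then have "z > x" using ys yz 3(3) by auto
      then have "x \<notin> set ys" using ys yz by auto
      then show ?thesis using ys 3 by auto
    qed
  qed
qed auto

text \<open>Only this weak consequence of the lexicographic order is used: of two entries, the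
  earlier one is smaller at some position. It yields distinctness of the index sets, that
  \<open>{0..<j}\<close> comes first, and triangularity of compounds.\<close>

lemma combs_lex_sorted:
  assumes "sorted_wrt (<) xs"
  shows "sorted_wrt (\<lambda>a b. \<exists>i<k. a ! i < b ! i) (combs_lex xs k)"
  using assms
proof (induction xs k rule: combs_lex.induct)
  case (3 x xs k)
  have "sorted_wrt (\<lambda>a b. \<exists>i<Suc k. a ! i < b ! i) (map ((#) x) (combs_lex xs k))"
    unfolding sorted_wrt_map
    by (rule sorted_wrt_mono_rel[OF _ "3.IH"(1)]) (use 3 in force)+
  moreover have "\<exists>i<Suc k. (x # a) ! i < b ! i" if "b \<in> set (combs_lex xs (Suc k))" for a b
  proof -
    have "b \<noteq> []" "set b \<subseteq> set xs"
      using that 3 by (auto simp: set_combs_lex)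
    then have "x < b ! 0" using 3(3) by (cases b) auto
    then show ?thesis by auto
  qed
  ultimately show ?case using 3 by (auto simp: sorted_wrt_append)
qed auto

lemma nth_index_sets:
  assumes "r < length (index_sets n j)"
  obtains xs where "xs = combs_lex [0..<n] j ! r" "index_sets n j ! r = set xs"
    "sorted_wrt (<) xs" "length xs = j" "set xs \<subseteq> {0..<n}"
proof
  let ?xs = "combs_lex [0..<n] j ! r"
  have "?xs \<in> set (combs_lex [0..<n] j)" using assms by (simp add: index_sets_def)
  then show "sorted_wrt (<) ?xs" "length ?xs = j" "set ?xs \<subseteq> {0..<n}"
    by (auto simp: set_combs_lex)
  show "index_sets n j ! r = set ?xs" using assms by (simp add: index_sets_def)
qed simp

lemma set_index_sets: "set (index_sets n j) = {I. I \<subseteq> {0..<n} \<and> card I = j}"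
proof (intro equalityI subsetI)
  fix I assume "I \<in> set (index_sets n j)"
  then show "I \<in> {I. I \<subseteq> {0..<n} \<and> card I = j}"
    by (auto simp: index_sets_def set_combs_lex strict_sorted_iff distinct_card)
next
  fix I assume "I \<in> {I. I \<subseteq> {0..<n} \<and> card I = j}"
  then have I: "I \<subseteq> {0..<n}" "card I = j" and fin: "finite I"
    by (auto intro: finite_subset)
  then have "sorted_list_of_set I \<in> set (combs_lex [0..<n] j)"
    by (auto simp: set_combs_lex strict_sorted_list_of_set)
  then show "I \<in> set (index_sets n j)"
    using fin by (auto simp: index_sets_def intro!: image_eqI[of _ _ "sorted_list_of_set I"])
qed

lemma index_setsD:
  assumes "r < length (index_sets n j)"
  shows "index_sets n j ! r \<subseteq> {0..<n}" "card (index_sets n j ! r) = j"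
    "finite (index_sets n j ! r)"
  using nth_mem[OF assms] set_index_sets by (auto intro: finite_subset)

lemma index_sets_less:
  assumes "r < s" "s < length (index_sets n j)"
  shows "\<exists>i<j. pick (index_sets n j ! r) i < pick (index_sets n j ! s) i"
proof -
  have r: "r < length (index_sets n j)" using assms by simp
  obtain xs where xs: "xs = combs_lex [0..<n] j ! r" "index_sets n j ! r = set xs"
    "sorted_wrt (<) xs" "length xs = j" using nth_index_sets[OF r] by metis
  obtain ys where ys: "ys = combs_lex [0..<n] j ! s" "index_sets n j ! s = set ys"
    "sorted_wrt (<) ys" "length ys = j" using nth_index_sets[OF assms(2)] by metis
  have "\<exists>i<j. xs ! i < ys ! i"
    unfolding xs(1) ys(1)
    by (rule sorted_wrt_nth_less[OF combs_lex_sorted]) (use assms in \<open>auto simp: index_sets_def\<close>)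
  then show ?thesis
    using xs ys by (auto simp: pick_sorted_list)
qed

lemma distinct_index_sets: "distinct (index_sets n j)"
proof -
  have "index_sets n j ! r \<noteq> index_sets n j ! s"
    if "r < s" "s < length (index_sets n j)" for r s
    using index_sets_less[OF that] by force
  then show ?thesis
    unfolding distinct_conv_nth by (metis linorder_neqE_nat)
qed

lemma sum_index_sets:
  "(\<Sum>k = 0..<length (index_sets n j). f (index_sets n j ! k))
     = (\<Sum>K | K \<subseteq> {0..<n} \<and> card K = j. f K)"
  using sum_list_distinct_conv_sum_set[OF distinct_index_sets, of f n j]
  by (simp add: set_index_sets sum_list_sum_nth)

lemma pick_initial: "i < j \<Longrightarrow> pick {0..<j} i = i"
  using pick_sorted_list[of "[0..<j]" i] by simp

text \<open>A strictly increasing list of naturals satisfies \<open>k \<le> xs ! k\<close>, so no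
  index set is smaller than \<open>{0..<j}\<close> at any position. Position 0 of a compound thus
  belongs to the first \<open>j\<close> rows or columns.\<close>

lemma index_sets_0:
  assumes "j \<le> n"
  shows "0 < length (index_sets n j)" "index_sets n j ! 0 = {0..<j}"
proof -
  have "{0..<j} \<in> set (index_sets n j)" using assms by (auto simp: set_index_sets)
  then obtain r where r: "r < length (index_sets n j)" "index_sets n j ! r = {0..<j}"
    by (auto simp: in_set_conv_nth)
  then show len: "0 < length (index_sets n j)" by linarith
  have "r = 0"
  proof (rule ccontr)
    assume "r \<noteq> 0"
    then obtain i where i: "i < j" "pick (index_sets n j ! 0) i < pick {0..<j} i"
      using index_sets_less[of 0 r n j] r by auto
    obtain xs where xs: "index_sets n j ! 0 = set xs"
      "sorted_wrt (<) xs" "length xs = j" using nth_index_sets[OF len] by metis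
    have "k \<le> xs ! k" if "k < length xs" for k
      using that
    proof (induction k)
      case (Suc k)
      then have "xs ! k < xs ! Suc k" using sorted_wrt_nth_less[OF xs(2)] by auto
      with Suc show ?case by simp
    qed simp
    with i xs pick_initial pick_sorted_list[OF xs(2), of i] show False
      by (metis not_less)
  qed
  then show "index_sets n j ! 0 = {0..<j}" using r by simp
qed

section \<open>The Cauchy--Binet formula\<close>

lemma submatrix_pick:
  assumes "A \<in> carrier_mat nr nc" "I \<subseteq> {0..<nr}" "J \<subseteq> {0..<nc}"
  shows "submatrix A I J = mat (card I) (card J) (\<lambda>(i, j). A $$ (pick I i, pick J j))"
proof -
  have "{i. i < dim_row A \<and> i \<in> I} = I" "{i. i < dim_col A \<and> i \<in> J} = J"
    using assms by auto
  then show ?thesis by (simp add: submatrix_def)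
qed

lemma pick_less:
  assumes "I \<subseteq> {0..<n}" "i < card I"
  shows "pick I i < n"
  using pick_in_set_le[OF assms(2)] assms(1) by auto

lemma permutes_nat_less:
  fixes j :: nat
  assumes "p permutes {0..<j}" "i < j"
  shows "p i < j"
  using permutes_in_image[OF assms(1), of i] assms(2) by simp

text \<open>Multilinearity in the rows: each \<open>f\<close> selects, for every row
  \<open>i\<close>, the summand \<open>k = f i\<close>. The maps \<open>a\<close> and
  \<open>b\<close> stay arbitrary, to be specialised to \<open>pick I\<close> and
  \<open>pick J\<close>.\<close>

lemma det_product_expansion:
  fixes A B :: "'a :: comm_ring_1 mat"
  shows "det (mat j j (\<lambda>(i, l). \<Sum>k = 0..<n. A $$ (a i, k) * B $$ (k, b l)))
    = (\<Sum>f \<in> {0..<j} \<rightarrow>\<^sub>E {0..<n}. (\<Prod>i = 0..<j. A $$ (a i, f i)) *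
        det (mat j j (\<lambda>(i, l). B $$ (f i, b l))))"
proof -
  let ?U = "{0..<j}"
  let ?P = "{p. p permutes ?U}"
  have "det (mat j j (\<lambda>(i, l). \<Sum>k = 0..<n. A $$ (a i, k) * B $$ (k, b l)))
    = (\<Sum>p\<in>?P. signof p * (\<Prod>i\<in>?U. \<Sum>k = 0..<n. A $$ (a i, k) * B $$ (k, b (p i))))"
    by (subst det_def'[of _ j]) (auto intro!: sum.cong prod.cong simp: permutes_in_image)
  also have "\<dots> = (\<Sum>p\<in>?P. signof p * (\<Sum>f\<in>?U \<rightarrow>\<^sub>E {0..<n}.
      \<Prod>i\<in>?U. A $$ (a i, f i) * B $$ (f i, b (p i))))"
    by (simp add: prod_sum_PiE)
  also have "\<dots> = (\<Sum>f\<in>?U \<rightarrow>\<^sub>E {0..<n}. \<Sum>p\<in>?P. signof p *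
      (\<Prod>i\<in>?U. A $$ (a i, f i) * B $$ (f i, b (p i))))"
    unfolding sum_distrib_left by (rule sum.swap)
  also have "\<dots> = (\<Sum>f \<in> ?U \<rightarrow>\<^sub>E {0..<n}. (\<Prod>i\<in>?U. A $$ (a i, f i)) *
      (\<Sum>p\<in>?P. signof p * (\<Prod>i\<in>?U. B $$ (f i, b (p i)))))"
    by (simp add: sum_distrib_left prod.distrib mult_ac)
  also have "\<dots> = (\<Sum>f \<in> ?U \<rightarrow>\<^sub>E {0..<n}. (\<Prod>i\<in>?U. A $$ (a i, f i)) *
      det (mat j j (\<lambda>(i, l). B $$ (f i, b l))))"
    by (intro sum.cong refl arg_cong[of _ _ "(*) _"], subst det_def'[of _ j])
      (auto intro!: sum.cong prod.cong simp: permutes_in_image)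
  finally show ?thesis .
qed

text \<open>Every injection with image \<open>K\<close> is the increasing enumeration of
  \<open>K\<close> composed with a unique permutation. The \<open>restrict\<close> reflects that the
  functions on the left are \<open>undefined\<close> outside \<open>{0..<j}\<close>.\<close>

lemma sum_injections_with_image:
  fixes h :: "(nat \<Rightarrow> nat) \<Rightarrow> 'b :: comm_monoid_add"
  assumes "finite K" "card K = j" "K \<subseteq> {0..<n}"
  shows "(\<Sum>f | f \<in> {0..<j} \<rightarrow>\<^sub>E {0..<n} \<and> inj_on f {0..<j} \<and> f ` {0..<j} = K. h f)
    = (\<Sum>p | p permutes {0..<j}. h (restrict (pick K \<circ> p) {0..<j}))"
proof -
  let ?U = "{0..<j}"
  have bij: "bij_betw (pick K) ?U K" using bij_betw_pick[OF assms(1)] assms(2) by simp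
  define idx where "idx = inv_into ?U (pick K)"
  have idx: "bij_betw idx K ?U" unfolding idx_def by (rule bij_betw_inv_into[OF bij])
  have pi: "pick K (idx a) = a" if "a \<in> K" for a
    unfolding idx_def by (rule bij_betw_inv_into_right[OF bij that])
  have ip: "idx (pick K i) = i" if "i < j" for i
    unfolding idx_def using bij_betw_inv_into_left[OF bij] that by simp
  show ?thesis
  \<comment> \<open>The permutation behind \<open>f\<close> sends \<open>i\<close> to the rank of
    \<open>f i\<close> in \<open>K\<close>; it is continued by the identity, as
    \<open>permutes\<close> demands.\<close>
  proof (rule sum.reindex_bij_witness[where i = "\<lambda>p. restrict (pick K \<circ> p) ?U"
        and j = "\<lambda>f i. if i < j then idx (f i) else i"])
    fix f assume "f \<in> {f. f \<in> ?U \<rightarrow>\<^sub>E {0..<n} \<and> inj_on f ?U \<and> f ` ?U = K}"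
    then have f: "f \<in> ?U \<rightarrow>\<^sub>E {0..<n}" "bij_betw f ?U K" by (auto simp: bij_betw_def)
    have fK: "f i \<in> K" if "i < j" for i using f(2) that by (auto simp: bij_betw_def)
    show eq: "restrict (pick K \<circ> (\<lambda>i. if i < j then idx (f i) else i)) ?U = f"
      using f fK pi by (auto simp: restrict_def PiE_def extensional_def fun_eq_iff)
    have "bij_betw (idx \<circ> f) ?U ?U" by (rule bij_betw_trans[OF f(2) idx])
    then have "bij_betw (\<lambda>i. if i < j then idx (f i) else i) ?U ?U"
      by (rule bij_betw_cong[THEN iffD1, rotated]) auto
    then show "(\<lambda>i. if i < j then idx (f i) else i) \<in> {p. p permutes ?U}"
      by (auto intro: bij_imp_permutes)
    show "h (restrict (pick K \<circ> (\<lambda>i. if i < j then idx (f i) else i)) ?U) = h f"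
      unfolding eq ..
  next
    fix p assume "p \<in> {p. p permutes ?U}"
    then have p: "p permutes ?U" by simp
    have pj: "p i < j" if "i < j" for i using permutes_in_image[OF p, of i] that by simp
    show "(\<lambda>i. if i < j then idx (restrict (pick K \<circ> p) ?U i) else i) = p"
      using ip pj permutes_not_in[OF p] by (auto simp: fun_eq_iff)
    have "bij_betw (pick K \<circ> p) ?U K"
      by (rule bij_betw_trans[OF permutes_imp_bij[OF p] bij])
    then have "bij_betw (restrict (pick K \<circ> p) ?U) ?U K"
      by (rule bij_betw_cong[THEN iffD1, rotated]) auto
    then show "restrict (pick K \<circ> p) ?U \<in> {f. f \<in> ?U \<rightarrow>\<^sub>E {0..<n} \<and> inj_on f ?U \<and> f ` ?U = K}"
      using assms(3) pj bij by (auto simp: bij_betw_def)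
  qed
qed

text \<open>Choices \<open>f\<close> with a repeated value give two equal rows of \<open>B\<close>
  and drop out. The injective ones are grouped by their image \<open>K\<close>; reordering the rows
  extracts a sign, and the signed products of entries of \<open>A\<close> add up to the minor of
  \<open>A\<close> with columns \<open>K\<close>.\<close>

lemma Cauchy_Binet:
  fixes A B :: "'a :: comm_ring_1 mat"
  assumes A: "A \<in> carrier_mat nr n" and B: "B \<in> carrier_mat n nc"
    and I: "I \<subseteq> {0..<nr}" "card I = j" and J: "J \<subseteq> {0..<nc}" "card J = j"
  shows "det (submatrix (A * B) I J)
    = (\<Sum>K | K \<subseteq> {0..<n} \<and> card K = j. det (submatrix A I K) * det (submatrix B K J))"
proof -
  let ?U = "{0..<j}"
  let ?KK = "{K. K \<subseteq> {0..<n} \<and> card K = j}"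
  let ?F = "?U \<rightarrow>\<^sub>E {0..<n}"
  let ?M = "\<lambda>f. mat j j (\<lambda>(i, l). B $$ (f i, pick J l))"
  let ?h = "\<lambda>f. (\<Prod>i\<in>?U. A $$ (pick I i, f i)) * det (?M f)"
  have AB: "A * B \<in> carrier_mat nr nc" using A B by simp
  have finF: "finite ?F" by (intro finite_PiE) auto
  have "submatrix (A * B) I J
      = mat j j (\<lambda>(i, l). \<Sum>k = 0..<n. A $$ (pick I i, k) * B $$ (k, pick J l))"
    unfolding submatrix_pick[OF AB I(1) J(1)] I J
    by (rule eq_matI)
      (use A B I J pick_less[OF I(1)] pick_less[OF J(1)] in \<open>auto simp: scalar_prod_def\<close>)
  then have "det (submatrix (A * B) I J) = (\<Sum>f\<in>?F. ?h f)"
    using det_product_expansion[where a = "pick I" and b = "pick J"] by simp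
  also have "\<dots> = (\<Sum>f | f \<in> ?F \<and> inj_on f ?U. ?h f)"
  proof (rule sum.mono_neutral_right[OF finF])
    show "\<forall>f \<in> ?F - {f. f \<in> ?F \<and> inj_on f ?U}. ?h f = 0"
    proof
      fix f assume "f \<in> ?F - {f. f \<in> ?F \<and> inj_on f ?U}"
      then obtain i i' where "i < j" "i' < j" "i \<noteq> i'" "f i = f i'"
        by (auto simp: inj_on_def)
      then have "det (?M f) = 0"
        by (intro det_identical_rows[of _ j i i']) auto
      then show "?h f = 0" by simp
    qed
  qed auto
  also have "\<dots> = (\<Sum>K\<in>?KK. \<Sum>f | f \<in> {f. f \<in> ?F \<and> inj_on f ?U} \<and> f ` ?U = K. ?h f)"
  proof (rule sum.group[symmetric])
    show "finite {f. f \<in> ?F \<and> inj_on f ?U}" using finF by simp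
    show "(\<lambda>f. f ` ?U) ` {f. f \<in> ?F \<and> inj_on f ?U} \<subseteq> ?KK"
      by (auto simp: card_image PiE_def Pi_def)
  qed simp
  also have "\<dots> = (\<Sum>K\<in>?KK. det (submatrix A I K) * det (submatrix B K J))"
  proof (rule sum.cong[OF refl])
    fix K assume "K \<in> ?KK"
    then have K: "K \<subseteq> {0..<n}" "card K = j" "finite K" by (auto intro: finite_subset)
    have sB: "submatrix B K J = mat j j (\<lambda>(i, l). B $$ (pick K i, pick J l))"
      unfolding submatrix_pick[OF B K(1) J(1)] K J ..
    have sA: "submatrix A I K = mat j j (\<lambda>(i, l). A $$ (pick I i, pick K l))"
      unfolding submatrix_pick[OF A I(1) K(1)] K I ..
    have M: "det (?M (restrict (pick K \<circ> p) ?U)) = signof p * det (submatrix B K J)"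
      if p: "p permutes ?U" for p
    proof -
      have "?M (restrict (pick K \<circ> p) ?U)
          = mat j j (\<lambda>(i, l). submatrix B K J $$ (p i, l))"
        unfolding sB using permutes_nat_less[OF p] by (intro eq_matI) auto
      then show ?thesis
        using det_permute_rows[OF _ p, of "submatrix B K J"] sB by simp
    qed
    have "(\<Sum>f | f \<in> {f. f \<in> ?F \<and> inj_on f ?U} \<and> f ` ?U = K. ?h f)
        = (\<Sum>p | p permutes ?U. ?h (restrict (pick K \<circ> p) ?U))"
      using sum_injections_with_image[OF K(3,2,1), of ?h] by (simp add: conj_assoc)
    also have "\<dots> = (\<Sum>p | p permutes ?U.
        (signof p * (\<Prod>i\<in>?U. submatrix A I K $$ (i, p i))) * det (submatrix B K J))"
      using M permutes_nat_less
      by (intro sum.cong refl) (simp add: sA mult_ac)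
    also have "\<dots> = det (submatrix A I K) * det (submatrix B K J)"
      unfolding sum_distrib_right[symmetric] by (subst det_def'[of _ j]) (auto simp: sA)
    finally show "(\<Sum>f | f \<in> {f. f \<in> ?F \<and> inj_on f ?U} \<and> f ` ?U = K. ?h f)
        = det (submatrix A I K) * det (submatrix B K J)" .
  qed
  finally show ?thesis .
qed

text \<open>\<open>compound_mat\<close> over an arbitrary ring, because the eigenvalues of a real compound are read off
  a complex triangularisation.\<close>

definition compound :: "'a :: comm_ring_1 mat \<Rightarrow> nat \<Rightarrow> 'a mat" where
  "compound A j =
     (let R = index_sets (dim_row A) j; C = index_sets (dim_col A) j
      in mat (length R) (length C) (\<lambda>(r, c). det (submatrix A (R ! r) (C ! c))))"

lemma compound_mat_eq_compound: "compound_mat A j = compound A j"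
  by (simp add: compound_mat_def compound_def)

lemma dim_compound [simp]:
  "dim_row (compound A j) = length (index_sets (dim_row A) j)"
  "dim_col (compound A j) = length (index_sets (dim_col A) j)"
  by (simp_all add: compound_def Let_def)

lemma compound_carrier [simp]:
  assumes "A \<in> carrier_mat n n"
  shows "compound A j \<in> carrier_mat (length (index_sets n j)) (length (index_sets n j))"
  using assms by (auto simp: compound_def Let_def)

lemma compound_index:
  assumes "A \<in> carrier_mat n n" "r < length (index_sets n j)" "c < length (index_sets n j)"
  shows "compound A j $$ (r, c) = det (submatrix A (index_sets n j ! r) (index_sets n j ! c))"
  using assms by (auto simp: compound_def Let_def)

section \<open>Compounds of products, transposes and homomorphic images\<close>

lemma compound_mult:
  assumes A: "A \<in> carrier_mat n n" and B: "B \<in> carrier_mat n n"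
  shows "compound (A * B) j = compound A j * compound B j"
proof (rule eq_matI)
  let ?S = "index_sets n j"
  note car = A B
  fix r c assume "r < dim_row (compound A j * compound B j)" "c < dim_col (compound A j * compound B j)"
  then have rc: "r < length ?S" "c < length ?S" using car by auto
  have AB: "A * B \<in> carrier_mat n n" using A B by simp
  have "(compound A j * compound B j) $$ (r, c)
      = (\<Sum>k = 0..<length ?S. compound A j $$ (r, k) * compound B j $$ (k, c))"
    using rc car by (auto simp: scalar_prod_def)
  also have "\<dots> = (\<Sum>k = 0..<length ?S. det (submatrix A (?S ! r) (?S ! k)) *
      det (submatrix B (?S ! k) (?S ! c)))"
    using rc by (simp add: compound_index[OF A] compound_index[OF B])
  also have "\<dots> = det (submatrix (A * B) (?S ! r) (?S ! c))"
    unfolding sum_index_sets[of "\<lambda>K. det (submatrix A (?S ! r) K) * det (submatrix B K (?S ! c))"]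
    by (rule Cauchy_Binet[OF A B, symmetric]) (use rc index_setsD in auto)
  finally show "compound (A * B) j $$ (r, c) = (compound A j * compound B j) $$ (r, c)"
    using rc by (simp add: compound_index[OF AB])
qed (use A B in auto)

lemma compound_transpose:
  assumes A: "A \<in> carrier_mat n n"
  shows "(compound A j)\<^sup>T = compound (A\<^sup>T) j"
proof (rule eq_matI)
  let ?S = "index_sets n j"
  have AT: "A\<^sup>T \<in> carrier_mat n n" using A by simp
  fix r c assume "r < dim_row (compound (A\<^sup>T) j)" "c < dim_col (compound (A\<^sup>T) j)"
  then have rc: "r < length ?S" "c < length ?S" using AT by auto
  note S = index_setsD[OF rc(1)] index_setsD[OF rc(2)]
  have "submatrix (A\<^sup>T) (?S ! r) (?S ! c) = (submatrix A (?S ! c) (?S ! r))\<^sup>T"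
    unfolding submatrix_pick[OF A S(4,1)] submatrix_pick[OF AT S(1,4)]
    using S A by (intro eq_matI) (auto simp: pick_less)
  moreover have "submatrix A (?S ! c) (?S ! r) \<in> carrier_mat j j"
    unfolding submatrix_pick[OF A S(4,1)] using S by simp
  ultimately have "det (submatrix (A\<^sup>T) (?S ! r) (?S ! c)) = det (submatrix A (?S ! c) (?S ! r))"
    by (simp add: det_transpose)
  then show "(compound A j)\<^sup>T $$ (r, c) = compound (A\<^sup>T) j $$ (r, c)"
    using rc A by (simp add: compound_index[OF A] compound_index[OF AT])
qed (use A in auto)

text \<open>Determinants commute with ring homomorphisms. The instance needed is the embedding of
  the reals into the complex numbers, where triangularisation is available.\<close>

lemma compound_hom:
  fixes h :: "'a :: comm_ring_1 \<Rightarrow> 'b :: comm_ring_1"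
  assumes "comm_ring_hom h" and A: "A \<in> carrier_mat n n"
  shows "map_mat h (compound A j) = compound (map_mat h A) j"
proof (rule eq_matI)
  interpret comm_ring_hom h by fact
  let ?S = "index_sets n j"
  have hA: "map_mat h A \<in> carrier_mat n n" using A by simp
  fix r c assume "r < dim_row (compound (map_mat h A) j)" "c < dim_col (compound (map_mat h A) j)"
  then have rc: "r < length ?S" "c < length ?S" using hA by auto
  note S = index_setsD[OF rc(1)] index_setsD[OF rc(2)]
  have "submatrix (map_mat h A) (?S ! r) (?S ! c) = map_mat h (submatrix A (?S ! r) (?S ! c))"
    unfolding submatrix_pick[OF A S(1,4)] submatrix_pick[OF hA S(1,4)]
    using S A by (intro eq_matI) (auto simp: pick_less)
  then show "map_mat h (compound A j) $$ (r, c) = compound (map_mat h A) j $$ (r, c)"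
    using rc A by (simp add: compound_index[OF A] compound_index[OF hA])
qed (use A in auto)

section \<open>Compounds of triangular matrices and their eigenvalues\<close>

text \<open>Since \<open>pick J k < pick I k\<close>, the rows from \<open>k\<close> on and the
  columns up to \<open>k\<close> of the submatrix form a zero block of size \<open>j - k\<close> by
  \<open>k + 1\<close>. These sizes add up to more than \<open>j\<close>, so every permutation meets
  the block.\<close>

lemma det_submatrix_triangular_zero:
  fixes T :: "'a :: comm_ring_1 mat"
  assumes T: "T \<in> carrier_mat n n" "upper_triangular T"
    and I: "I \<subseteq> {0..<n}" "card I = j" and J: "J \<subseteq> {0..<n}" "card J = j"
    and k: "k < j" "pick J k < pick I k"
  shows "det (submatrix T I J) = 0"
proof -
  have zero: "T $$ (pick I a, pick J b) = 0" if "k \<le> a" "a < j" "b \<le> k" for a b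
  proof -
    have "pick J b \<le> pick J k" using that k J pick_mono_le[of k J b] by (cases "b = k") auto
    also have "\<dots> < pick I k" by fact
    also have "\<dots> \<le> pick I a" using that I pick_mono_le[of a I k] by (cases "a = k") auto
    finally show ?thesis
      using T pick_less[OF I(1), of a] that I by (auto simp: upper_triangular_def)
  qed
  have "(\<Prod>i = 0..<j. T $$ (pick I i, pick J (p i))) = 0" if p: "p permutes {0..<j}" for p
  proof -
    have "\<exists>a\<in>{k..<j}. p a \<le> k"
    proof (rule ccontr)
      assume "\<not> ?thesis"
      then have "p ` {k..<j} \<subseteq> {Suc k..<j}"
        using permutes_nat_less[OF p] by (auto simp: not_le Suc_le_eq)
      then have "card (p ` {k..<j}) \<le> card {Suc k..<j}" by (intro card_mono) auto
      moreover have "card (p ` {k..<j}) = card {k..<j}"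
        by (rule card_image) (meson p permutes_inj inj_on_subset subset_UNIV)
      ultimately show False using k by simp
    qed
    then obtain a where "k \<le> a" "a < j" "p a \<le> k" by auto
    then show ?thesis using zero by (intro prod_zero bexI[of _ a]) auto
  qed
  then show ?thesis
    unfolding submatrix_pick[OF T(1) I(1) J(1)] I J
    by (subst det_def'[of _ j]) (auto simp: permutes_nat_less)
qed

lemma compound_upper_triangular:
  assumes T: "T \<in> carrier_mat n n" "upper_triangular T"
  shows "upper_triangular (compound T j)"
proof (unfold upper_triangular_def, intro allI impI)
  fix r c assume "r < dim_row (compound T j)" "c < r"
  then have rc: "r < length (index_sets n j)" "c < length (index_sets n j)"
    using T(1) by auto
  obtain k where "k < j" "pick (index_sets n j ! c) k < pick (index_sets n j ! r) k"
    using index_sets_less[OF \<open>c < r\<close> rc(1)] by auto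
  then show "compound T j $$ (r, c) = 0"
    unfolding compound_index[OF T(1) rc]
    by (intro det_submatrix_triangular_zero[OF T, where k = k and j = j] index_setsD rc)
qed

lemma compound_triangular_diag:
  assumes T: "T \<in> carrier_mat n n" "upper_triangular T" and r: "r < length (index_sets n j)"
  shows "compound T j $$ (r, r) = (\<Prod>i\<in>index_sets n j ! r. T $$ (i, i))"
proof -
  let ?I = "index_sets n j ! r"
  note I = index_setsD[OF r]
  have sub: "submatrix T ?I ?I = mat j j (\<lambda>(a, b). T $$ (pick ?I a, pick ?I b))"
    unfolding submatrix_pick[OF T(1) I(1) I(1)] I ..
  have "upper_triangular (submatrix T ?I ?I)"
    unfolding sub upper_triangular_def
    using T pick_less[OF I(1)] pick_mono_le[of _ ?I] I by (auto simp: upper_triangular_def)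
  then have "det (submatrix T ?I ?I) = (\<Prod>a = 0..<j. T $$ (pick ?I a, pick ?I a))"
    by (subst det_upper_triangular[of _ j]) (auto simp: sub prod_list_diag_prod)
  also have "\<dots> = (\<Prod>i\<in>?I. T $$ (i, i))"
    using bij_betw_pick[OF I(3)] I(2) by (intro prod.reindex_bij_betw) simp
  finally show ?thesis by (simp add: compound_index[OF T(1) r r])
qed

text \<open>The identity is upper triangular, which settles the entries on and below the diagonal;
  it is also symmetric, and transposing settles those above.\<close>

lemma compound_one: "compound (1\<^sub>m n) j = 1\<^sub>m (length (index_sets n j))"
proof (rule eq_matI)
  let ?S = "index_sets n j"
  have ut: "upper_triangular (1\<^sub>m n :: 'a mat)" by (auto simp: upper_triangular_def)
  have one: "(1\<^sub>m n :: 'a mat) \<in> carrier_mat n n" by simp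
  fix r c assume "r < dim_row (1\<^sub>m (length ?S) :: 'a mat)" "c < dim_col (1\<^sub>m (length ?S) :: 'a mat)"
  then have rc: "r < length ?S" "c < length ?S" by auto
  have low: "compound (1\<^sub>m n :: 'a mat) j $$ (r, c) = 0" if "c < r" "r < length ?S" for r c
    using compound_upper_triangular[OF one ut, of j] one that
    by (auto simp: upper_triangular_def)
  have diag: "compound (1\<^sub>m n :: 'a mat) j $$ (r, r) = 1"
    unfolding compound_triangular_diag[OF one ut rc(1)]
    using index_setsD[OF rc(1)] by (intro prod.neutral) auto
  have "compound (1\<^sub>m n :: 'a mat) j $$ (r, c) = (compound (1\<^sub>m n :: 'a mat) j)\<^sup>T $$ (r, c)"
    unfolding compound_transpose[OF one] by simp
  then have "compound (1\<^sub>m n :: 'a mat) j $$ (r, c) = 0" if "r < c"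
    using low[OF that rc(2)] rc one by auto
  then show "compound (1\<^sub>m n :: 'a mat) j $$ (r, c) = 1\<^sub>m (length ?S) $$ (r, c)"
    using rc low diag by (cases r c rule: linorder_cases) auto
qed auto

lemma compound_pow:
  assumes A: "A \<in> carrier_mat n n"
  shows "compound (A ^\<^sub>m k) j = compound A j ^\<^sub>m k"
proof (induction k)
  case 0
  then show ?case using A A by (simp add: compound_one)
next
  case (Suc k)
  then show ?case using compound_mult[OF pow_carrier_mat[OF A] A] by simp
qed

lemma compound_similar:
  assumes A: "A \<in> carrier_mat n n" and "similar_mat A B"
  shows "similar_mat (compound A j) (compound B j)"
proof -
  from assms obtain P Q where w: "similar_mat_wit A B P Q" by (auto simp: similar_mat_def)
  note D = similar_mat_witD2[OF A w]
  let ?N = "length (index_sets n j)"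
  show ?thesis
  proof (rule similar_matI[where n = ?N])
    show "{compound A j, compound B j, compound P j, compound Q j} \<subseteq> carrier_mat ?N ?N"
      using D by auto
    show "compound P j * compound Q j = 1\<^sub>m ?N"
      using D(1) compound_mult[OF D(6,7), of j] by (simp add: compound_one)
    show "compound Q j * compound P j = 1\<^sub>m ?N"
      using D(2) compound_mult[OF D(7,6), of j] by (simp add: compound_one)
    show "compound A j = compound P j * compound B j * compound Q j"
      using D(3) compound_mult[OF D(6,5), of j] compound_mult[OF mult_carrier_mat[OF D(6,5)] D(7), of j]
      by simp
  qed
qed

text \<open>The diagonal of the compound of \<open>T\<close> lists the products over all
  \<open>j\<close>-subsets. Indexing the factors by subsets rather than by values keeps track of
  multiplicities.\<close>

lemma char_poly_compound:
  assumes A: "A \<in> carrier_mat n n" and sim: "similar_mat A T" and ut: "upper_triangular T"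
  shows "char_poly (compound A j) =
    (\<Prod>I \<in> {I. I \<subseteq> {0..<n} \<and> card I = j}. [:- (\<Prod>i\<in>I. T $$ (i, i)), 1:])"
proof -
  let ?S = "index_sets n j"
  have T: "T \<in> carrier_mat n n" using similar_matD[OF sim] A by auto
  have "char_poly (compound A j) = char_poly (compound T j)"
    by (rule char_poly_similar[OF compound_similar[OF A sim]])
  also have "\<dots> = (\<Prod>a \<leftarrow> diag_mat (compound T j). [:- a, 1:])"
    by (rule char_poly_upper_triangular[OF compound_carrier[OF T] compound_upper_triangular[OF T ut]])
  also have "diag_mat (compound T j) = map (\<lambda>I. \<Prod>i\<in>I. T $$ (i, i)) ?S"
    using T
    by (intro nth_equalityI) (auto simp: diag_mat_def compound_triangular_diag[OF T ut])
  also have "(\<Prod>a \<leftarrow> map (\<lambda>I. \<Prod>i\<in>I. T $$ (i, i)) ?S. [:- a, 1:])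
      = (\<Prod>I\<in>set ?S. [:- (\<Prod>i\<in>I. T $$ (i, i)), 1:])"
    by (simp add: prod.distinct_set_conv_list[OF distinct_index_sets] comp_def)
  finally show ?thesis by (simp add: set_index_sets)
qed

section \<open>Perron--Frobenius theory\<close>

definition outer :: "nat \<Rightarrow> 'a :: times vec \<Rightarrow> 'a vec \<Rightarrow> 'a mat" where
  "outer m v w = mat m m (\<lambda>(i, j). v $ i * w $ j)"

lemma outer_carrier [simp]: "outer m v w \<in> carrier_mat m m"
  by (simp add: outer_def)

lemma dim_outer [simp]: "dim_row (outer m v w) = m" "dim_col (outer m v w) = m"
  by (simp_all add: outer_def)

lemma mult_outer:
  fixes X :: "'a :: comm_ring_1 mat"
  assumes "X \<in> carrier_mat m m" "v \<in> carrier_vec m"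
  shows "X * outer m v w = outer m (X *\<^sub>v v) w"
  using assms by (intro eq_matI) (auto simp: outer_def scalar_prod_def sum_distrib_left sum_distrib_right mult_ac)

lemma outer_mult:
  fixes X :: "'a :: comm_ring_1 mat"
  assumes "X \<in> carrier_mat m m" "w \<in> carrier_vec m"
  shows "outer m v w * X = outer m v (X\<^sup>T *\<^sub>v w)"
  using assms by (intro eq_matI) (auto simp: outer_def scalar_prod_def sum_distrib_left mult_ac)

lemma outer_mult_vec:
  fixes z :: "'a :: comm_ring_1 vec"
  assumes "v \<in> carrier_vec m" "w \<in> carrier_vec m" "z \<in> carrier_vec m"
  shows "outer m v w *\<^sub>v z = (w \<bullet> z) \<cdot>\<^sub>v v"
  using assms by (intro eq_vecI) (auto simp: outer_def scalar_prod_def sum_distrib_left sum_distrib_right mult_ac)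

text \<open>This is the matrix determinant lemma. Multiplying the block matrix \<open>M\<close> by
  the unipotent \<open>L\<close> on the right or on the left clears the lower left block either way;
  the two products have equal determinants, read off from different diagonal blocks.\<close>

lemma det_one_minus_outer:
  fixes v w :: "'a :: field vec"
  assumes v: "v \<in> carrier_vec m" and w: "w \<in> carrier_vec m"
  shows "det (1\<^sub>m m - s \<cdot>\<^sub>m outer m v w) = 1 - s * (w \<bullet> v)"
proof -
  define V where "V = mat m 1 (\<lambda>(i, j). s * v $ i)"
  define W where "W = mat 1 m (\<lambda>(i, j). w $ j)"
  define M where "M = four_block_mat (1\<^sub>m m) V W (1\<^sub>m 1)"
  define L where "L = four_block_mat (1\<^sub>m m) (0\<^sub>m m 1) (- W) (1\<^sub>m 1)"
  have V: "V \<in> carrier_mat m 1" and W: "W \<in> carrier_mat 1 m"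
    and nW: "- W \<in> carrier_mat 1 m" by (auto simp: V_def W_def)
  have LMcar: "M \<in> carrier_mat (m + 1) (m + 1)" "L \<in> carrier_mat (m + 1) (m + 1)"
    unfolding M_def L_def by (intro four_block_carrier_mat; simp)+
  have "M * L = four_block_mat (1\<^sub>m m * 1\<^sub>m m + V * - W) (1\<^sub>m m * 0\<^sub>m m 1 + V * 1\<^sub>m 1)
      (W * 1\<^sub>m m + 1\<^sub>m 1 * - W) (W * 0\<^sub>m m 1 + 1\<^sub>m 1 * 1\<^sub>m 1)"
    unfolding M_def L_def by (rule mult_four_block_mat) (use V W nW in auto)
  also have "\<dots> = four_block_mat (1\<^sub>m m - s \<cdot>\<^sub>m outer m v w) V (0\<^sub>m 1 m) (1\<^sub>m 1)"
  proof -
    have "1\<^sub>m m * 1\<^sub>m m + V * - W = 1\<^sub>m m - s \<cdot>\<^sub>m outer m v w"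
      by (intro eq_matI) (auto simp: V_def W_def outer_def scalar_prod_def)
    moreover have "1\<^sub>m m * 0\<^sub>m m 1 + V * 1\<^sub>m 1 = V" using V by (intro eq_matI) auto
    moreover have "W * 1\<^sub>m m + 1\<^sub>m 1 * - W = 0\<^sub>m 1 m" using W nW by (intro eq_matI) auto
    moreover have "W * 0\<^sub>m m 1 + 1\<^sub>m 1 * 1\<^sub>m 1 = (1\<^sub>m 1 :: 'a mat)" using W by (intro eq_matI) auto
    ultimately show ?thesis by simp
  qed
  finally have detM: "det (M * L) = det (1\<^sub>m m - s \<cdot>\<^sub>m outer m v w)"
    using det_four_block_mat_lower_left_zero[OF _ V refl one_carrier_mat,
        of "1\<^sub>m m - s \<cdot>\<^sub>m outer m v w"] by (simp add: minus_carrier_mat)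
  have "L * M = four_block_mat (1\<^sub>m m * 1\<^sub>m m + 0\<^sub>m m 1 * W) (1\<^sub>m m * V + 0\<^sub>m m 1 * 1\<^sub>m 1)
      (- W * 1\<^sub>m m + 1\<^sub>m 1 * W) (- W * V + 1\<^sub>m 1 * 1\<^sub>m 1)"
    unfolding M_def L_def by (rule mult_four_block_mat) (use V W nW in auto)
  also have "\<dots> = four_block_mat (1\<^sub>m m) V (0\<^sub>m 1 m) (mat 1 1 (\<lambda>_. 1 - s * (w \<bullet> v)))"
  proof -
    have "1\<^sub>m m * 1\<^sub>m m + 0\<^sub>m m 1 * W = 1\<^sub>m m" using W by (intro eq_matI) auto
    moreover have "1\<^sub>m m * V + 0\<^sub>m m 1 * 1\<^sub>m 1 = V" using V by (intro eq_matI) auto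
    moreover have "- W * 1\<^sub>m m + 1\<^sub>m 1 * W = 0\<^sub>m 1 m" using W nW by (intro eq_matI) auto
    moreover have "- W * V + 1\<^sub>m 1 * 1\<^sub>m 1 = mat 1 1 (\<lambda>_. 1 - s * (w \<bullet> v))"
      using v by (intro eq_matI)
        (auto simp: V_def W_def scalar_prod_def sum_distrib_left mult_ac sum_negf)
    ultimately show ?thesis by simp
  qed
  finally have "det (L * M) = 1 - s * (w \<bullet> v)"
    using det_four_block_mat_lower_left_zero[OF one_carrier_mat V refl,
        of "mat 1 1 (\<lambda>_. 1 - s * (w \<bullet> v))"] by (simp add: det_single)
  with detM show ?thesis using det_mult[OF LMcar] det_mult[OF LMcar(2,1)] by (simp add: mult.commute)
qed

definition deflate :: "nat \<Rightarrow> 'a :: comm_ring_1 mat \<Rightarrow> 'a \<Rightarrow> 'a vec \<Rightarrow> 'a vec \<Rightarrow> 'a mat" where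
  "deflate m B r v w = B - r \<cdot>\<^sub>m outer m v w"

text \<open>With \<open>w \<bullet> v = 1\<close> the matrix \<open>outer m v w\<close> is the
  projection onto the line of \<open>v\<close> along the kernel of \<open>w\<close>. The field is
  left open because the setting serves a real matrix and its complexification alike.\<close>

locale eigenpair =
  fixes m :: nat and B :: "'a :: field_char_0 mat" and r :: 'a and v w :: "'a vec"
  assumes B: "B \<in> carrier_mat m m" and v: "v \<in> carrier_vec m" and w: "w \<in> carrier_vec m"
    and Bv: "B *\<^sub>v v = r \<cdot>\<^sub>v v" and wB: "B\<^sup>T *\<^sub>v w = r \<cdot>\<^sub>v w" and wv: "w \<bullet> v = 1"
begin

abbreviation "C \<equiv> deflate m B r v w"
abbreviation "Q \<equiv> outer m v w"

lemma C: "C \<in> carrier_mat m m"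
  unfolding deflate_def by (rule minus_carrier_mat) simp

lemma v_nonzero: "v \<noteq> 0\<^sub>v m"
  using wv w by auto

lemma C_mult_vec:
  assumes "z \<in> carrier_vec m"
  shows "C *\<^sub>v z = B *\<^sub>v z - (r * (w \<bullet> z)) \<cdot>\<^sub>v v"
proof -
  have "C *\<^sub>v z = B *\<^sub>v z - (r \<cdot>\<^sub>m Q) *\<^sub>v z"
    unfolding deflate_def by (rule minus_mult_distrib_mat_vec) (use B assms in auto)
  also have "(r \<cdot>\<^sub>m Q) *\<^sub>v z = r \<cdot>\<^sub>v (Q *\<^sub>v z)"
    using assms by (intro eq_vecI) auto
  finally show ?thesis using outer_mult_vec[OF v w assms] by (simp add: smult_smult_assoc)
qed

lemma C_v: "C *\<^sub>v v = 0\<^sub>v m"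
  using C_mult_vec[OF v] Bv wv v by auto

lemma wB_scalar:
  assumes "z \<in> carrier_vec m"
  shows "w \<bullet> (B *\<^sub>v z) = r * (w \<bullet> z)"
  using transpose_vec_mult_scalar[OF B assms w] wB assms w
  by (simp add: smult_scalar_prod_distrib[of _ m])

text \<open>\<open>w\<close> annihilates the image of \<open>C\<close>, so
  \<open>\<mu> * (w \<bullet> z) = 0\<close>; on vectors annihilated by \<open>w\<close>,
  \<open>C\<close> and \<open>B\<close> agree.\<close>

lemma C_eigenvector:
  assumes "eigenvector C z \<mu>" "\<mu> \<noteq> 0"
  shows "w \<bullet> z = 0" "eigenvector B z \<mu>"
proof -
  have z: "z \<in> carrier_vec m" "z \<noteq> 0\<^sub>v m" "C *\<^sub>v z = \<mu> \<cdot>\<^sub>v z"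
    using assms C by (auto simp: eigenvector_def)
  have "w \<bullet> (C *\<^sub>v z) = w \<bullet> (B *\<^sub>v z) - w \<bullet> ((r * (w \<bullet> z)) \<cdot>\<^sub>v v)"
    unfolding C_mult_vec[OF z(1)]
    by (rule scalar_prod_minus_distrib) (use B z v w in auto)
  also have "\<dots> = 0" using wB_scalar[OF z(1)] wv v w by simp
  finally show wz: "w \<bullet> z = 0" using z w assms(2) by simp
  have "B *\<^sub>v z - 0 \<cdot>\<^sub>v v = B *\<^sub>v z" using B z v by (intro eq_vecI) auto
  then show "eigenvector B z \<mu>"
    using z C_mult_vec[OF z(1)] B wz by (simp add: eigenvector_def)
qed

text \<open>As \<open>C * Q = 0\<close>, for \<open>x \<noteq> 0\<close> the matrix
  \<open>x - B\<close> factors as \<open>x - C\<close> times \<open>1 - (r / x) Q\<close>, and the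
  second factor has determinant \<open>1 - r / x\<close>. The linear factors on both sides clear the
  denominator and cover \<open>x = 0\<close>, where \<open>C\<close> has the kernel vector
  \<open>v\<close>.\<close>

lemma char_poly_deflate: "[:0, 1:] * char_poly B = [:- r, 1:] * char_poly C"
proof (rule poly_ext)
  fix x
  show "poly ([:0, 1:] * char_poly B) x = poly ([:- r, 1:] * char_poly C) x"
  proof (cases "x = 0")
    case True
    have "eigenvector C v 0"
      unfolding eigenvector_def using v v_nonzero C_v C by auto
    then have "poly (char_poly C) 0 = 0"
      using eigenvalue_root_char_poly[OF C] by (auto simp: eigenvalue_def)
    then show ?thesis using True by simp
  next
    case False
    have "(x \<cdot>\<^sub>m 1\<^sub>m m - C) * Q = x \<cdot>\<^sub>m Q"
    proof -
      have "(x \<cdot>\<^sub>m 1\<^sub>m m - C) * Q = (x \<cdot>\<^sub>m 1\<^sub>m m) * Q - C * Q"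
        by (rule minus_mult_distrib_mat[of _ m m _ _ m]) (use C in auto)
      also have "C * Q = 0\<^sub>m m m"
        unfolding mult_outer[OF C v] C_v by (intro eq_matI) (auto simp: outer_def)
      also have "(x \<cdot>\<^sub>m 1\<^sub>m m) * Q = x \<cdot>\<^sub>m (1\<^sub>m m * Q)"
        by (rule mult_smult_assoc_mat[of _ m m _ m]) auto
      finally show ?thesis by (auto intro!: eq_matI)
    qed
    then have "(x \<cdot>\<^sub>m 1\<^sub>m m - C) * (1\<^sub>m m - (r / x) \<cdot>\<^sub>m Q)
        = (x \<cdot>\<^sub>m 1\<^sub>m m - C) * 1\<^sub>m m - (r / x) \<cdot>\<^sub>m (x \<cdot>\<^sub>m Q)"
      using minus_carrier_mat[OF C, of "x \<cdot>\<^sub>m 1\<^sub>m m"] mult_minus_distrib_mat[of "x \<cdot>\<^sub>m 1\<^sub>m m - C" m m "1\<^sub>m m" m "(r / x) \<cdot>\<^sub>m Q"]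
        mult_smult_distrib[of "x \<cdot>\<^sub>m 1\<^sub>m m - C" m m Q m "r / x"] by simp
    also have "\<dots> = x \<cdot>\<^sub>m 1\<^sub>m m - B"
      using False C B by (intro eq_matI) (auto simp: deflate_def)
    finally have fac: "(x \<cdot>\<^sub>m 1\<^sub>m m - C) * (1\<^sub>m m - (r / x) \<cdot>\<^sub>m Q) = x \<cdot>\<^sub>m 1\<^sub>m m - B" .
    have cm: "- char_matrix X x = x \<cdot>\<^sub>m 1\<^sub>m m - X" if "X \<in> carrier_mat m m" for X
      using that by (intro eq_matI) (auto simp: char_matrix_def)
    have "det (x \<cdot>\<^sub>m 1\<^sub>m m - B) = det (x \<cdot>\<^sub>m 1\<^sub>m m - C) * (1 - r / x)"
      unfolding fac[symmetric] using C wv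
      by (subst det_mult[of _ m]) (auto simp: det_one_minus_outer[OF v w])
    then show ?thesis
      using False by (simp add: char_poly_matrix[OF B] char_poly_matrix[OF C] cm[OF B] cm[OF C] field_simps)
  qed
qed

text \<open>Comparing orders at \<open>r\<close> in the identity of characteristic polynomials: the
  factor \<open>x\<close> does not vanish at \<open>r\<close>, so the order for \<open>B\<close> is
  one more than that for \<open>C\<close>.\<close>

lemma order_eq_1_iff:
  assumes "r \<noteq> 0"
  shows "order r (char_poly B) = 1 \<longleftrightarrow> \<not> eigenvalue C r"
proof -
  have nz: "char_poly B \<noteq> 0" "char_poly C \<noteq> 0"
    using degree_monic_char_poly[OF B] degree_monic_char_poly[OF C] by auto
  have "order r ([:0, 1:] * char_poly B) = order r (char_poly B)"
    using nz assms by (subst order_mult) (auto intro: order_0I)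
  moreover have "order r ([:- r, 1:] * char_poly C) = 1 + order r (char_poly C)"
  proof -
    have "[:- r, 1:] * char_poly C \<noteq> 0" using nz by (simp only: mult_eq_0_iff) simp
    then show ?thesis using order_power_n_n[of r 1] order_mult[of "[:- r, 1:]" "char_poly C" r] by simp
  qed
  ultimately have "order r (char_poly B) = 1 + order r (char_poly C)"
    unfolding char_poly_deflate by (rule trans[OF sym])
  then show ?thesis
    using order_root[of "char_poly C" r] nz eigenvalue_root_char_poly[OF C] by auto
qed

text \<open>Subtracting from \<open>z\<close> its component along \<open>v\<close> leaves a vector
  annihilated by \<open>w\<close>; were it nonzero, it would be an eigenvector of \<open>C\<close>
  for \<open>r\<close>, which algebraic simplicity excludes.\<close>

lemma eigenspace_simple:
  assumes "r \<noteq> 0" "order r (char_poly B) = 1" "z \<in> carrier_vec m" "B *\<^sub>v z = r \<cdot>\<^sub>v z"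
  shows "z = (w \<bullet> z) \<cdot>\<^sub>v v"
proof (rule ccontr)
  assume ne: "z \<noteq> (w \<bullet> z) \<cdot>\<^sub>v v"
  define y where "y = z - (w \<bullet> z) \<cdot>\<^sub>v v"
  have y: "y \<in> carrier_vec m" using assms v by (simp add: y_def)
  have "y \<noteq> 0\<^sub>v m"
  proof
    assume "y = 0\<^sub>v m"
    then have "y $ i = 0" if "i < m" for i using that by simp
    then have "z $ i = ((w \<bullet> z) \<cdot>\<^sub>v v) $ i" if "i < m" for i
      using that v assms by (simp add: y_def)
    then have "z = (w \<bullet> z) \<cdot>\<^sub>v v" using v assms by (intro eq_vecI) auto
    with ne show False by simp
  qed
  moreover have "w \<bullet> y = 0"
    unfolding y_def using assms v w wv
    by (subst scalar_prod_minus_distrib[of _ m]) auto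
  moreover have "B *\<^sub>v y = r \<cdot>\<^sub>v y"
    unfolding y_def using assms v B mult_mat_vec[OF B v] Bv
    by (subst mult_minus_distrib_mat_vec[OF B])
      (auto intro!: eq_vecI simp: algebra_simps)
  ultimately have "eigenvector C y r"
    using y C v C_mult_vec[OF y] by (auto simp: eigenvector_def intro!: eq_vecI)
  then show False using order_eq_1_iff assms by (auto simp: eigenvalue_def)
qed

text \<open>\<open>C * Q\<close> and \<open>Q * C\<close> vanish and \<open>Q\<close> is idempotent,
  so all mixed terms disappear. The exponent is \<open>Suc k\<close> because the zeroth powers do
  not satisfy the identity.\<close>

lemma pow_deflate: "B ^\<^sub>m Suc k = C ^\<^sub>m Suc k + r ^ Suc k \<cdot>\<^sub>m Q"
proof -
  have CQ: "C * Q = 0\<^sub>m m m"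
    unfolding mult_outer[OF C v] C_v by (intro eq_matI) (auto simp: outer_def)
  have "C\<^sup>T *\<^sub>v w = 0\<^sub>v m"
  proof -
    have "C\<^sup>T = B\<^sup>T - r \<cdot>\<^sub>m outer m w v"
      unfolding deflate_def using B by (intro eq_matI) (auto simp: outer_def)
    also have "(\<dots>) *\<^sub>v w = B\<^sup>T *\<^sub>v w - (r \<cdot>\<^sub>m outer m w v) *\<^sub>v w"
      by (rule minus_mult_distrib_mat_vec) (use B w in auto)
    also have "(r \<cdot>\<^sub>m outer m w v) *\<^sub>v w = r \<cdot>\<^sub>v (outer m w v *\<^sub>v w)"
      using w by (intro eq_vecI) auto
    also have "outer m w v *\<^sub>v w = w"
      using outer_mult_vec[OF w v w] wv comm_scalar_prod[OF v w] by simp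
    finally show ?thesis using wB w by simp
  qed
  then have QC: "Q * C = 0\<^sub>m m m"
    unfolding outer_mult[OF C w] by (intro eq_matI) (auto simp: outer_def)
  have QQ: "Q * Q = Q"
    unfolding mult_outer[OF outer_carrier v] outer_mult_vec[OF v w v] wv by simp
  have dec: "B = C + r \<cdot>\<^sub>m Q" using B by (intro eq_matI) (auto simp: deflate_def)
  show ?thesis
  proof (induction k)
    case 0
    then show ?case using dec B C by simp
  next
    case (Suc k)
    let ?X = "C ^\<^sub>m Suc k"
    have X: "?X \<in> carrier_mat m m" using pow_carrier_mat[OF C, of "Suc k"] .
    have XQ: "?X * Q = 0\<^sub>m m m"
    proof -
      have "?X * Q = C ^\<^sub>m k * (C * Q)"
        using assoc_mult_mat[OF pow_carrier_mat[OF C] C outer_carrier, of k] by simp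
      also have "\<dots> = 0\<^sub>m m m"
        unfolding CQ using pow_carrier_mat[OF C, of k] by (rule right_mult_zero_mat)
      finally show ?thesis .
    qed
    have "B ^\<^sub>m Suc (Suc k) = (?X + r ^ Suc k \<cdot>\<^sub>m Q) * (C + r \<cdot>\<^sub>m Q)"
      using Suc dec by simp
    also have "\<dots> = ?X * (C + r \<cdot>\<^sub>m Q) + (r ^ Suc k \<cdot>\<^sub>m Q) * (C + r \<cdot>\<^sub>m Q)"
      by (rule add_mult_distrib_mat[OF X]) (use C in auto)
    also have "?X * (C + r \<cdot>\<^sub>m Q) = ?X * C"
      using mult_add_distrib_mat[OF X C, of "r \<cdot>\<^sub>m Q"] mult_smult_distrib[OF X, of Q m r] XQ X C
      by simp
    also have "(r ^ Suc k \<cdot>\<^sub>m Q) * (C + r \<cdot>\<^sub>m Q) = r ^ Suc k \<cdot>\<^sub>m (r \<cdot>\<^sub>m Q)"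
    proof -
      have "Q * (C + r \<cdot>\<^sub>m Q) = Q * C + Q * (r \<cdot>\<^sub>m Q)"
        by (rule mult_add_distrib_mat[OF outer_carrier C]) simp
      also have "Q * (r \<cdot>\<^sub>m Q) = r \<cdot>\<^sub>m (Q * Q)"
        by (rule mult_smult_distrib[OF outer_carrier outer_carrier])
      finally have "Q * (C + r \<cdot>\<^sub>m Q) = r \<cdot>\<^sub>m Q" by (simp add: QC QQ)
      then show ?thesis
        by (subst mult_smult_assoc_mat[OF outer_carrier, of _ m]) (use C in auto)
    qed
    also have "\<dots> = r ^ Suc (Suc k) \<cdot>\<^sub>m Q" by (intro eq_matI) auto
    finally show ?case by simp
  qed
qed

end

section \<open>Growth of matrix powers\<close>

lemma smult_pow_mat:
  fixes A :: "'a :: comm_ring_1 mat"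
  assumes A: "A \<in> carrier_mat m m"
  shows "(a \<cdot>\<^sub>m A) ^\<^sub>m k = a ^ k \<cdot>\<^sub>m A ^\<^sub>m k"
proof (induction k)
  case 0
  then show ?case using A by (intro eq_matI) auto
next
  case (Suc k)
  have "(a ^ k \<cdot>\<^sub>m A ^\<^sub>m k) * (a \<cdot>\<^sub>m A) = a ^ k \<cdot>\<^sub>m (a \<cdot>\<^sub>m (A ^\<^sub>m k * A))"
    using mult_smult_assoc_mat[OF pow_carrier_mat[OF A], of "a \<cdot>\<^sub>m A" m "a ^ k" k]
      mult_smult_distrib[OF pow_carrier_mat[OF A] A, of k a] A by simp
  also have "\<dots> = a ^ Suc k \<cdot>\<^sub>m (A ^\<^sub>m k * A)"
    using A by (intro eq_matI) (auto simp: mult_ac)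
  finally show ?case using Suc by simp
qed

text \<open>Dividing by a number \<open>q\<close> strictly between the spectral radius and
  \<open>r\<close> makes the spectral radius less than 1, so the powers of the scaled matrix are
  uniformly bounded. The midpoint serves as \<open>q\<close> and is positive even for spectral
  radius 0.\<close>

lemma spectral_growth:
  assumes C: "C \<in> carrier_mat m m" and m: "m > 0" and r: "r > 0"
    and ev: "\<And>\<mu>. eigenvalue C \<mu> \<Longrightarrow> cmod \<mu> < r"
  obtains c q where "0 < q" "q < r"
    "\<And>k i j. i < m \<Longrightarrow> j < m \<Longrightarrow> cmod ((C ^\<^sub>m k) $$ (i, j)) \<le> c * q ^ k"
proof -
  let ?\<rho> = "spectral_radius C"
  have "?\<rho> \<in> norm ` spectrum C" by (rule spectral_radius_mem_max[OF C m])
  then have \<rho>: "0 \<le> ?\<rho>" "?\<rho> < r" using ev by (auto simp: spectrum_def)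
  define q where "q = (?\<rho> + r) / 2"
  have q: "0 < q" "q < r" "?\<rho> < q" using \<rho> r by (auto simp: q_def)
  let ?D = "complex_of_real (1 / q) \<cdot>\<^sub>m C"
  have D: "?D \<in> carrier_mat m m" using C by simp
  have "cmod \<mu> < 1" if "eigenvalue ?D \<mu>" for \<mu>
  proof -
    from that obtain z where z: "z \<in> carrier_vec m" "z \<noteq> 0\<^sub>v m" "?D *\<^sub>v z = \<mu> \<cdot>\<^sub>v z"
      using C by (auto simp: eigenvalue_def eigenvector_def)
    have "C *\<^sub>v z = complex_of_real q \<cdot>\<^sub>v (?D *\<^sub>v z)"
      using C z(1) q by (intro eq_vecI) auto
    also have "\<dots> = (q * \<mu>) \<cdot>\<^sub>v z" unfolding z(3) by (simp add: smult_smult_assoc)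
    finally have "eigenvalue C (q * \<mu>)" using C z by (auto simp: eigenvalue_def eigenvector_def)
    then have "cmod (q * \<mu>) \<le> ?\<rho>"
      by (intro spectral_radius_mem_max(2)[OF C m]) (auto simp: spectrum_def)
    then show ?thesis using q by (simp add: norm_mult) (smt (verit) mult_le_cancel_left1)
  qed
  moreover have "spectral_radius ?D \<in> norm ` spectrum ?D"
    by (rule spectral_radius_mem_max[OF D m])
  ultimately have "spectral_radius ?D < 1" by (auto simp: spectrum_def)
  then obtain c where c: "\<And>k. norm_bound (?D ^\<^sub>m k) c"
    using spectral_radius_jnf_norm_bound_less_1_upper_triangular[OF D] by auto
  show ?thesis
  proof (rule that[OF q(1,2)])
    fix k i j assume ij: "i < m" "j < m"
    have "cmod ((?D ^\<^sub>m k) $$ (i, j)) \<le> c" using c[of k] C ij by (auto simp: norm_bound_def)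
    moreover have "(?D ^\<^sub>m k) $$ (i, j) = complex_of_real (1 / q) ^ k * (C ^\<^sub>m k) $$ (i, j)"
      unfolding smult_pow_mat[OF C] using C ij by simp
    ultimately have "(1 / q) ^ k * cmod ((C ^\<^sub>m k) $$ (i, j)) \<le> c"
      using q by (simp add: norm_mult norm_power norm_divide)
    then show "cmod ((C ^\<^sub>m k) $$ (i, j)) \<le> c * q ^ k"
      using q by (simp add: field_simps)
  qed
qed

section \<open>Perron's theorem for positive matrices\<close>

lemma mult_mat_vec_nth:
  assumes "P \<in> carrier_mat m m" "u \<in> carrier_vec m" "i < m"
  shows "(P *\<^sub>v u) $ i = (\<Sum>j = 0..<m. P $$ (i, j) * u $ j)"
  using assms by (auto simp: scalar_prod_def)

lemma pow_mat_Suc_left: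
  assumes A: "A \<in> carrier_mat m m"
  shows "A ^\<^sub>m Suc k = A * A ^\<^sub>m k"
proof (induction k)
  case (Suc k)
  have "A ^\<^sub>m Suc (Suc k) = (A * A ^\<^sub>m k) * A" using Suc by simp
  also have "\<dots> = A * A ^\<^sub>m Suc k"
    using assoc_mult_mat[OF A pow_carrier_mat[OF A] A] by simp
  finally show ?case .
qed (use A in simp)

text \<open>Positive entries make \<open>P\<close> monotone on vectors, so the inequality
  \<open>s y \<le> P y\<close> can be iterated.\<close>

lemma pow_mat_mono_growth:
  fixes P :: "real mat"
  assumes P: "P \<in> carrier_mat m m" "positive_mat P" and y: "y \<in> carrier_vec m"
    and s: "s \<ge> 0" "\<And>i. i < m \<Longrightarrow> s * y $ i \<le> (P *\<^sub>v y) $ i" and i: "i < m"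
  shows "s ^ k * y $ i \<le> (P ^\<^sub>m k *\<^sub>v y) $ i"
  using i
proof (induction k arbitrary: i)
  case 0
  then show ?case using P y by simp
next
  case (Suc k)
  have X: "P ^\<^sub>m k *\<^sub>v y \<in> carrier_vec m" by (rule mult_mat_vec_carrier[OF pow_carrier_mat[OF P(1)] y])
  have "s ^ Suc k * y $ i = s ^ k * (s * y $ i)" by simp
  also have "\<dots> \<le> s ^ k * (P *\<^sub>v y) $ i"
    using s Suc.prems by (intro mult_left_mono) auto
  also have "\<dots> = (\<Sum>j = 0..<m. P $$ (i, j) * (s ^ k * y $ j))"
    using mult_mat_vec_nth[OF P(1) y Suc.prems] by (simp add: sum_distrib_left mult_ac)
  also have "\<dots> \<le> (\<Sum>j = 0..<m. P $$ (i, j) * (P ^\<^sub>m k *\<^sub>v y) $ j)"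
    using Suc P by (intro sum_mono mult_left_mono) (auto simp: positive_mat_def less_imp_le)
  also have "\<dots> = (P *\<^sub>v (P ^\<^sub>m k *\<^sub>v y)) $ i"
    by (rule mult_mat_vec_nth[OF P(1) X Suc.prems, symmetric])
  also have "\<dots> = (P ^\<^sub>m Suc k *\<^sub>v y) $ i"
    using assoc_mult_mat_vec[OF P(1) pow_carrier_mat[OF P(1)] y]
    by (simp add: pow_mat_Suc_left[OF P(1)] del: pow_mat.simps)
  finally show ?case .
qed

lemma positive_mult_vec:
  assumes P: "P \<in> carrier_mat m m" "positive_mat P" and u: "u \<in> carrier_vec m"
    and nn: "\<And>i. i < m \<Longrightarrow> u $ i \<ge> 0" and j: "j < m" "u $ j > 0" and i: "i < m"
  shows "(P *\<^sub>v u) $ i > 0"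
  unfolding mult_mat_vec_nth[OF P(1) u i]
proof (rule sum_pos2[of _ j])
  show "0 < P $$ (i, j) * u $ j" using P i j by (auto simp: positive_mat_def)
  show "0 \<le> P $$ (i, k) * u $ k" if "k \<in> {0..<m}" for k
    using P i that nn[of k] by (auto simp: positive_mat_def less_imp_le)
qed (use j in auto)

text \<open>If the moduli of an eigenvector of maximal modulus did not form an eigenvector, one more
  application of \<open>P\<close> would make the inequality strict in every coordinate, and the powers of
  \<open>P\<close> would grow faster than the spectral radius allows.\<close>

lemma perron_modulus:
  fixes P :: "real mat"
  assumes P: "P \<in> carrier_mat m m" "positive_mat P" and m: "m > 0"
    and z: "eigenvector (map_mat complex_of_real P) z \<mu>"
    and \<mu>: "cmod \<mu> = spectral_radius (map_mat complex_of_real P)"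
  defines "u \<equiv> vec m (\<lambda>i. cmod (z $ i))"
  shows "P *\<^sub>v u = cmod \<mu> \<cdot>\<^sub>v u" "\<And>i. i < m \<Longrightarrow> u $ i > 0" "cmod \<mu> > 0"
    "\<exists>c. \<forall>i<m. z $ i = c * complex_of_real (u $ i)"
proof -
  let ?P = "map_mat complex_of_real P"
  let ?\<rho> = "cmod \<mu>"
  have Pc: "?P \<in> carrier_mat m m" using P by simp
  have zc: "z \<in> carrier_vec m" "z \<noteq> 0\<^sub>v m" "?P *\<^sub>v z = \<mu> \<cdot>\<^sub>v z"
    using z P by (auto simp: eigenvector_def)
  have u: "u \<in> carrier_vec m" by (simp add: u_def)
  have ui: "u $ i = cmod (z $ i)" if "i < m" for i using that by (simp add: u_def)
  have Ppos: "P $$ (i, j) > 0" if "i < m" "j < m" for i j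
    using P that by (auto simp: positive_mat_def)
  have zi: "\<mu> * z $ i = (\<Sum>j = 0..<m. P $$ (i, j) * z $ j)" if "i < m" for i
    using mult_mat_vec_nth[OF Pc zc(1) that] zc P that by simp
  obtain j0 where j0: "j0 < m" "u $ j0 > 0"
  proof -
    have "\<exists>j<m. z $ j \<noteq> 0" using zc by (metis carrier_vecD eq_vecI index_zero_vec)
    then show ?thesis using that ui by auto
  qed
  have ge: "?\<rho> * u $ i \<le> (P *\<^sub>v u) $ i" if "i < m" for i
  proof -
    have "?\<rho> * u $ i = cmod (\<mu> * z $ i)" using ui that by (simp add: norm_mult)
    also have "\<dots> \<le> (\<Sum>j = 0..<m. cmod (P $$ (i, j) * z $ j))"
      unfolding zi[OF that] by (rule norm_sum)
    also have "\<dots> = (P *\<^sub>v u) $ i"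
      unfolding mult_mat_vec_nth[OF P(1) u that]
      using ui Ppos[OF that] by (intro sum.cong) (auto simp: norm_mult less_imp_le abs_of_pos)
    finally show ?thesis .
  qed
  have eq: "(P *\<^sub>v u) $ i = ?\<rho> * u $ i" if i: "i < m" for i
  proof (rule ccontr)
    assume "\<not> ?thesis"
    with ge[OF i] have lt: "?\<rho> * u $ i < (P *\<^sub>v u) $ i" by simp
    define y where "y = P *\<^sub>v u"
    have y: "y \<in> carrier_vec m" using P u by (simp add: y_def)
    have ypos: "y $ k > 0" if "k < m" for k
      unfolding y_def by (rule positive_mult_vec[OF P u _ j0 that]) (use ui in auto)
    \<comment> \<open>\<open>P u - \<rho> u\<close> is nonnegative and positive at \<open>i\<close>,
      so \<open>P\<close> maps it to a vector positive everywhere, namely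
      \<open>P y - \<rho> y\<close>.\<close>
    have strict: "?\<rho> * y $ k < (P *\<^sub>v y) $ k" if "k < m" for k
    proof -
      have "(P *\<^sub>v (y - ?\<rho> \<cdot>\<^sub>v u)) $ k > 0"
        by (rule positive_mult_vec[OF P _ _ i _ that]) (use y u lt ge i in \<open>auto simp: y_def\<close>)
      moreover have "P *\<^sub>v (y - ?\<rho> \<cdot>\<^sub>v u) = P *\<^sub>v y - ?\<rho> \<cdot>\<^sub>v y"
        using mult_minus_distrib_mat_vec[OF P(1) y, of "?\<rho> \<cdot>\<^sub>v u"] mult_mat_vec[OF P(1) u] u
        by (simp add: y_def)
      ultimately show ?thesis using that y P by simp
    qed
    \<comment> \<open>The largest \<open>s\<close> with \<open>s y \<le> P y\<close>; by strictness
      in each of the finitely many coordinates it still exceeds \<open>\<rho>\<close>.\<close>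
    define s where "s = Min ((\<lambda>k. (P *\<^sub>v y) $ k / y $ k) ` {0..<m})"
    have "s \<in> (\<lambda>k. (P *\<^sub>v y) $ k / y $ k) ` {0..<m}"
      unfolding s_def using m by (intro Min_in) auto
    then have s: "s > ?\<rho>" using strict ypos by (auto simp: field_simps)
    have sy: "s * y $ k \<le> (P *\<^sub>v y) $ k" if "k < m" for k
    proof -
      have "s \<le> (P *\<^sub>v y) $ k / y $ k" unfolding s_def using that by (intro Min_le) auto
      then show ?thesis using ypos[OF that] by (simp add: field_simps)
    qed
    have s0: "s > 0" using s norm_ge_zero[of \<mu>] by linarith
    have "cmod \<nu> < s" if "eigenvalue ?P \<nu>" for \<nu>
      using spectral_radius_mem_max(2)[OF Pc m, of "cmod \<nu>"] that s \<mu> by (auto simp: spectrum_def)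
    then obtain c q where cq: "0 < q" "q < s"
      "\<And>k i j. i < m \<Longrightarrow> j < m \<Longrightarrow> cmod ((?P ^\<^sub>m k) $$ (i, j)) \<le> c * q ^ k"
      using spectral_growth[OF Pc m s0] by metis
    have bound: "s ^ k * y $ 0 \<le> c * q ^ k * (\<Sum>j = 0..<m. y $ j)" for k
    proof -
      have "s ^ k * y $ 0 \<le> (P ^\<^sub>m k *\<^sub>v y) $ 0"
        using s0 by (intro pow_mat_mono_growth[OF P y _ sy m]) auto
      also have "\<dots> = (\<Sum>j = 0..<m. (P ^\<^sub>m k) $$ (0, j) * y $ j)"
        by (rule mult_mat_vec_nth[OF pow_carrier_mat[OF P(1)] y m])
      also have "\<dots> \<le> (\<Sum>j = 0..<m. c * q ^ k * y $ j)"
      proof (intro sum_mono mult_right_mono)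
        fix j assume j: "j \<in> {0..<m}"
        have "(?P ^\<^sub>m k) = map_mat complex_of_real (P ^\<^sub>m k)"
          by (simp add: of_real_hom.mat_hom_pow[OF P(1)])
        then have "cmod ((?P ^\<^sub>m k) $$ (0, j)) = \<bar>(P ^\<^sub>m k) $$ (0, j)\<bar>"
          using j m P by simp
        then show "(P ^\<^sub>m k) $$ (0, j) \<le> c * q ^ k" using cq(3)[OF m, of j k] j by simp
        show "0 \<le> y $ j" using ypos j by (simp add: less_imp_le)
      qed
      finally show ?thesis by (simp add: sum_distrib_left)
    qed
    have "(\<lambda>k. c * (q / s) ^ k * (\<Sum>j = 0..<m. y $ j)) \<longlonglongrightarrow> c * 0 * (\<Sum>j = 0..<m. y $ j)"
      using cq s0 by (intro tendsto_intros LIMSEQ_power_zero) auto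
    moreover have "y $ 0 \<le> c * (q / s) ^ k * (\<Sum>j = 0..<m. y $ j)" for k
      using bound[of k] s0 by (simp add: power_divide field_simps)
    ultimately have "y $ 0 \<le> c * 0 * (\<Sum>j = 0..<m. y $ j)"
      by (intro LIMSEQ_le_const) auto
    then show False using ypos[OF m] by simp
  qed
  show "P *\<^sub>v u = ?\<rho> \<cdot>\<^sub>v u" using eq u P by (intro eq_vecI) auto
  have pos: "?\<rho> * u $ i > 0" if "i < m" for i
    using positive_mult_vec[OF P u _ j0 that] eq[OF that] ui by simp
  show "?\<rho> > 0" using pos[OF m] ui[OF m] by (simp add: zero_less_mult_iff)
  show upos: "u $ i > 0" if "i < m" for i using pos[OF that] ui[OF that] by (simp add: zero_less_mult_iff)
  \<comment> \<open>Row 0 now attains equality in the triangle inequality. With \<open>c\<close> the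
    phase of its sum, all \<open>z $ j\<close> must have phase \<open>c\<close>, because the weights
    \<open>P $$ (0, j)\<close> are positive.\<close>
  define S where "S = \<mu> * z $ 0"
  define c where "c = S / cmod S"
  have S: "cmod S > 0" using pos[OF m] ui[OF m] by (simp add: S_def norm_mult)
  then have c1: "cmod c = 1" by (simp add: c_def norm_divide)
  have cS: "cnj c * S = cmod S"
    using S by (simp add: c_def complex_norm_square[symmetric] power2_eq_square field_simps)
  have le: "Re (cnj c * z $ j) \<le> u $ j" if "j < m" for j
    using complex_Re_le_cmod[of "cnj c * z $ j"] c1 ui[OF that] by (simp add: norm_mult)
  have "(\<Sum>j = 0..<m. P $$ (0, j) * Re (cnj c * z $ j)) = Re (cnj c * S)"
    unfolding S_def zi[OF m] by (simp add: sum_distrib_left mult_ac)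
      (simp add: algebra_simps)
  also have "\<dots> = cmod S" unfolding cS by simp
  also have "\<dots> = (\<Sum>j = 0..<m. P $$ (0, j) * u $ j)"
    using eq[OF m] mult_mat_vec_nth[OF P(1) u m] ui[OF m] by (simp add: S_def norm_mult)
  finally have "(\<Sum>j = 0..<m. P $$ (0, j) * (u $ j - Re (cnj c * z $ j))) = 0"
    by (simp add: sum_subtractf right_diff_distrib)
  then have zero: "\<forall>j\<in>{0..<m}. P $$ (0, j) * (u $ j - Re (cnj c * z $ j)) = 0"
    using le Ppos[OF m] by (subst (asm) sum_nonneg_eq_0_iff) (auto simp: less_imp_le)
  have Re: "Re (cnj c * z $ j) = u $ j" if "j < m" for j
  proof -
    have "P $$ (0, j) * (u $ j - Re (cnj c * z $ j)) = 0"
      using bspec[OF zero, of j] that by simp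
    then show ?thesis using Ppos[OF m that] by (simp only: mult_eq_0_iff) simp
  qed
  have "z $ j = c * u $ j" if "j < m" for j
  proof -
    have "cmod (cnj c * z $ j) = Re (cnj c * z $ j)"
      using Re[OF that] ui[OF that] c1 by (simp add: norm_mult)
    then have "cnj c * z $ j = u $ j"
      using Re[OF that] cmod_power2[of "cnj c * z $ j"] by (intro complex_eqI) auto
    then have "c * (cnj c * z $ j) = c * u $ j" by simp
    moreover have "c * cnj c = 1" using c1 by (simp add: complex_norm_square[symmetric])
    ultimately show ?thesis by (metis mult.assoc mult_1)
  qed
  then show "\<exists>c. \<forall>i<m. z $ i = c * complex_of_real (u $ i)" by blast
qed

text \<open>The vector \<open>v\<close> collects the moduli of one eigenvector of maximal modulus.
  The last clause covers the whole circle of radius \<open>\<rho>\<close>; hence it carries over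
  from a power of a matrix to the matrix, whose eigenvectors are also eigenvectors of the
  power.\<close>

lemma perron:
  fixes P :: "real mat"
  assumes P: "P \<in> carrier_mat m m" "positive_mat P" and m: "m > 0"
  obtains \<rho> v where "\<rho> > 0" "v \<in> carrier_vec m" "\<And>i. i < m \<Longrightarrow> v $ i > 0" "P *\<^sub>v v = \<rho> \<cdot>\<^sub>v v"
    "\<And>z \<mu>. eigenvector (map_mat complex_of_real P) z \<mu> \<Longrightarrow> cmod \<mu> \<le> \<rho>"
    "\<And>z \<mu>. eigenvector (map_mat complex_of_real P) z \<mu> \<Longrightarrow> cmod \<mu> = \<rho> \<Longrightarrow>
       \<exists>c. z = c \<cdot>\<^sub>v map_vec complex_of_real v"
proof -
  let ?P = "map_mat complex_of_real P"
  let ?\<rho> = "spectral_radius ?P"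
  have Pc: "?P \<in> carrier_mat m m" using P by simp
  obtain \<mu>0 z0 where z0: "eigenvector ?P z0 \<mu>0" "cmod \<mu>0 = ?\<rho>"
    using spectral_radius_mem_max(1)[OF Pc m] by (auto simp: spectrum_def eigenvalue_def)
  define v where "v = vec m (\<lambda>i. cmod (z0 $ i))"
  note K0 = perron_modulus[OF P m z0, folded v_def]
  have v: "v \<in> carrier_vec m" by (simp add: v_def)
  show ?thesis
  proof (rule that[of ?\<rho> v])
    show "?\<rho> > 0" using K0(3) z0(2) by simp
    show "v \<in> carrier_vec m" by (rule v)
    show "\<And>i. i < m \<Longrightarrow> v $ i > 0" by (rule K0(2))
    show "P *\<^sub>v v = ?\<rho> \<cdot>\<^sub>v v" using K0(1) z0(2) by simp
    show "cmod \<mu> \<le> ?\<rho>" if "eigenvector ?P z \<mu>" for z \<mu>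
      using that unfolding spectrum_def eigenvalue_def
      by (intro spectral_radius_mem_max(2)[OF Pc m] imageI) (auto simp: spectrum_def eigenvalue_def)
    show "\<exists>c. z = c \<cdot>\<^sub>v map_vec complex_of_real v"
      if z: "eigenvector ?P z \<mu>" "cmod \<mu> = ?\<rho>" for z \<mu>
    proof -
      define u where "u = vec m (\<lambda>i. cmod (z $ i))"
      note K = perron_modulus[OF P m z, folded u_def]
      have u: "u \<in> carrier_vec m" by (simp add: u_def)
      \<comment> \<open>Two positive eigenvectors are proportional because \<open>v + \<i> u\<close> is an eigenvector of
        maximal modulus as well, so that all its coordinates have the same argument.\<close>
      define y where "y = vec m (\<lambda>i. Complex (v $ i) (u $ i))"
      have y: "y \<in> carrier_vec m" by (simp add: y_def)
      have "?P *\<^sub>v y = complex_of_real ?\<rho> \<cdot>\<^sub>v y"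
      proof (rule eq_vecI)
        fix i assume "i < dim_vec (complex_of_real ?\<rho> \<cdot>\<^sub>v y)"
        then have i: "i < m" using y by simp
        have "(?P *\<^sub>v y) $ i = (\<Sum>j = 0..<m. P $$ (i, j) * Complex (v $ j) (u $ j))"
          unfolding mult_mat_vec_nth[OF Pc y i] using i P by (intro sum.cong) (auto simp: y_def)
        also have "\<dots> = Complex ((P *\<^sub>v v) $ i) ((P *\<^sub>v u) $ i)"
          unfolding mult_mat_vec_nth[OF P(1) v i] mult_mat_vec_nth[OF P(1) u i]
          by (intro complex_eqI) auto
        also have "\<dots> = complex_of_real ?\<rho> * y $ i"
          using K(1) K0(1) z0(2) z(2) i v u by (intro complex_eqI) (auto simp: y_def)
        finally show "(?P *\<^sub>v y) $ i = (complex_of_real ?\<rho> \<cdot>\<^sub>v y) $ i" using i y by simp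
      qed (use P y in auto)
      moreover have "y \<noteq> 0\<^sub>v m"
      proof
        assume "y = 0\<^sub>v m"
        then have "Complex (v $ 0) (u $ 0) = 0" using m by (metis index_vec index_zero_vec(1) y_def)
        then show False using K0(2)[OF m] by (simp add: complex_eq_iff)
      qed
      ultimately have "eigenvector ?P y (complex_of_real ?\<rho>)"
        using y P by (simp add: eigenvector_def)
      moreover have "cmod (complex_of_real ?\<rho>) = ?\<rho>" using z(2) norm_ge_zero[of \<mu>] by simp
      ultimately obtain c where c: "\<And>i. i < m \<Longrightarrow> y $ i = c * complex_of_real (vec m (\<lambda>i. cmod (y $ i)) $ i)"
        using perron_modulus(4)[OF P m] by metis
      have vu: "v $ i = Re c * cmod (y $ i)" "u $ i = Im c * cmod (y $ i)" if "i < m" for i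
        using c[OF that] that by (auto simp: y_def complex_eq_iff)
      have "Re c \<noteq> 0" using vu(1)[OF m] K0(2)[OF m] by auto
      then have uv: "u $ i = Im c / Re c * v $ i" if "i < m" for i
        using vu[OF that] by simp
      obtain d where d: "\<And>i. i < m \<Longrightarrow> z $ i = d * complex_of_real (u $ i)" using K(4) by blast
      have "z = (d * (Im c / Re c)) \<cdot>\<^sub>v map_vec complex_of_real v"
        using z Pc v d uv by (intro eq_vecI) (auto simp: eigenvector_def)
      then show ?thesis by blast
    qed
  qed
qed

section \<open>Eventual positivity and the strong Perron--Frobenius property\<close>

lemma real_multiple:
  assumes "z \<in> carrier_vec m" "v \<in> carrier_vec m"
    and "map_vec complex_of_real z = c \<cdot>\<^sub>v map_vec complex_of_real v"
  shows "z = Re c \<cdot>\<^sub>v v"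
proof (rule eq_vecI)
  fix i assume "i < dim_vec (Re c \<cdot>\<^sub>v v)"
  then have i: "i < m" using assms by simp
  have "complex_of_real (z $ i) = c * complex_of_real (v $ i)"
  proof -
    have "map_vec complex_of_real z $ i = (c \<cdot>\<^sub>v map_vec complex_of_real v) $ i"
      using assms(3) by simp
    then show ?thesis using i assms(1,2) by simp
  qed
  then show "z $ i = (Re c \<cdot>\<^sub>v v) $ i" using i assms by (simp add: complex_eq_iff)
qed (use assms in auto)

text \<open>An eventually positive matrix inherits the Perron vector of its positive powers because it
  commutes with them.\<close>

lemma eventually_positive_perron:
  fixes B :: "real mat"
  assumes B: "B \<in> carrier_mat m m" and m: "m > 0" and ep: "eventually_positive B"
  obtains r v where "r > 0" "v \<in> carrier_vec m" "\<And>i. i < m \<Longrightarrow> v $ i > 0" "B *\<^sub>v v = r \<cdot>\<^sub>v v"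
    "\<And>z \<mu>. eigenvector (map_mat complex_of_real B) z \<mu> \<Longrightarrow> cmod \<mu> \<le> r"
    "\<And>z \<mu>. eigenvector (map_mat complex_of_real B) z \<mu> \<Longrightarrow> cmod \<mu> = r \<Longrightarrow>
       \<exists>c. z = c \<cdot>\<^sub>v map_vec complex_of_real v"
proof -
  obtain k0 where k0: "\<And>k. k \<ge> k0 \<Longrightarrow> positive_mat (B ^\<^sub>m k)"
    using ep by (auto simp: eventually_positive_def)
  \<comment> \<open>Two consecutive positive powers are used: positivity of both
    \<open>r ^ k\<close> and \<open>r ^ Suc k\<close> forces \<open>r > 0\<close>. The exponent
    \<open>k\<close> is nonzero so that moduli can be compared through their \<open>k\<close>-th
    powers.\<close>
  define k where "k = Suc k0"
  have P: "B ^\<^sub>m k \<in> carrier_mat m m" "positive_mat (B ^\<^sub>m k)"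
    and Q: "B ^\<^sub>m Suc k \<in> carrier_mat m m" "positive_mat (B ^\<^sub>m Suc k)"
    using B k0 pow_carrier_mat[OF B] unfolding k_def by (blast intro: le_SucI order_refl)+
  obtain \<rho> v where \<rho>: "\<rho> > 0" and v: "v \<in> carrier_vec m" "\<And>i. i < m \<Longrightarrow> v $ i > 0"
    and Pv: "B ^\<^sub>m k *\<^sub>v v = \<rho> \<cdot>\<^sub>v v"
    and dom: "\<And>z \<mu>. eigenvector (map_mat complex_of_real (B ^\<^sub>m k)) z \<mu> \<Longrightarrow> cmod \<mu> \<le> \<rho>"
    and simple: "\<And>z \<mu>. eigenvector (map_mat complex_of_real (B ^\<^sub>m k)) z \<mu> \<Longrightarrow> cmod \<mu> = \<rho> \<Longrightarrow>
       \<exists>c. z = c \<cdot>\<^sub>v map_vec complex_of_real v"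
    using perron[OF P m] by metis
  have Bvc: "B *\<^sub>v v \<in> carrier_vec m" using B v by simp
  have "B ^\<^sub>m k *\<^sub>v (B *\<^sub>v v) = \<rho> \<cdot>\<^sub>v (B *\<^sub>v v)"
  proof -
    have "B ^\<^sub>m k *\<^sub>v (B *\<^sub>v v) = B ^\<^sub>m Suc k *\<^sub>v v"
      using assoc_mult_mat_vec[OF P(1) B v(1)] by simp
    also have "\<dots> = B *\<^sub>v (B ^\<^sub>m k *\<^sub>v v)"
      unfolding pow_mat_Suc_left[OF B] using assoc_mult_mat_vec[OF B P(1) v(1)] by simp
    also have "\<dots> = \<rho> \<cdot>\<^sub>v (B *\<^sub>v v)" unfolding Pv by (rule mult_mat_vec[OF B v(1)])
    finally show ?thesis .
  qed
  then have ev: "eigenvector (B ^\<^sub>m k) (B *\<^sub>v v) \<rho>" if "B *\<^sub>v v \<noteq> 0\<^sub>v m"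
    using that B Bvc by (simp add: eigenvector_def)
  obtain r where Bv: "B *\<^sub>v v = r \<cdot>\<^sub>v v"
  proof (cases "B *\<^sub>v v = 0\<^sub>v m")
    \<comment> \<open>The zero vector is no eigenvector, so this case is met with
      \<open>r = 0\<close>; it is ruled out later, when \<open>r\<close> is shown to be
      positive.\<close>
    case True
    then have "B *\<^sub>v v = 0 \<cdot>\<^sub>v v" using v by auto
    then show ?thesis by (rule that)
  next
    case False
    have "eigenvector (map_mat complex_of_real (B ^\<^sub>m k)) (map_vec complex_of_real (B *\<^sub>v v)) (complex_of_real \<rho>)"
      by (rule of_real_hom.eigenvector_hom[OF P(1) ev[OF False]])
    from simple[OF this] \<rho> obtain c
      where "map_vec complex_of_real (B *\<^sub>v v) = c \<cdot>\<^sub>v map_vec complex_of_real v" by auto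
    from real_multiple[OF Bvc v(1) this] show ?thesis by (rule that)
  qed
  have v0: "v \<noteq> 0\<^sub>v m" using v(2)[OF m] m by auto
  have evB: "eigenvector B v r" using Bv v v0 B by (simp add: eigenvector_def)
  have pw: "B ^\<^sub>m i *\<^sub>v v = r ^ i \<cdot>\<^sub>v v" for i by (rule eigenvector_pow[OF B evB])
  have \<rho>r: "\<rho> = r ^ k"
    using arg_cong[OF pw[of k, unfolded Pv], of "\<lambda>x. x $ 0"] v(1) v(2)[OF m] m by simp
  have "(B ^\<^sub>m Suc k *\<^sub>v v) $ 0 > 0"
    by (rule positive_mult_vec[OF Q v(1) _ m v(2)[OF m] m]) (use v in \<open>auto simp: less_imp_le\<close>)
  then have "r ^ Suc k > 0"
    unfolding pw using v(1) v(2)[OF m] m by (simp add: zero_less_mult_iff)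
  then have "r * r ^ k > 0" by simp
  then have r: "r > 0" using \<rho> unfolding \<rho>r by (rule zero_less_mult_pos2)
  have evP: "eigenvector (map_mat complex_of_real (B ^\<^sub>m k)) z (\<mu> ^ k)"
    if "eigenvector (map_mat complex_of_real B) z \<mu>" for z \<mu>
    using that eigenvector_pow[OF _ that, of m k] B
    by (simp add: eigenvector_def of_real_hom.mat_hom_pow[OF B])
  show ?thesis
  proof (rule that[OF r v Bv])
    show "cmod \<mu> \<le> r" if "eigenvector (map_mat complex_of_real B) z \<mu>" for z \<mu>
      using dom[OF evP[OF that]] less_imp_le[OF r] unfolding \<rho>r norm_power k_def
      by (rule power_le_imp_le_base)
    show "\<exists>c. z = c \<cdot>\<^sub>v map_vec complex_of_real v"
      if "eigenvector (map_mat complex_of_real B) z \<mu>" "cmod \<mu> = r" for z \<mu>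
      using simple[OF evP[OF that(1)]] that(2) by (simp add: \<rho>r norm_power)
  qed
qed

lemma transpose_pow_mat:
  fixes B :: "'a :: comm_ring_1 mat"
  assumes B: "B \<in> carrier_mat m m"
  shows "(B\<^sup>T) ^\<^sub>m k = (B ^\<^sub>m k)\<^sup>T"
proof (induction k)
  case (Suc k)
  have "(B\<^sup>T) ^\<^sub>m Suc k = (B ^\<^sub>m k)\<^sup>T * B\<^sup>T" using Suc by simp
  also have "\<dots> = (B * B ^\<^sub>m k)\<^sup>T" by (rule transpose_mult[OF B pow_carrier_mat[OF B], symmetric])
  finally show ?case by (simp only: pow_mat_Suc_left[OF B])
qed (use B in simp)

lemma positive_mat_transpose: "positive_mat (A\<^sup>T) \<longleftrightarrow> positive_mat A"
  by (auto simp: positive_mat_def)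

lemma eventually_positive_transpose:
  assumes B: "B \<in> carrier_mat m m" and "eventually_positive B"
  shows "eventually_positive (B\<^sup>T)"
  using assms(2) by (simp add: eventually_positive_def transpose_pow_mat[OF B] positive_mat_transpose)

lemma scalar_prod_pos:
  assumes "v \<in> carrier_vec m" "w \<in> carrier_vec m" "m > 0"
    "\<And>i. i < m \<Longrightarrow> v $ i > 0" "\<And>i. i < m \<Longrightarrow> w $ i > (0 :: real)"
  shows "w \<bullet> v > 0"
  using assms by (auto simp: scalar_prod_def intro!: sum_pos)

text \<open>Evaluating \<open>w \<bullet> (B v)\<close> in two ways shows that the two eigenvalues
  coincide, because positive vectors have \<open>w \<bullet> v > 0\<close>. The factor
  \<open>1 / (w \<bullet> v)\<close> normalises.\<close>

lemma left_right_eigenpair: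
  fixes B :: "real mat"
  assumes B: "B \<in> carrier_mat m m" and m: "m > 0"
    and v: "v \<in> carrier_vec m" "\<And>i. i < m \<Longrightarrow> v $ i > 0" "B *\<^sub>v v = r \<cdot>\<^sub>v v"
    and w: "w \<in> carrier_vec m" "\<And>i. i < m \<Longrightarrow> w $ i > 0" "B\<^sup>T *\<^sub>v w = s \<cdot>\<^sub>v w"
  shows "eigenpair m B r v ((1 / (w \<bullet> v)) \<cdot>\<^sub>v w)"
proof -
  have wv: "w \<bullet> v > 0" by (rule scalar_prod_pos[OF v(1) w(1) m v(2) w(2)])
  have "s * (w \<bullet> v) = (B\<^sup>T *\<^sub>v w) \<bullet> v" using w v by simp
  also have "\<dots> = w \<bullet> (B *\<^sub>v v)" by (rule transpose_vec_mult_scalar[OF B v(1) w(1)])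
  also have "\<dots> = r * (w \<bullet> v)" using w v by simp
  finally have "s = r" using wv by simp
  then have "B\<^sup>T *\<^sub>v ((1 / (w \<bullet> v)) \<cdot>\<^sub>v w) = r \<cdot>\<^sub>v ((1 / (w \<bullet> v)) \<cdot>\<^sub>v w)"
    using mult_mat_vec[OF _ w(1), of "B\<^sup>T" m "1 / (w \<bullet> v)"] B w
    by (simp add: smult_smult_assoc mult.commute)
  then show ?thesis
    using B v w wv by unfold_locales auto
qed

text \<open>An eigenvector of the deflated matrix for \<open>r\<close> would be one of
  \<open>B\<close>, hence a multiple of \<open>v\<close>, yet be annihilated by the left
  eigenvector; so \<open>r\<close> is algebraically simple. An eigenvalue on the circle of radius
  \<open>r\<close> has a multiple of \<open>v\<close> as eigenvector and is therefore
  \<open>r\<close>.\<close>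

lemma eventually_positive_strong_PF:
  fixes B :: "real mat"
  assumes B: "B \<in> carrier_mat m m" and m: "m > 0" and ep: "eventually_positive B"
  shows "strong_PF B"
proof -
  obtain r v where r: "r > 0" and vv: "v \<in> carrier_vec m" "\<And>i. i < m \<Longrightarrow> v $ i > 0" "B *\<^sub>v v = r \<cdot>\<^sub>v v"
    and dom: "\<And>z \<mu>. eigenvector (map_mat complex_of_real B) z \<mu> \<Longrightarrow> cmod \<mu> \<le> r"
    and simple: "\<And>z \<mu>. eigenvector (map_mat complex_of_real B) z \<mu> \<Longrightarrow> cmod \<mu> = r \<Longrightarrow>
       \<exists>c. z = c \<cdot>\<^sub>v map_vec complex_of_real v"
    using eventually_positive_perron[OF B m ep] by metis
  have BT: "B\<^sup>T \<in> carrier_mat m m" using B by simp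
  obtain s w where w: "w \<in> carrier_vec m" "\<And>i. i < m \<Longrightarrow> w $ i > 0" "B\<^sup>T *\<^sub>v w = s \<cdot>\<^sub>v w"
    using eventually_positive_perron[OF BT m eventually_positive_transpose[OF B ep]] by metis
  define x where "x = (1 / (w \<bullet> v)) \<cdot>\<^sub>v w"
  interpret eigenpair m B r v x
    unfolding x_def by (rule left_right_eigenpair[OF B m vv w])
  have vn: "eigenvector B v r" using B vv v_nonzero by (simp add: eigenvector_def)
  have "\<not> eigenvalue C r"
  proof
    assume "eigenvalue C r"
    then obtain z where z: "eigenvector C z r" by (auto simp: eigenvalue_def)
    note zz = C_eigenvector[OF z less_imp_neq[OF r, symmetric]]
    have zc: "z \<in> carrier_vec m" "z \<noteq> 0\<^sub>v m" using zz(2) B by (auto simp: eigenvector_def)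
    obtain c where "map_vec complex_of_real z = c \<cdot>\<^sub>v map_vec complex_of_real v"
      using simple[OF of_real_hom.eigenvector_hom[OF B zz(2)]] r by auto
    from real_multiple[OF zc(1) vv(1) this] have zv: "z = Re c \<cdot>\<^sub>v v" .
    with zz(1) wv v eigenpair.w[OF eigenpair_axioms]
    have "Re c = 0" by simp
    with zv zc v show False by auto
  qed
  then have ord: "order r (char_poly B) = 1" using order_eq_1_iff r by simp
  have lt: "cmod \<mu> < r" if \<mu>: "eigenvalue (map_mat complex_of_real B) \<mu>" "\<mu> \<noteq> complex_of_real r" for \<mu>
  proof (rule ccontr)
    assume "\<not> cmod \<mu> < r"
    obtain z where z: "eigenvector (map_mat complex_of_real B) z \<mu>" using \<mu> by (auto simp: eigenvalue_def)
    with dom \<open>\<not> cmod \<mu> < r\<close> have "cmod \<mu> = r" by fastforce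
    then obtain c where c: "z = c \<cdot>\<^sub>v map_vec complex_of_real v" using simple[OF z] by auto
    have "eigenvector (map_mat complex_of_real B) (map_vec complex_of_real v) (complex_of_real r)"
      by (rule of_real_hom.eigenvector_hom[OF B vn])
    then have "map_mat complex_of_real B *\<^sub>v z = complex_of_real r \<cdot>\<^sub>v z"
      using mult_mat_vec[of "map_mat complex_of_real B" m m "map_vec complex_of_real v" c] B v
      by (simp add: c eigenvector_def smult_smult_assoc mult.commute)
    then have eq: "\<mu> \<cdot>\<^sub>v z = complex_of_real r \<cdot>\<^sub>v z" using z by (simp add: eigenvector_def)
    have zc: "z \<in> carrier_vec m" "z \<noteq> 0\<^sub>v m" using z B by (auto simp: eigenvector_def)
    then obtain i where i: "i < m" "z $ i \<noteq> 0"
      by (metis carrier_vecD eq_vecI index_zero_vec)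
    then have "\<mu> = complex_of_real r" using arg_cong[OF eq, of "\<lambda>x. x $ i"] zc by simp
    with \<mu> show False by simp
  qed
  show ?thesis
    unfolding strong_PF_def
    using r vn ord lt vv by (intro exI[of _ r]) (auto simp: eigenvalue_def)
qed

lemma strong_PF_pair:
  fixes B :: "real mat"
  assumes B: "B \<in> carrier_mat m m" and m: "m > 0" and PF: "strong_PF B" "strong_PF (B\<^sup>T)"
  obtains r v w where "eigenpair m B r v w" "r > 0" "order r (char_poly B) = 1"
    "\<And>i. i < m \<Longrightarrow> v $ i > 0" "\<And>i. i < m \<Longrightarrow> w $ i > 0"
    "\<And>\<mu>. eigenvalue (map_mat complex_of_real B) \<mu> \<Longrightarrow> \<mu> \<noteq> complex_of_real r \<Longrightarrow> cmod \<mu> < r"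
proof -
  obtain r v where r: "r > 0" "order r (char_poly B) = 1"
    "\<And>\<mu>. eigenvalue (map_mat complex_of_real B) \<mu> \<Longrightarrow> \<mu> \<noteq> complex_of_real r \<Longrightarrow> cmod \<mu> < r"
    and "eigenvector B v r" and "\<And>i. i < dim_vec v \<Longrightarrow> v $ i > 0"
    using PF(1) by (auto simp: strong_PF_def)
  then have v: "v \<in> carrier_vec m" "\<And>i. i < m \<Longrightarrow> v $ i > 0" "B *\<^sub>v v = r \<cdot>\<^sub>v v"
    using B by (auto simp: eigenvector_def)
  obtain s w where "eigenvector (B\<^sup>T) w s" and "\<And>i. i < dim_vec w \<Longrightarrow> w $ i > 0"
    using PF(2) by (auto simp: strong_PF_def)
  then have w: "w \<in> carrier_vec m" "\<And>i. i < m \<Longrightarrow> w $ i > 0" "B\<^sup>T *\<^sub>v w = s \<cdot>\<^sub>v w"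
    using B by (auto simp: eigenvector_def)
  have "w \<bullet> v > 0" by (rule scalar_prod_pos[OF v(1) w(1) m v(2) w(2)])
  then show ?thesis
    using that[OF left_right_eigenpair[OF B m v w] r(1,2) v(2) _ r(3)] w by simp
qed

text \<open>Each entry of the \<open>k\<close>-th power, divided by \<open>r ^ k\<close>, tends to
  \<open>v $ i * w $ j > 0\<close>; the finitely many entries then share a threshold.\<close>

lemma strong_PF_eventually_positive:
  fixes B :: "real mat"
  assumes B: "B \<in> carrier_mat m m" and m: "m > 0" and PF: "strong_PF B" "strong_PF (B\<^sup>T)"
  shows "eventually_positive B"
proof -
  obtain r v w where pair: "eigenpair m B r v w" and r: "r > 0" and ord: "order r (char_poly B) = 1"
    and pos: "\<And>i. i < m \<Longrightarrow> v $ i > 0" "\<And>i. i < m \<Longrightarrow> w $ i > 0"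
    and lt: "\<And>\<mu>. eigenvalue (map_mat complex_of_real B) \<mu> \<Longrightarrow> \<mu> \<noteq> complex_of_real r \<Longrightarrow> cmod \<mu> < r"
    using strong_PF_pair[OF assms] by metis
  interpret eigenpair m B r v w by (rule pair)
  let ?h = complex_of_real
  \<comment> \<open>The growth bound concerns complex matrices, so the deflation is repeated over
    the complex numbers; it commutes with the embedding.\<close>
  interpret c: eigenpair m "map_mat ?h B" "?h r" "map_vec ?h v" "map_vec ?h w"
  proof
    show "map_mat ?h B *\<^sub>v map_vec ?h v = ?h r \<cdot>\<^sub>v map_vec ?h v"
      using of_real_hom.mult_mat_vec_hom[OF B v, where 'a = complex] Bv
      by (simp add: of_real_hom.vec_hom_smult)
    have "map_mat ?h (B\<^sup>T) *\<^sub>v map_vec ?h w = ?h r \<cdot>\<^sub>v map_vec ?h w"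
      using of_real_hom.mult_mat_vec_hom[of "B\<^sup>T" m m w, where 'a = complex] wB B w
      by (simp add: of_real_hom.vec_hom_smult)
    then show "(map_mat ?h B)\<^sup>T *\<^sub>v map_vec ?h w = ?h r \<cdot>\<^sub>v map_vec ?h w"
      by (simp add: map_mat_transpose)
    have "map_vec ?h w \<bullet> map_vec ?h v = ?h (w \<bullet> v)"
      using v w by (auto simp: scalar_prod_def)
    then show "map_vec ?h w \<bullet> map_vec ?h v = 1" using wv by simp
  qed (use B v w in auto)
  have hC: "map_mat ?h C = c.C"
    using B v w by (intro eq_matI) (auto simp: deflate_def outer_def)
  have cC: "map_mat ?h C \<in> carrier_mat m m" using C by simp
  have "cmod \<mu> < r" if \<mu>: "eigenvalue (map_mat ?h C) \<mu>" for \<mu>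
  proof (cases "\<mu> = 0")
    case False
    from \<mu> obtain z where "eigenvector c.C z \<mu>" by (auto simp: eigenvalue_def hC)
    from c.C_eigenvector(2)[OF this False] have ev: "eigenvalue (map_mat ?h B) \<mu>"
      by (auto simp: eigenvalue_def)
    have "\<mu> \<noteq> ?h r"
    proof
      assume "\<mu> = ?h r"
      then have "poly (map_poly ?h (char_poly C)) (?h r) = 0"
        using \<mu> eigenvalue_root_char_poly[OF cC] of_real_hom.char_poly_hom[OF C, where 'a = complex]
        by simp
      then have "poly (char_poly C) r = 0" by (simp add: of_real_hom.poly_map_poly_0)
      then show False using order_eq_1_iff r ord eigenvalue_root_char_poly[OF C] by simp
    qed
    then show ?thesis by (rule lt[OF ev])
  qed (use r in simp)
  then obtain c q where cq: "0 < q" "q < r"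
    "\<And>k i j. i < m \<Longrightarrow> j < m \<Longrightarrow> cmod (((map_mat ?h C) ^\<^sub>m k) $$ (i, j)) \<le> c * q ^ k"
    using spectral_growth[OF cC m r] by metis
  have ev: "\<forall>\<^sub>F k in sequentially. (B ^\<^sub>m k) $$ (i, j) > 0" if ij: "i < m" "j < m" for i j
  proof -
    have "(\<lambda>k. c * (q / r) ^ k) \<longlonglongrightarrow> c * 0"
      using cq r by (intro tendsto_intros LIMSEQ_power_zero) auto
    then have "\<forall>\<^sub>F k in sequentially. c * (q / r) ^ k < v $ i * w $ j"
      using pos ij by (intro order_tendstoD) auto
    then show ?thesis
      \<comment> \<open>\<open>k > 0\<close> is required because the splitting of the power holds
        for exponents of the form \<open>Suc l\<close>.\<close>
      using eventually_gt_at_top[of "0 :: nat"]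
    proof eventually_elim
      case (elim k)
      then obtain l where k: "k = Suc l" by (cases k) auto
      have "(B ^\<^sub>m k) $$ (i, j) = (C ^\<^sub>m k) $$ (i, j) + r ^ k * (v $ i * w $ j)"
        unfolding k pow_deflate using ij pow_carrier_mat[OF C, of "Suc l"] by (simp add: outer_def del: pow_mat.simps)
      moreover have "\<bar>(C ^\<^sub>m k) $$ (i, j)\<bar> \<le> c * q ^ k"
        using cq(3)[OF ij, of k] ij C
        by (simp add: of_real_hom.mat_hom_pow[OF C, symmetric])
      moreover have "c * q ^ k < r ^ k * (v $ i * w $ j)"
        using elim r by (simp add: power_divide field_simps)
      ultimately show ?case by linarith
    qed
  qed
  have "\<forall>\<^sub>F k in sequentially. \<forall>i\<in>{..<m}. \<forall>j\<in>{..<m}. (B ^\<^sub>m k) $$ (i, j) > 0"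
    using ev by (intro eventually_ball_finite ballI) auto
  then obtain N where "\<forall>k\<ge>N. \<forall>i<m. \<forall>j<m. (B ^\<^sub>m k) $$ (i, j) > 0"
    by (auto simp: eventually_sequentially)
  then show ?thesis
    unfolding eventually_positive_def positive_mat_def pow_mat_dim_square[OF B] by blast
qed

section \<open>Markov systems and minors\<close>

lemma S_plus_set_finite:
  "finite {sign_changes_nz y | y. dim_vec y = dim_vec x \<and> Q y}"
proof (rule finite_subset)
  show "{sign_changes_nz y | y. dim_vec y = dim_vec x \<and> Q y} \<subseteq> {..dim_vec x}"
  proof
    fix c assume "c \<in> {sign_changes_nz y | y. dim_vec y = dim_vec x \<and> Q y}"
    then obtain y where "c = sign_changes_nz y" "dim_vec y = dim_vec x" by auto
    moreover have "sign_changes_nz y \<le> card {..<dim_vec y}"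
      unfolding sign_changes_nz_def by (rule card_mono) auto
    ultimately show "c \<in> {..dim_vec x}" by simp
  qed
qed simp

text \<open>Discrete intermediate value theorem: if the last step does not change the sign, the
  right endpoint can be moved back by one.\<close>

lemma sign_change_between:
  fixes y :: "nat \<Rightarrow> real"
  assumes "a < b" "y a * y b < 0" "\<And>i. i \<le> b \<Longrightarrow> y i \<noteq> 0"
  shows "\<exists>p\<in>{a..<b}. y p * y (Suc p) < 0"
  using assms
proof (induction b)
  case (Suc b)
  show ?case
  proof (cases "y b * y (Suc b) < 0")
    case True
    then show ?thesis using Suc.prems by (intro bexI[of _ b]) auto
  next
    case False
    then have same: "y b * y (Suc b) > 0" using Suc.prems(3)[of b] Suc.prems(3)[of "Suc b"]
      by (simp add: not_less less_le)
    then have "a \<noteq> b" using Suc.prems(2) by auto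
    then have "a < b" using Suc.prems by simp
    moreover have "y a * y b < 0"
      using same Suc.prems(2) by (auto simp: zero_less_mult_iff mult_less_0_iff)
    ultimately obtain p where "p \<in> {a..<b}" "y p * y (Suc p) < 0"
      using Suc.IH Suc.prems(3) by fastforce
    then show ?thesis by (intro bexI[of _ p]) auto
  qed
qed simp

text \<open>Zeros at the chosen indices receive the sign that the alternation prescribes, all other
  zeros the value 1. The completed vector alternates strictly along \<open>I\<close>, hence changes
  sign in each of the \<open>j\<close> disjoint gaps between consecutive elements.\<close>

lemma S_plus_ge:
  fixes s :: real
  assumes x: "x \<in> carrier_vec d" and I: "I \<subseteq> {0..<d}" "card I = Suc j" and s: "s \<noteq> 0"
    and alt: "\<And>k. k \<le> j \<Longrightarrow> s * (-1) ^ k * x $ pick I k \<ge> 0"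
  shows "j \<le> S_plus x"
proof -
  have "finite I" using I by (auto intro: finite_subset)
  have mono: "pick I k < pick I l" if "k < l" "l \<le> j" for k l
    using pick_mono_le[of l I k] that I by simp
  have inj: "k = l" if "pick I k = pick I l" "k \<le> j" "l \<le> j" for k l
    using mono[of k l] mono[of l k] that by (cases k l rule: linorder_cases) auto
  define y where "y = vec d (\<lambda>l. if x $ l \<noteq> 0 then x $ l
    else if \<exists>k\<le>j. l = pick I k \<and> s * (-1) ^ k < 0 then -1 else 1)"
  have y_nz: "y $ l \<noteq> 0" if "l < d" for l using that by (auto simp: y_def)
  have pd: "pick I k < d" if "k \<le> j" for k using pick_less[OF I(1)] that I by simp
  have alty: "s * (-1) ^ k * y $ pick I k > 0" if k: "k \<le> j" for k
  proof -
    define t where "t = s * (-1) ^ k"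
    have t: "t \<noteq> 0" using s by (simp add: t_def)
    have "(\<exists>k'\<le>j. pick I k = pick I k' \<and> s * (-1) ^ k' < 0) \<longleftrightarrow> t < 0"
      unfolding t_def using inj k by metis
    then have "y $ pick I k = (if x $ pick I k \<noteq> 0 then x $ pick I k else if t < 0 then -1 else 1)"
      using pd[OF k] by (simp add: y_def)
    moreover have "t * x $ pick I k \<ge> 0" using alt[OF k] by (simp add: t_def)
    ultimately show ?thesis
      unfolding t_def[symmetric] using t by (auto simp: less_le)
  qed
  have ch: "\<exists>p\<in>{pick I k..<pick I (Suc k)}. y $ p * y $ Suc p < 0" if k: "k < j" for k
  proof (rule sign_change_between)
    show "pick I k < pick I (Suc k)" using mono k by simp
    show "y $ i \<noteq> 0" if "i \<le> pick I (Suc k)" for i using y_nz that pd[of "Suc k"] k by simp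
    have "0 < (s * (-1) ^ k * y $ pick I k) * (s * (-1) ^ Suc k * y $ pick I (Suc k))"
      using k by (intro mult_pos_pos[OF alty alty]) auto
    also have "\<dots> = - ((s * (-1) ^ k)\<^sup>2 * (y $ pick I k * y $ pick I (Suc k)))"
      by (simp add: power2_eq_square algebra_simps)
    finally show "y $ pick I k * y $ pick I (Suc k) < 0"
      using s by (simp add: mult_less_0_iff zero_less_mult_iff)
  qed
  then obtain p where p: "\<And>k. k < j \<Longrightarrow> p k \<in> {pick I k..<pick I (Suc k)} \<and> y $ p k * y $ Suc (p k) < 0"
    by metis
  have "strict_mono_on {..<j} p"
  proof (rule strict_mono_onI)
    fix k l assume kl: "k \<in> {..<j}" "l \<in> {..<j}" "k < l"
    then have "pick I (Suc k) \<le> pick I l"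
      using mono[of "Suc k" l] by (cases "Suc k = l") auto
    then show "p k < p l" using p[of k] p[of l] kl by auto
  qed
  then have "card (p ` {..<j}) = j"
    by (simp add: card_image strict_mono_on_imp_inj_on)
  moreover have "p ` {..<j} \<subseteq> {i. Suc i < dim_vec y \<and> y $ i * y $ Suc i < 0}"
  proof
    fix i assume "i \<in> p ` {..<j}"
    then obtain k where k: "k < j" "i = p k" by auto
    then have "Suc i \<le> pick I (Suc k)" using p[OF k(1)] by simp
    also have "\<dots> < d" using pd[of "Suc k"] k by simp
    finally show "i \<in> {i. Suc i < dim_vec y \<and> y $ i * y $ Suc i < 0}" using p[OF k(1)] k by (simp add: y_def)
  qed
  then have "card (p ` {..<j}) \<le> sign_changes_nz y"
    unfolding sign_changes_nz_def by (intro card_mono) (auto intro: finite_subset[of _ "{..<dim_vec y}"])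
  ultimately have "j \<le> sign_changes_nz y" by simp
  also have "\<dots> \<le> S_plus x"
    unfolding S_plus_def
  proof (rule Max_ge[OF S_plus_set_finite])
    show "sign_changes_nz y \<in> {sign_changes_nz y | y. dim_vec y = dim_vec x \<and>
      (\<forall>i < dim_vec x. (x $ i \<noteq> 0 \<longrightarrow> y $ i = x $ i) \<and> (x $ i = 0 \<longrightarrow> y $ i \<in> {-1, 1}))}"
      using x by (intro CollectI exI[of _ y]) (auto simp: y_def)
  qed
  finally show ?thesis .
qed

text \<open>The list consists of the index 0 and each index just after a sign change. The last
  conjunct, that the latest chosen entry has the sign of the current one, is what the induction
  needs to extend the alternation.\<close>

lemma alternating_sublist:
  fixes y :: "nat \<Rightarrow> real"
  assumes "\<And>i. i \<le> d \<Longrightarrow> y i \<noteq> 0"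
  shows "\<exists>xs s. s \<noteq> 0 \<and> sorted_wrt (<) xs \<and> set xs \<subseteq> {0..d} \<and>
    length xs = Suc (card {i. i < d \<and> y i * y (Suc i) < 0}) \<and>
    (\<forall>k<length xs. s * (-1) ^ k * y (xs ! k) > 0) \<and> y (last xs) * y d > 0"
  using assms
proof (induction d)
  case 0
  then have "y 0 \<noteq> 0" by simp
  then show ?case by (intro exI[of _ "[0]"] exI[of _ "y 0"]) (auto simp: zero_less_mult_iff linorder_neq_iff)
next
  case (Suc d)
  let ?Z = "\<lambda>d. {i. i < d \<and> y i * y (Suc i) < 0}"
  obtain xs s where xs: "s \<noteq> 0" "sorted_wrt (<) xs" "set xs \<subseteq> {0..d}" "length xs = Suc (card (?Z d))"
    "\<And>k. k < length xs \<Longrightarrow> s * (-1) ^ k * y (xs ! k) > 0" "y (last xs) * y d > 0"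
  proof -
    from Suc.prems have "\<And>i. i \<le> d \<Longrightarrow> y i \<noteq> 0" by simp
    from Suc.IH[OF this] show ?thesis using that by blast
  qed
  show ?case
  proof (cases "y d * y (Suc d) < 0")
    case True
    have "?Z (Suc d) = insert d (?Z d)" using True by (auto simp: less_Suc_eq)
    then have card: "card (?Z (Suc d)) = Suc (card (?Z d))" by simp
    have "xs \<noteq> []" using xs(4) by auto
    then have last: "last xs = xs ! card (?Z d)" using xs(4) by (simp add: last_conv_nth)
    have "s * (-1) ^ card (?Z d) * y (last xs) > 0" using xs(4) xs(5) last by simp
    then have "s * (-1) ^ length xs * y (Suc d) > 0"
      using xs(6) True unfolding xs(4)
      by (auto simp: zero_less_mult_iff mult_less_0_iff)
    then have "s * (-1) ^ k * y ((xs @ [Suc d]) ! k) > 0" if "k < length (xs @ [Suc d])" for k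
      using xs(5)[of k] that by (cases "k = length xs") (auto simp: nth_append)
    moreover have "sorted_wrt (<) (xs @ [Suc d])"
      using xs by (auto simp: sorted_wrt_append less_Suc_eq_le)
    moreover have "y (Suc d) \<noteq> 0" using Suc.prems by simp
    ultimately show ?thesis
      using xs card by (intro exI[of _ "xs @ [Suc d]"] exI[of _ s])
        (auto simp: zero_less_mult_iff linorder_neq_iff)
  next
    case False
    then have "?Z (Suc d) = ?Z d" by (auto simp: less_Suc_eq)
    moreover have "y d * y (Suc d) > 0"
      using False Suc.prems[of d] Suc.prems[of "Suc d"] by (simp add: not_less less_le)
    then have "y (last xs) * y (Suc d) > 0"
      using xs(6) by (auto simp: zero_less_mult_iff)
    ultimately show ?thesis
      using xs by (intro exI[of _ xs] exI[of _ s]) auto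
  qed
qed

text \<open>Converse of \<open>S_plus_ge\<close>. A completion attaining the maximum has a strictly
  alternating list of indices, which can be cut to length \<open>Suc j\<close>; at zeros of
  \<open>x\<close> the inequality becomes weak but survives.\<close>

lemma S_plus_geD:
  assumes x: "x \<in> carrier_vec d" and d: "d > 0" and j: "j \<le> S_plus x"
  obtains I s where "I \<subseteq> {0..<d}" "card I = Suc j" "(s :: real) \<noteq> 0"
    "\<And>k. k \<le> j \<Longrightarrow> s * (-1) ^ k * x $ pick I k \<ge> 0"
proof -
  let ?A = "{sign_changes_nz y | y. dim_vec y = dim_vec x \<and>
      (\<forall>i < dim_vec x. (x $ i \<noteq> 0 \<longrightarrow> y $ i = x $ i) \<and> (x $ i = 0 \<longrightarrow> y $ i \<in> {-1, 1}))}"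
  have "sign_changes_nz (vec d (\<lambda>i. if x $ i = 0 then 1 else x $ i)) \<in> ?A"
    using x by (intro CollectI exI[of _ "vec d (\<lambda>i. if x $ i = 0 then 1 else x $ i)"]) auto
  then have "S_plus x \<in> ?A"
    unfolding S_plus_def by (intro Max_in S_plus_set_finite) auto
  then obtain y where y: "S_plus x = sign_changes_nz y" "dim_vec y = d"
    "\<And>i. i < d \<Longrightarrow> (x $ i \<noteq> 0 \<longrightarrow> y $ i = x $ i) \<and> (x $ i = 0 \<longrightarrow> y $ i \<in> {-1, 1})"
    using x by auto
  have "y $ i \<noteq> 0" if "i \<le> d - 1" for i
  proof -
    have "i < d" using that d by linarith
    then show ?thesis using y(3)[of i] by (cases "x $ i = 0") auto
  qed
  then obtain xs s where xs: "s \<noteq> 0" "sorted_wrt (<) xs" "set xs \<subseteq> {0..d - 1}"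
    "length xs = Suc (card {i. i < d - 1 \<and> y $ i * y $ Suc i < 0})"
    "\<And>k. k < length xs \<Longrightarrow> s * (-1) ^ k * y $ (xs ! k) > 0"
  proof -
    assume "\<And>i. i \<le> d - 1 \<Longrightarrow> y $ i \<noteq> 0"
    from alternating_sublist[of "d - 1" "($) y", OF this] show ?thesis using that by blast
  qed
  have "{i. i < d - 1 \<and> y $ i * y $ Suc i < 0} = {i. Suc i < dim_vec y \<and> y $ i * y $ Suc i < 0}"
    using y(2) by auto
  then have len: "length xs = Suc (S_plus x)" using xs(4) y(1) by (simp add: sign_changes_nz_def)
  define zs where "zs = take (Suc j) xs"
  have zs: "sorted_wrt (<) zs" "length zs = Suc j" "set zs \<subseteq> {0..<d}"
    using xs(2) len j xs(3) d set_take_subset[of "Suc j" xs]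
    by (auto simp: zs_def sorted_wrt_take)
  show ?thesis
  proof (rule that[of "set zs" s])
    show "card (set zs) = Suc j" using zs by (simp add: strict_sorted_iff distinct_card)
    show "s * (-1) ^ k * x $ pick (set zs) k \<ge> 0" if k: "k \<le> j" for k
    proof -
      have pk: "pick (set zs) k = xs ! k"
        using pick_sorted_list[OF zs(1), of k] zs(2) k by (simp add: zs_def)
      have "xs ! k < d" using nth_mem[of k xs] xs(3) len j k d by fastforce
      then show ?thesis
        unfolding pk using y(3)[of "xs ! k"] xs(5)[of k] len j k by (cases "x $ (xs ! k) = 0") auto
    qed
  qed (use zs xs in auto)
qed

section \<open>Minors formed from the first columns\<close>

text \<open>Removing one element shifts the later ranks by one. This is the index shift in
  \<open>mat_delete\<close>, so deleted rows correspond to smaller index sets.\<close>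

lemma pick_remove:
  assumes "finite S" "i < card S" "Suc a < card S"
  shows "pick (S - {pick S i}) a = pick S (if a < i then a else Suc a)"
proof -
  define b where "b = (if a < i then a else Suc a)"
  have b: "b < card S" "b \<noteq> i" using assms by (auto simp: b_def)
  have mono: "pick S k < pick S l \<longleftrightarrow> k < l" if "k < card S" "l < card S" for k l
    using pick_mono_le[of l S k] pick_mono_le[of k S l] that by (cases k l rule: linorder_cases) auto
  have "pick S b \<noteq> pick S i" using mono[of b i] mono[of i b] b assms by (metis nat_neq_iff)
  then have mem: "pick S b \<in> S - {pick S i}" using pick_in_set_le[OF b(1)] by simp
  have "{c \<in> S - {pick S i}. c < pick S b} = {c \<in> S. c < pick S b} - {pick S i}" by auto
  moreover have "card ({c \<in> S. c < pick S b} - {pick S i}) = a"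
  proof (cases "a < i")
    case True
    then have "\<not> pick S i < pick S b" using mono[of i b] b assms by (simp add: b_def)
    then have "{c \<in> S. c < pick S b} - {pick S i} = {c \<in> S. c < pick S b}" by auto
    then show ?thesis using card_pick_le[OF b(1)] True by (simp add: b_def)
  next
    case False
    then have "pick S i < pick S b" using mono[of i b] b assms by (simp add: b_def)
    then have "pick S i \<in> {c \<in> S. c < pick S b}" using pick_in_set_le[OF assms(2)] by simp
    then show ?thesis using card_pick_le[OF b(1)] False assms(1) by (simp add: b_def card_Diff_singleton)
  qed
  ultimately show ?thesis
    using pick_card_in_set[OF mem] by (simp add: b_def[symmetric])
qed

text \<open>The coordinate at \<open>I\<close> of the wedge product of the first
  \<open>card I\<close> columns; the number of columns is read off from \<open>I\<close>.\<close>

definition initial_minor :: "real mat \<Rightarrow> nat set \<Rightarrow> real" where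
  "initial_minor P I = det (mat (card I) (card I) (\<lambda>(a, b). P $$ (pick I a, b)))"

definition col_comb :: "real mat \<Rightarrow> nat \<Rightarrow> (nat \<Rightarrow> real) \<Rightarrow> real vec" where
  "col_comb P j c = vec (dim_row P) (\<lambda>l. \<Sum>i<j. c i * P $$ (l, i))"

lemma submatrix_initial_minor:
  assumes "P \<in> carrier_mat n n" "I \<subseteq> {0..<n}" "card I = j" "j \<le> n"
  shows "det (submatrix P I {0..<j}) = initial_minor P I"
proof -
  have "submatrix P I {0..<j} = mat (card I) (card {0..<j}) (\<lambda>(a, b). P $$ (pick I a, pick {0..<j} b))"
    by (rule submatrix_pick[OF assms(1,2)]) (use assms in auto)
  also have "\<dots> = mat (card I) (card I) (\<lambda>(a, b). P $$ (pick I a, b))"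
    using assms by (intro eq_matI) (auto simp: pick_initial)
  finally show ?thesis by (simp add: initial_minor_def)
qed

text \<open>The entries of a kernel vector of the square submatrix are the coefficients of the
  combination.\<close>

lemma minor_zero_iff:
  assumes P: "P \<in> carrier_mat n n" and I: "I \<subseteq> {0..<n}" "card I = j"
  shows "initial_minor P I = 0 \<longleftrightarrow>
    (\<exists>c. (\<exists>i<j. c i \<noteq> 0) \<and> (\<forall>l\<in>I. col_comb P j c $ l = 0))"
proof -
  let ?M = "mat j j (\<lambda>(a, b). P $$ (pick I a, b))"
  have "finite I" using I by (auto intro: finite_subset)
  then have img: "I = pick I ` {0..<j}" using bij_betw_pick[of I] I by (simp add: bij_betw_def)
  have cc: "col_comb P j (($) v) $ pick I a = (?M *\<^sub>v v) $ a" if "v \<in> carrier_vec j" "a < j" for v a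
    using that P pick_less[OF I(1), of a] I
    by (auto simp: col_comb_def scalar_prod_def lessThan_atLeast0 mult.commute)
  show ?thesis
  proof
    assume "initial_minor P I = 0"
    then obtain v where v: "v \<in> carrier_vec j" "v \<noteq> 0\<^sub>v j" "?M *\<^sub>v v = 0\<^sub>v j"
      using det_0_iff_vec_prod_zero_field[of ?M j] I by (auto simp: initial_minor_def)
    have "\<exists>i<j. v $ i \<noteq> 0" using v by (metis carrier_vecD eq_vecI index_zero_vec)
    moreover have "\<forall>l\<in>I. col_comb P j (($) v) $ l = 0"
      using cc[OF v(1)] v(3) by (subst img) auto
    ultimately show "\<exists>c. (\<exists>i<j. c i \<noteq> 0) \<and> (\<forall>l\<in>I. col_comb P j c $ l = 0)" by blast
  next
    assume "\<exists>c. (\<exists>i<j. c i \<noteq> 0) \<and> (\<forall>l\<in>I. col_comb P j c $ l = 0)"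
    then obtain c where c: "\<exists>i<j. c i \<noteq> 0" "\<forall>l\<in>I. col_comb P j c $ l = 0" by blast
    define v where "v = vec j c"
    have v: "v \<in> carrier_vec j" "v \<noteq> 0\<^sub>v j" using c(1) by (auto simp: v_def vec_eq_iff)
    have "col_comb P j (($) v) = col_comb P j c" by (simp add: col_comb_def v_def)
    then have "?M *\<^sub>v v = 0\<^sub>v j"
      using c(2) cc[OF v(1)] pick_in_set_le[of _ I] I by (intro eq_vecI) auto
    then show "initial_minor P I = 0"
      using det_0_iff_vec_prod_zero_field[of ?M j] I v by (auto simp: initial_minor_def)
  qed
qed

text \<open>Cramer's rule, through the adjugate: the coefficients solve the square system on the
  rows \<open>I\<close> with a unit vector as right-hand side.\<close>

lemma minor_solve:
  assumes P: "P \<in> carrier_mat n n" and I: "I \<subseteq> {0..<n}" "card I = j"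
    and nz: "initial_minor P I \<noteq> 0" and p: "p \<in> I"
  obtains c where "\<exists>i<j. c i \<noteq> 0" "\<And>l. l \<in> I \<Longrightarrow> col_comb P j c $ l = (if l = p then 1 else 0)"
proof -
  let ?M = "mat j j (\<lambda>(a, b). P $$ (pick I a, b))"
  have M: "?M \<in> carrier_mat j j" by simp
  have det: "det ?M \<noteq> 0" using nz I by (simp add: initial_minor_def)
  define v where "v = (1 / det ?M) \<cdot>\<^sub>v (adj_mat ?M *\<^sub>v vec j (\<lambda>a. if pick I a = p then 1 else 0))"
  have adj: "adj_mat ?M \<in> carrier_mat j j" "?M * adj_mat ?M = det ?M \<cdot>\<^sub>m 1\<^sub>m j"
    using adj_mat[OF M] by auto
  have v: "v \<in> carrier_vec j" using adj by (simp add: v_def)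
  have Mv: "?M *\<^sub>v v = vec j (\<lambda>a. if pick I a = p then 1 else 0)"
  proof -
    let ?e = "vec j (\<lambda>a. if pick I a = p then 1 else (0 :: real))"
    have "?M *\<^sub>v v = (1 / det ?M) \<cdot>\<^sub>v (?M *\<^sub>v (adj_mat ?M *\<^sub>v ?e))"
      unfolding v_def using adj by (intro mult_mat_vec[OF M]) simp
    also have "?M *\<^sub>v (adj_mat ?M *\<^sub>v ?e) = (det ?M \<cdot>\<^sub>m 1\<^sub>m j) *\<^sub>v ?e"
      unfolding adj(2)[symmetric] by (rule assoc_mult_mat_vec[OF M adj(1), symmetric]) simp
    also have "\<dots> = det ?M \<cdot>\<^sub>v ?e" by (intro eq_vecI) auto
    finally show ?thesis using det by (simp add: smult_smult_assoc)
  qed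
  have "finite I" using I by (auto intro: finite_subset)
  then have img: "I = pick I ` {0..<j}" using bij_betw_pick[of I] I by (simp add: bij_betw_def)
  have cc: "col_comb P j (($) v) $ pick I a = (?M *\<^sub>v v) $ a" if "a < j" for a
    using that P pick_less[OF I(1), of a] I v
    by (auto simp: col_comb_def scalar_prod_def lessThan_atLeast0 mult.commute)
  have sol: "col_comb P j (($) v) $ l = (if l = p then 1 else 0)" if "l \<in> I" for l
  proof -
    have "l \<in> pick I ` {0..<j}" using that img by blast
    then obtain a where "a < j" "l = pick I a" by auto
    then show ?thesis using cc Mv by simp
  qed
  moreover have "\<exists>i<j. v $ i \<noteq> 0"
  proof (rule ccontr)
    assume "\<not> ?thesis"
    then have "col_comb P j (($) v) $ p = 0" using p I P by (auto simp: col_comb_def)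
    then show False using sol[OF p] by simp
  qed
  ultimately show ?thesis using that by blast
qed

text \<open>Laplace expansion along the last column of the singular matrix formed by the first \<open>j\<close>
  columns and their linear combination.\<close>

lemma alternating_minor_sum:
  assumes P: "P \<in> carrier_mat n n" and S: "S \<subseteq> {0..<n}" "card S = Suc j"
  shows "(\<Sum>k\<le>j. (-1) ^ k * col_comb P j c $ pick S k * initial_minor P (S - {pick S k})) = 0"
proof -
  have fin: "finite S" using S by (auto intro: finite_subset)
  define y where "y = col_comb P j c"
  define Z where "Z = mat (Suc j) (Suc j) (\<lambda>(a, b). if b < j then P $$ (pick S a, b) else y $ pick S a)"
  have Z: "Z \<in> carrier_mat (Suc j) (Suc j)" by (simp add: Z_def)
  \<comment> \<open>The last column of \<open>Z\<close> is the combination of the others with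
    coefficients \<open>c\<close>; the entry -1 makes this a kernel vector that is nonzero even if
    all \<open>c i\<close> vanish.\<close>
  define v where "v = vec (Suc j) (\<lambda>b. if b < j then c b else -1)"
  have "Z *\<^sub>v v = 0\<^sub>v (Suc j)"
  proof (rule eq_vecI)
    fix a assume "a < dim_vec (0\<^sub>v (Suc j) :: real vec)"
    then have a: "a < Suc j" by simp
    have "(Z *\<^sub>v v) $ a = (\<Sum>b = 0..<Suc j. Z $$ (a, b) * v $ b)"
      using a by (auto simp: Z_def v_def scalar_prod_def)
    also have "\<dots> = (\<Sum>b = 0..<j. P $$ (pick S a, b) * c b) - y $ pick S a"
      using a by (simp add: Z_def v_def)
    also have "\<dots> = 0"
      using pick_less[OF S(1), of a] S a P by (simp add: y_def col_comb_def lessThan_atLeast0 mult.commute)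
    finally show "(Z *\<^sub>v v) $ a = 0\<^sub>v (Suc j) $ a" using a by simp
  qed (simp add: Z_def)
  moreover have "v $ j = -1" by (simp add: v_def)
  then have "v \<noteq> 0\<^sub>v (Suc j)" by auto
  moreover have "v \<in> carrier_vec (Suc j)" by (simp add: v_def)
  ultimately have "det Z = 0" using det_0_iff_vec_prod_zero_field[OF Z] by blast
  moreover have "det Z = (\<Sum>k<Suc j. Z $$ (k, j) * cofactor Z k j)"
    by (rule laplace_expansion_column[OF Z]) simp
  moreover have "\<dots> = (\<Sum>k\<le>j. (-1) ^ j * ((-1) ^ k * y $ pick S k * initial_minor P (S - {pick S k})))"
    unfolding lessThan_Suc_atMost
  proof (rule sum.cong[OF refl])
    fix k assume "k \<in> {..j}"
    then have k: "k \<le> j" by simp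
    have "pick S k \<in> S" using pick_in_set_le[of k S] S k by simp
    then have card: "card (S - {pick S k}) = j" using S fin by (simp add: card_Diff_singleton)
    have "mat_delete Z k j = mat j j (\<lambda>(a, b). P $$ (pick (S - {pick S k}) a, b))"
      using k S fin by (intro eq_matI) (auto simp: mat_delete_def Z_def pick_remove)
    then have "det (mat_delete Z k j) = initial_minor P (S - {pick S k})"
      by (simp add: initial_minor_def card)
    then show "Z $$ (k, j) * cofactor Z k j
        = (-1) ^ j * ((-1) ^ k * y $ pick S k * initial_minor P (S - {pick S k}))"
      using k by (simp add: cofactor_def Z_def power_add mult_ac)
  qed
  ultimately show ?thesis by (simp add: sum_distrib_left[symmetric] y_def)
qed

section \<open>Bounds on sign changes and minors of one sign\<close>

text \<open>If \<open>S_plus\<close> were at least \<open>j\<close>, the combination would alternate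
  weakly on a set \<open>S\<close> of \<open>j + 1\<close> indices. With minors of one sign, all
  terms of the alternating relation then have the same sign, so they all vanish; the combination is
  zero on \<open>S\<close>, and a minor with rows in \<open>S\<close> is zero.\<close>

lemma S_plus_le_of_minors:
  assumes P: "P \<in> carrier_mat n n" and j: "1 \<le> j" "j \<le> n"
    and sgn: "\<And>I. I \<subseteq> {0..<n} \<Longrightarrow> card I = j \<Longrightarrow> e * initial_minor P I > 0"
    and c: "\<exists>i<j. c i \<noteq> 0"
  shows "S_plus (col_comb P j c) \<le> j - 1"
proof (rule ccontr)
  let ?y = "col_comb P j c"
  assume "\<not> ?thesis"
  then have "j \<le> S_plus ?y" using j by simp
  moreover have y: "?y \<in> carrier_vec n" using P by (simp add: col_comb_def)
  moreover have "n > 0" using j by simp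
  ultimately obtain S s where S: "S \<subseteq> {0..<n}" "card S = Suc j" and s: "s \<noteq> 0"
    and alt: "\<And>k. k \<le> j \<Longrightarrow> s * (-1) ^ k * ?y $ pick S k \<ge> 0"
    using S_plus_geD[OF y] by blast
  have fin: "finite S" using S by (auto intro: finite_subset)
  let ?M = "\<lambda>k. initial_minor P (S - {pick S k})"
  have sub: "S - {pick S k} \<subseteq> {0..<n}" "card (S - {pick S k}) = j" if "k \<le> j" for k
    using S fin pick_in_set_le[of k S] that by (auto simp: card_Diff_singleton)
  have M: "e * ?M k > 0" if "k \<le> j" for k using sgn sub[OF that] by simp
  have "(\<Sum>k\<le>j. (s * (-1) ^ k * ?y $ pick S k) * (e * ?M k))
      = s * e * (\<Sum>k\<le>j. (-1) ^ k * ?y $ pick S k * ?M k)"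
    by (simp add: sum_distrib_left mult_ac)
  also have "\<dots> = 0" using alternating_minor_sum[OF P S] by simp
  finally have sum0: "(\<Sum>k\<le>j. (s * (-1) ^ k * ?y $ pick S k) * (e * ?M k)) = 0" .
  define t where "t k = (s * (-1) ^ k * ?y $ pick S k) * (e * ?M k)" for k
  have "0 \<le> t k" if "k \<in> {..j}" for k
    unfolding t_def using that by (intro mult_nonneg_nonneg[OF alt less_imp_le[OF M]]) auto
  from sum_nonneg_eq_0_iff[OF finite_atMost this, of j] sum0
  have "\<forall>k\<in>{..j}. (s * (-1) ^ k * ?y $ pick S k) * (e * ?M k) = 0" by (simp add: t_def)
  then have zero: "?y $ pick S k = 0" if "k \<le> j" for k
    using M[OF that] s that by auto
  have "?y $ l = 0" if "l \<in> S" for l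
  proof -
    have "pick S ` {0..<Suc j} = S" using bij_betw_pick[OF fin] S(2) by (simp add: bij_betw_def)
    then have "l \<in> pick S ` {0..<Suc j}" using that by simp
    then obtain k where "k < Suc j" "l = pick S k" by auto
    then show ?thesis using zero by simp
  qed
  then have "initial_minor P (S - {pick S j}) = 0"
    using minor_zero_iff[OF P sub[OF order_refl]] c by blast
  then show False using M[of j] by simp
qed

text \<open>A zero minor yields a combination vanishing on \<open>I\<close>. Adjoining a row
  \<open>p\<close> outside \<open>I\<close>, which exists since \<open>j < n\<close>, gives
  \<open>j + 1\<close> indices with at most one nonzero value; this alternates weakly for a suitable
  overall sign, contradicting the bound.\<close>

lemma minors_nonzero_of_S_plus_le:
  assumes P: "P \<in> carrier_mat n n" and j: "1 \<le> j" "j < n"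
    and le: "\<And>c. \<exists>i<j. c i \<noteq> 0 \<Longrightarrow> S_plus (col_comb P j c) \<le> j - 1"
    and I: "I \<subseteq> {0..<n}" "card I = j"
  shows "initial_minor P I \<noteq> 0"
proof
  assume "initial_minor P I = 0"
  then obtain c where c: "\<exists>i<j. c i \<noteq> 0" "\<And>l. l \<in> I \<Longrightarrow> col_comb P j c $ l = 0"
    using minor_zero_iff[OF P I] by blast
  let ?y = "col_comb P j c"
  have fin: "finite I" using I by (auto intro: finite_subset)
  have "I \<noteq> {0..<n}" using I j by auto
  then have "\<exists>p. p \<in> {0..<n} \<and> p \<notin> I" using I by blast
  then obtain p where p: "p < n" "p \<notin> I" by auto
  define S where "S = insert p I"
  have S: "S \<subseteq> {0..<n}" "card S = Suc j" using I p fin by (auto simp: S_def)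
  obtain m where m: "m < Suc j" "p = pick S m"
  proof -
    have "pick S ` {0..<Suc j} = S"
      using bij_betw_pick[of S] S fin by (simp add: bij_betw_def S_def)
    then have "p \<in> pick S ` {0..<Suc j}" by (simp add: S_def)
    then show ?thesis using that by auto
  qed
  define s where "s = (if (-1) ^ m * ?y $ p \<ge> 0 then 1 else - 1 :: real)"
  have "j \<le> S_plus ?y"
  proof (rule S_plus_ge[OF _ S])
    show "?y \<in> carrier_vec n" using P by (simp add: col_comb_def)
    show "s \<noteq> 0" by (simp add: s_def)
    show "0 \<le> s * (-1) ^ k * ?y $ pick S k" if "k \<le> j" for k
    proof (cases "pick S k = p")
      case True
      have "k = m"
      proof (rule inj_onD)
        show "inj_on (pick S) {0..<Suc j}"
          using bij_betw_pick[of S] S fin by (simp add: bij_betw_def S_def)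
      qed (use m True that in auto)
      then show ?thesis using m by (simp add: s_def)
    next
      case False
      then have "pick S k \<in> I" using pick_in_set_le[of k S] S that by (simp add: S_def)
      then show ?thesis using c by simp
    qed
  qed
  then show False using le[OF c(1)] j by simp
qed

text \<open>A combination of the columns vanishing on all but two consecutive elements of \<open>S\<close> has equal
  signs there, since otherwise it would alternate weakly on the \<open>j + 1\<close> elements of \<open>S\<close>.\<close>

lemma adjacent_minors_same_sign:
  assumes P: "P \<in> carrier_mat n n" and j: "1 \<le> j"
    and le: "\<And>c. \<exists>i<j. c i \<noteq> 0 \<Longrightarrow> S_plus (col_comb P j c) \<le> j - 1"
    and nz: "\<And>I. I \<subseteq> {0..<n} \<Longrightarrow> card I = j \<Longrightarrow> initial_minor P I \<noteq> 0"
    and S: "S \<subseteq> {0..<n}" "card S = Suc j" and m: "m < j"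
  shows "initial_minor P (S - {pick S m}) * initial_minor P (S - {pick S (Suc m)}) > 0"
proof -
  have fin: "finite S" using S by (auto intro: finite_subset)
  have inj: "pick S k = pick S l \<longleftrightarrow> k = l" if "k \<le> j" "l \<le> j" for k l
    using bij_betw_pick[OF fin] S that by (auto simp: bij_betw_def inj_on_def less_Suc_eq_le)
  have memS: "pick S k \<in> S" if "k \<le> j" for k using pick_in_set_le[of k S] S that by simp
  let ?M = "\<lambda>k. initial_minor P (S - {pick S k})"
  have sub: "S - {pick S k} \<subseteq> {0..<n}" "card (S - {pick S k}) = j" if "k \<le> j" for k
    using S fin memS[OF that] by (auto simp: card_Diff_singleton)
  have Mnz: "?M k \<noteq> 0" if "k \<le> j" for k using nz sub[OF that] by simp
  have "pick S m \<in> S - {pick S (Suc m)}" using memS[of m] inj[of m "Suc m"] m by simp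
  then obtain c where c: "\<exists>i<j. c i \<noteq> 0"
    and cl: "\<And>l. l \<in> S - {pick S (Suc m)} \<Longrightarrow> col_comb P j c $ l = (if l = pick S m then 1 else 0)"
    using minor_solve[OF P sub[of "Suc m"] Mnz[of "Suc m"]] m by (metis Suc_leI)
  define y where "y = col_comb P j c"
  have ym: "y $ pick S m = 1" and y0: "\<And>k. k \<le> j \<Longrightarrow> k \<noteq> m \<Longrightarrow> k \<noteq> Suc m \<Longrightarrow> y $ pick S k = 0"
    using cl memS inj m by (auto simp: y_def)
  \<comment> \<open>Only the terms \<open>m\<close> and \<open>Suc m\<close> survive, so the value
    of \<open>y\<close> at the second position is the quotient of the two minors.\<close>
  have "(\<Sum>k\<le>j. (-1) ^ k * y $ pick S k * ?M k) = (\<Sum>k\<in>{m, Suc m}. (-1) ^ k * y $ pick S k * ?M k)"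
    using m y0 by (intro sum.mono_neutral_right) auto
  then have "(-1) ^ m * ?M m + (-1) ^ Suc m * y $ pick S (Suc m) * ?M (Suc m) = 0"
    using alternating_minor_sum[OF P S, of c] ym by (simp add: y_def)
  then have "(-1) ^ m * (?M m - y $ pick S (Suc m) * ?M (Suc m)) = 0" by (simp add: algebra_simps)
  then have eq: "?M m = y $ pick S (Suc m) * ?M (Suc m)" by simp
  have "y $ pick S (Suc m) > 0"
  proof (rule ccontr)
    assume neg: "\<not> ?thesis"
    have "j \<le> S_plus y"
    proof (rule S_plus_ge[OF _ S])
      show "y \<in> carrier_vec n" using P by (simp add: y_def col_comb_def)
      show "(-1 :: real) ^ m \<noteq> 0" by simp
      show "0 \<le> (-1) ^ m * (-1) ^ k * y $ pick S k" if "k \<le> j" for k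
        using y0[OF that] ym neg
        by (cases "k = m"; cases "k = Suc m") (auto simp: power_add[symmetric])
    qed
    then show False using le[OF c] j by (simp add: y_def)
  qed
  then show ?thesis
    unfolding eq using Mnz[of "Suc m"] m by (auto simp: mult.assoc zero_less_mult_iff linorder_neq_iff)
qed

text \<open>Neighbouring deletions compare all \<open>j\<close>-subsets of one set with
  \<open>j + 1\<close> elements. Any two \<open>j\<close>-subsets are linked by exchanging one
  element at a time, with \<open>card (I - J)\<close> decreasing.\<close>

lemma minors_same_sign:
  assumes P: "P \<in> carrier_mat n n" and j: "1 \<le> j"
    and le: "\<And>c. \<exists>i<j. c i \<noteq> 0 \<Longrightarrow> S_plus (col_comb P j c) \<le> j - 1"
    and nz: "\<And>I. I \<subseteq> {0..<n} \<Longrightarrow> card I = j \<Longrightarrow> initial_minor P I \<noteq> 0"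
    and I: "I \<subseteq> {0..<n}" "card I = j" and J: "J \<subseteq> {0..<n}" "card J = j"
  shows "initial_minor P I * initial_minor P J > 0"
proof -
  have trans: "a * c > 0" if "a * b > 0" "b * c > 0" for a b c :: real
    using that by (auto simp: zero_less_mult_iff)
  have same: "initial_minor P (S - {a}) * initial_minor P (S - {b}) > 0"
    if S: "S \<subseteq> {0..<n}" "card S = Suc j" and ab: "a \<in> S" "b \<in> S" for S a b
  proof -
    have fin: "finite S" using S by (auto intro: finite_subset)
    let ?M = "\<lambda>k. initial_minor P (S - {pick S k})"
    have "initial_minor P (S - {pick S 0}) \<noteq> 0"
      using S fin pick_in_set_le[of 0 S] by (intro nz) (auto simp: card_Diff_singleton)
    then have M0: "?M 0 * ?M 0 > 0" by (auto simp: zero_less_mult_iff linorder_neq_iff)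
    have up: "?M k * ?M 0 > 0" if "k \<le> j" for k
      using that
    proof (induction k)
      case 0
      show ?case by (rule M0)
    next
      case (Suc k)
      have "?M (Suc k) * ?M k > 0"
        unfolding mult.commute[of "?M (Suc k)"]
        by (rule adjacent_minors_same_sign[OF P j le nz S]) (use Suc.prems in auto)
      moreover have "?M k * ?M 0 > 0" using Suc by simp
      ultimately show ?case by (rule trans)
    qed
    have "S = pick S ` {0..<Suc j}" using bij_betw_pick[OF fin] S by (simp add: bij_betw_def)
    then have "a \<in> pick S ` {0..<Suc j}" "b \<in> pick S ` {0..<Suc j}" using ab by auto
    then obtain k l where kl: "k \<le> j" "a = pick S k" "l \<le> j" "b = pick S l"
      by (auto simp: less_Suc_eq_le)
    show ?thesis
      unfolding kl using trans[OF up[OF kl(1)], of "?M l"] up[OF kl(3)] by (simp add: mult.commute)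
  qed
  show ?thesis
    using I
  proof (induction "card (I - J)" arbitrary: I rule: less_induct)
    case (less I)
    have fin: "finite I" "finite J" using less J by (auto intro: finite_subset)
    show ?case
    proof (cases "I = J")
      case True
      then show ?thesis using nz[OF J] by (auto simp: zero_less_mult_iff linorder_neq_iff)
    next
      case False
      then have "\<not> J \<subseteq> I" "\<not> I \<subseteq> J"
        using card_subset_eq[OF fin(1), of J] card_subset_eq[OF fin(2), of I] less J by auto
      then obtain a b where ab: "a \<in> I" "a \<notin> J" "b \<in> J" "b \<notin> I" by auto
      define S where "S = insert b I"
      have S: "S \<subseteq> {0..<n}" "card S = Suc j" "S - {b} = I"
        using less fin ab J by (auto simp: S_def)
      have one: "initial_minor P I * initial_minor P (S - {a}) > 0"
        using same[OF S(1,2), of b a] S(3) ab by (simp add: S_def)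
      have "(S - {a}) - J = (I - J) - {a}" using ab by (auto simp: S_def)
      then have "card ((S - {a}) - J) < card (I - J)"
        using ab fin by (intro psubset_card_mono) auto
      then have "initial_minor P (S - {a}) * initial_minor P J > 0"
      proof (rule less.hyps)
        show "S - {a} \<subseteq> {0..<n}" using S by auto
        show "card (S - {a}) = j" using S fin ab by (simp add: S_def card_Diff_singleton)
      qed
      with one show ?thesis by (rule trans)
    qed
  qed
qed

text \<open>Below \<open>n\<close> the bound on \<open>S_plus\<close> makes the minors nonzero. For
  \<open>j = n\<close> the only minor is the determinant of the whole matrix; that it is nonzero
  will come from linear independence of eigenvectors.\<close>

lemma markov_system_minors:
  assumes mk: "markov_system n n x" and det: "det (mat n n (\<lambda>(l, i). x i $ l)) \<noteq> 0"
    and j: "1 \<le> j" "j \<le> n"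
  obtains e :: real where "\<And>I. I \<subseteq> {0..<n} \<Longrightarrow> card I = j \<Longrightarrow>
    e * det (submatrix (mat n n (\<lambda>(l, i). x i $ l)) I {0..<j}) > 0"
proof -
  let ?P = "mat n n (\<lambda>(l, i). x i $ l)"
  have P: "?P \<in> carrier_mat n n" by simp
  have cc: "col_comb ?P j c = vec n (\<lambda>l. \<Sum>i<j. c i * x i $ l)" for c
    using j by (auto simp: col_comb_def)
  have le: "S_plus (col_comb ?P j c) \<le> j - 1" if "\<exists>i<j. c i \<noteq> 0" for c
    using mk j that unfolding cc markov_system_def by auto
  have nz: "initial_minor ?P I \<noteq> 0" if I: "I \<subseteq> {0..<n}" "card I = j" for I
  proof (cases "j < n")
    case True
    then show ?thesis by (rule minors_nonzero_of_S_plus_le[OF P j(1) _ le I])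
  next
    case False
    then have "j = n" using j by simp
    moreover from this have "I = {0..<n}" using I by (intro card_subset_eq) auto
    moreover have "mat n n (\<lambda>(a, b). ?P $$ (pick {0..<n} a, b)) = ?P"
      by (intro eq_matI) (auto simp: pick_initial)
    ultimately show ?thesis using det by (simp add: initial_minor_def)
  qed
  show ?thesis
  proof (rule that[of "initial_minor ?P {0..<j}"])
    fix I assume I: "I \<subseteq> {0..<n}" "card I = j"
    show "initial_minor ?P {0..<j} * det (submatrix ?P I {0..<j}) > 0"
      unfolding submatrix_initial_minor[OF P I j(2)]
      by (rule minors_same_sign[OF P j(1) le nz _ _ I]) (use j in auto)
  qed
qed

lemma minors_markov_system:
  assumes x: "\<And>i. i < n \<Longrightarrow> x i \<in> carrier_vec n \<and> x i \<noteq> 0\<^sub>v n"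
    and sgn: "\<And>j. 1 \<le> j \<Longrightarrow> j \<le> n \<Longrightarrow> \<exists>e :: real. \<forall>I. I \<subseteq> {0..<n} \<longrightarrow> card I = j \<longrightarrow>
      e * det (submatrix (mat n n (\<lambda>(l, i). x i $ l)) I {0..<j}) > 0"
  shows "markov_system n n x"
proof -
  let ?P = "mat n n (\<lambda>(l, i). x i $ l)"
  have P: "?P \<in> carrier_mat n n" by simp
  have "S_plus (vec n (\<lambda>l. \<Sum>i<j. c i * x i $ l)) \<le> j - 1"
    if j: "1 \<le> j" "j \<le> n" and c: "\<exists>i<j. c i \<noteq> 0" for j c
  proof -
    obtain e where "\<And>I. I \<subseteq> {0..<n} \<Longrightarrow> card I = j \<Longrightarrow> e * initial_minor ?P I > 0"
      using sgn[OF j] submatrix_initial_minor[OF P _ _ j(2)] by metis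
    from S_plus_le_of_minors[OF P j this c] have "S_plus (col_comb ?P j c) \<le> j - 1" .
    moreover have "col_comb ?P j c = vec n (\<lambda>l. \<Sum>i<j. c i * x i $ l)"
      using j by (auto simp: col_comb_def)
    ultimately show ?thesis by simp
  qed
  then show ?thesis using x by (auto simp: markov_system_def)
qed

section \<open>Eigenvalues of compounds and the equivalence\<close>

lemma map_poly_of_real_prod_linear:
  "map_poly complex_of_real (\<Prod>i\<in>S. [:- f i, 1:]) = (\<Prod>i\<in>S. [:- complex_of_real (f i), 1:])"
proof -
  interpret map_poly_comm_ring_hom complex_of_real ..
  show ?thesis by (simp add: hom_prod)
qed

lemma order_of_real: "order (complex_of_real x) (map_poly complex_of_real p) = order x p"
proof -
  interpret map_poly_inj_idom_divide_hom complex_of_real ..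
  show ?thesis by (rule order_hom)
qed

lemma map_poly_of_real_eq_iff: "map_poly complex_of_real p = map_poly complex_of_real q \<longleftrightarrow> p = q"
proof -
  interpret map_poly_inj_idom_divide_hom complex_of_real ..
  show ?thesis by (rule eq_iff)
qed

text \<open>Indices are counted, not values: simplicity of a root for a compound thereby means that
  exactly one \<open>j\<close>-subset attains this product of eigenvalues.\<close>

lemma order_prod_linear:
  fixes f :: "'b \<Rightarrow> 'a :: field"
  assumes "finite S"
  shows "order a (\<Prod>i\<in>S. [:- f i, 1:]) = card {i \<in> S. f i = a}"
  using assms
proof (induction S rule: finite_induct)
  case empty
  then show ?case by simp
next
  case (insert i S)
  have nz: "(\<Prod>i\<in>S. [:- f i, 1:]) \<noteq> 0" using insert by simp
  have nz': "[:- f i, 1:] * (\<Prod>i\<in>S. [:- f i, 1:]) \<noteq> 0"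
    using nz by (simp only: mult_eq_0_iff) simp
  have "{k \<in> insert i S. f k = a} = (if f i = a then insert i {k \<in> S. f k = a} else {k \<in> S. f k = a})"
    by auto
  moreover have "order a [:- f i, 1:] = (if f i = a then 1 else 0)"
    using order_power_n_n[of a 1] by (auto intro: order_0I)
  moreover have "order a ([:- f i, 1:] * (\<Prod>i\<in>S. [:- f i, 1:]))
      = order a [:- f i, 1:] + order a (\<Prod>i\<in>S. [:- f i, 1:])"
    by (rule order_mult[OF nz'])
  ultimately show ?case using insert by simp
qed

lemma poly_prod_linear_root:
  fixes f :: "'b \<Rightarrow> 'a :: field"
  assumes "finite S"
  shows "poly (\<Prod>i\<in>S. [:- f i, 1:]) x = 0 \<longleftrightarrow> (\<exists>i\<in>S. x = f i)"
  using assms by (auto simp: poly_prod)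

section \<open>Comparing products of eigenvalues over index sets\<close>

lemma pick_ge:
  assumes "k < card I"
  shows "k \<le> pick I k"
proof -
  have "k = card {a \<in> I. a < pick I k}" using card_pick_le[OF assms] by simp
  also have "\<dots> \<le> card {..<pick I k}" by (intro card_mono) auto
  finally show ?thesis by simp
qed

text \<open>The element of rank \<open>k\<close> in \<open>I\<close> is at least \<open>k\<close>,
  so the factors can be compared one by one. The weak hypotheses suit moduli of complex eigenvalues,
  which may coincide or vanish.\<close>

lemma prod_subset_le_initial:
  fixes f :: "nat \<Rightarrow> real"
  assumes anti: "\<And>i k. i \<le> k \<Longrightarrow> k < n \<Longrightarrow> f k \<le> f i" and nn: "\<And>i. i < n \<Longrightarrow> 0 \<le> f i"
    and I: "I \<subseteq> {0..<n}" "card I = j"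
  shows "(\<Prod>i\<in>I. f i) \<le> (\<Prod>i = 0..<j. f i)"
proof -
  have "finite I" using I by (auto intro: finite_subset)
  then have "(\<Prod>i\<in>I. f i) = (\<Prod>k = 0..<j. f (pick I k))"
    using bij_betw_pick[of I] I(2) by (intro prod.reindex_bij_betw[symmetric]) simp
  also have "\<dots> \<le> (\<Prod>k = 0..<j. f k)"
    using nn anti pick_less[OF I(1)] pick_ge[of _ I] I(2) by (intro prod_mono) auto
  finally show ?thesis .
qed

text \<open>Some \<open>b \<ge> j\<close> in \<open>I\<close> can be exchanged for a missing
  \<open>a < j\<close>, which strictly increases the product; the weak inequality applies to the
  resulting set.\<close>

lemma prod_subset_less_initial:
  fixes f :: "nat \<Rightarrow> real"
  assumes anti: "\<And>i k. i < k \<Longrightarrow> k < n \<Longrightarrow> f k < f i" and pos: "\<And>i. i < n \<Longrightarrow> 0 < f i"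
    and I: "I \<subseteq> {0..<n}" "card I = j" "I \<noteq> {0..<j}"
  shows "(\<Prod>i\<in>I. f i) < (\<Prod>i = 0..<j. f i)"
proof -
  have fin: "finite I" using I by (auto intro: finite_subset)
  have "\<not> I \<subseteq> {0..<j}" using card_subset_eq[of "{0..<j}" I] I by auto
  moreover have "\<not> {0..<j} \<subseteq> I" using card_subset_eq[OF fin, of "{0..<j}"] I by auto
  ultimately obtain a b where ab: "a < j" "a \<notin> I" "b \<in> I" "j \<le> b" by (auto simp: subset_iff)
  then have abn: "a < b" "b < n" using I by auto
  let ?R = "I - {b}"
  have R: "0 < (\<Prod>i\<in>?R. f i)" using I pos by (intro prod_pos) auto
  have "(\<Prod>i\<in>I. f i) = f b * (\<Prod>i\<in>?R. f i)" using fin ab by (simp add: prod.remove)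
  also have "\<dots> < f a * (\<Prod>i\<in>?R. f i)" using R anti abn by (intro mult_strict_right_mono) auto
  also have "\<dots> = (\<Prod>i\<in>insert a ?R. f i)" using fin ab by simp
  also have "\<dots> \<le> (\<Prod>i = 0..<j. f i)"
  proof (rule prod_subset_le_initial)
    show "f k \<le> f i" if "i \<le> k" "k < n" for i k
      using anti[of i k] that by (cases "i = k") (auto simp: less_imp_le)
    show "0 \<le> f i" if "i < n" for i using pos[OF that] by simp
    show "insert a ?R \<subseteq> {0..<n}" using I abn by auto
    have "card I > 0" using ab fin by (auto simp: card_gt_0_iff)
    then show "card (insert a ?R) = j" using fin ab I(2) by (simp add: card_Diff_singleton)
  qed
  finally show ?thesis .
qed

section \<open>Eigenvectors of a matrix and of its compounds\<close>

text \<open>The relation \<open>A * P = P * D\<close> passes to compounds. The compound of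
  \<open>D\<close> is upper triangular, so below the diagonal entry, which belongs to
  \<open>{0..<j}\<close>, its first column is zero; column 0 of the compound of \<open>P\<close> is
  the wedge of the first \<open>j\<close> columns.\<close>

lemma compound_eigenvector:
  assumes A: "A \<in> carrier_mat n n" and P: "P \<in> carrier_mat n n" and D: "D \<in> carrier_mat n n"
    and AP: "A * P = P * D" and ut: "upper_triangular D" and j: "j \<le> n"
  shows "compound A j *\<^sub>v col (compound P j) 0 = (\<Prod>i = 0..<j. D $$ (i, i)) \<cdot>\<^sub>v col (compound P j) 0"
proof (rule eq_vecI)
  let ?S = "index_sets n j"
  let ?N = "length ?S"
  let ?r = "\<Prod>i = 0..<j. D $$ (i, i)"
  have N: "0 < ?N" "?S ! 0 = {0..<j}" using index_sets_0[OF j] by auto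
  have eq: "compound A j * compound P j = compound P j * compound D j"
    using compound_mult[OF A P] compound_mult[OF P D] AP by simp
  have ut': "upper_triangular (compound D j)" by (rule compound_upper_triangular[OF D ut])
  fix i assume "i < dim_vec (?r \<cdot>\<^sub>v col (compound P j) 0)"
  then have i: "i < ?N" using P by simp
  have "(compound A j *\<^sub>v col (compound P j) 0) $ i = (compound A j * compound P j) $$ (i, 0)"
    using i N A P by simp
  also have "\<dots> = (\<Sum>k = 0..<?N. compound P j $$ (i, k) * compound D j $$ (k, 0))"
    unfolding eq using i N P D by (auto simp: scalar_prod_def)
  also have "\<dots> = (\<Sum>k\<in>{0}. compound P j $$ (i, k) * compound D j $$ (k, 0))"
    using N ut' D by (intro sum.mono_neutral_right) (auto simp: upper_triangular_def)
  also have "\<dots> = ?r * compound P j $$ (i, 0)"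
    using compound_triangular_diag[OF D ut N(1)] N by simp
  finally show "(compound A j *\<^sub>v col (compound P j) 0) $ i = (?r \<cdot>\<^sub>v col (compound P j) 0) $ i"
    using i N P by simp
qed (use A P in auto)

text \<open>Applying \<open>A - lam m\<close> to a vanishing combination removes the last
  eigenvector and multiplies the other coefficients by nonzero numbers, so that the induction
  hypothesis applies.\<close>

lemma eigenvectors_independent:
  fixes lam :: "nat \<Rightarrow> 'a :: field"
  assumes A: "A \<in> carrier_mat n n"
    and ev: "\<And>i. i < m \<Longrightarrow> eigenvector A (x i) (lam i)"
    and dist: "\<And>i k. i < k \<Longrightarrow> k < m \<Longrightarrow> lam i \<noteq> lam k"
    and zero: "\<And>l. l < n \<Longrightarrow> (\<Sum>i<m. c i * x i $ l) = 0"
    and i: "i < m"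
  shows "c i = 0"
  using ev dist zero i
proof (induction m arbitrary: c i)
  case (Suc m)
  have xc: "x i \<in> carrier_vec n" "x i \<noteq> 0\<^sub>v n" "A *\<^sub>v x i = lam i \<cdot>\<^sub>v x i" if "i < Suc m" for i
    using Suc.prems(1)[OF that] A by (auto simp: eigenvector_def)
  have Ax: "(\<Sum>k = 0..<n. A $$ (l, k) * x i $ k) = lam i * x i $ l" if "l < n" "i < Suc m" for l i
    using mult_mat_vec_nth[OF A xc(1)[OF that(2)] that(1)] xc[OF that(2)] that by simp
  have "(\<Sum>i<m. (c i * (lam i - lam m)) * x i $ l) = 0" if l: "l < n" for l
  proof -
    have "(\<Sum>i<Suc m. c i * (lam i * x i $ l)) = (\<Sum>i<Suc m. c i * (\<Sum>k = 0..<n. A $$ (l, k) * x i $ k))"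
      using Ax[OF l] by (intro sum.cong) auto
    also have "\<dots> = (\<Sum>k = 0..<n. \<Sum>i<Suc m. c i * (A $$ (l, k) * x i $ k))"
      unfolding sum_distrib_left by (rule sum.swap)
    also have "\<dots> = (\<Sum>k = 0..<n. A $$ (l, k) * (\<Sum>i<Suc m. c i * x i $ k))"
      unfolding sum_distrib_left by (intro sum.cong refl) (simp add: mult_ac)
    also have "\<dots> = 0" using Suc.prems(3) by (intro sum.neutral) (auto simp del: sum.lessThan_Suc)
    finally have "(\<Sum>i<Suc m. c i * (lam i * x i $ l)) - lam m * (\<Sum>i<Suc m. c i * x i $ l) = 0"
      using Suc.prems(3)[OF l] by (simp del: sum.lessThan_Suc)
    then show ?thesis
      by (simp add: sum_distrib_left sum_subtractf[symmetric] algebra_simps)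
  qed
  then have prod0: "c i * (lam i - lam m) = 0" if "i < m" for i
    using Suc.IH[of "\<lambda>i. c i * (lam i - lam m)" i] Suc.prems(1,2) that by auto
  have c0: "c i = 0" if "i < m" for i
    using Suc.prems(2)[of i m] prod0[OF that] that by simp
  then have "c m * x m $ l = 0" if "l < n" for l
    using Suc.prems(3)[OF that] by simp
  moreover obtain l where "l < n" "x m $ l \<noteq> 0"
    using xc(1,2)[of m] by (metis carrier_vecD eq_vecI index_zero_vec lessI)
  ultimately have "c m = 0" by (metis mult_eq_0_iff)
  then show ?case using c0 Suc.prems(4) by (cases "i = m") auto
qed simp

definition eigen_mat :: "nat \<Rightarrow> (nat \<Rightarrow> 'a vec) \<Rightarrow> 'a mat" where
  "eigen_mat n x = mat n n (\<lambda>(l, i). x i $ l)"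

lemma eigen_mat_carrier [simp]: "eigen_mat n x \<in> carrier_mat n n"
  by (simp add: eigen_mat_def)

lemma dim_eigen_mat [simp]: "dim_row (eigen_mat n x) = n" "dim_col (eigen_mat n x) = n"
  by (simp_all add: eigen_mat_def)

lemma eigenbasis:
  fixes lam :: "nat \<Rightarrow> 'a :: field"
  assumes A: "A \<in> carrier_mat n n"
    and ev: "\<And>i. i < n \<Longrightarrow> eigenvector A (x i) (lam i)"
    and dist: "\<And>i k. i < k \<Longrightarrow> k < n \<Longrightarrow> lam i \<noteq> lam k"
  defines "D \<equiv> mat n n (\<lambda>(i, k). if i = k then lam i else 0)"
  obtains Q where "Q \<in> carrier_mat n n" "Q * eigen_mat n x = 1\<^sub>m n" "det (eigen_mat n x) \<noteq> 0"
    "A * eigen_mat n x = eigen_mat n x * D" "similar_mat A D"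
proof -
  let ?P = "eigen_mat n x"
  have P: "?P \<in> carrier_mat n n" and D: "D \<in> carrier_mat n n" by (simp_all add: D_def)
  have xc: "x i \<in> carrier_vec n" "A *\<^sub>v x i = lam i \<cdot>\<^sub>v x i" if "i < n" for i
    using ev[OF that] A by (auto simp: eigenvector_def)
  have det: "det ?P \<noteq> 0"
  proof
    assume "det ?P = 0"
    then obtain v where v: "v \<in> carrier_vec n" "v \<noteq> 0\<^sub>v n" "?P *\<^sub>v v = 0\<^sub>v n"
      using det_0_iff_vec_prod_zero_field[OF P] by auto
    have "(\<Sum>i<n. v $ i * x i $ l) = 0" if "l < n" for l
    proof -
      have "(?P *\<^sub>v v) $ l = (\<Sum>i<n. v $ i * x i $ l)"
        unfolding mult_mat_vec_nth[OF P v(1) that] lessThan_atLeast0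
        using that by (intro sum.cong) (auto simp: eigen_mat_def)
      then show ?thesis using v that by simp
    qed
    from eigenvectors_independent[OF A ev dist this] have "v $ i = 0" if "i < n" for i
      using that by blast
    then show False using v by (metis carrier_vecD eq_vecI index_zero_vec)
  qed
  have AP: "A * ?P = ?P * D"
  proof (rule eq_matI)
    fix l i assume "l < dim_row (?P * D)" "i < dim_col (?P * D)"
    then have li: "l < n" "i < n" by (auto simp: eigen_mat_def D_def)
    have "(A * ?P) $$ (l, i) = (A *\<^sub>v x i) $ l"
      using li A xc(1)[OF li(2)] by (auto simp: eigen_mat_def scalar_prod_def)
    also have "\<dots> = lam i * x i $ l" using li xc[OF li(2)] by simp
    also have "\<dots> = (\<Sum>k = 0..<n. if k = i then x k $ l * lam k else 0)"
      using li by (simp add: mult.commute)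
    also have "\<dots> = (\<Sum>k = 0..<n. x k $ l * (if k = i then lam k else 0))"
      by (intro sum.cong) auto
    also have "\<dots> = (?P * D) $$ (l, i)"
      using li by (auto simp: eigen_mat_def D_def scalar_prod_def)
    finally show "(A * ?P) $$ (l, i) = (?P * D) $$ (l, i)" .
  qed (use A D in \<open>auto simp: eigen_mat_def\<close>)
  obtain Q where Q: "Q \<in> carrier_mat n n" "Q * ?P = 1\<^sub>m n" "?P * Q = 1\<^sub>m n"
    using det_non_zero_imp_unit[OF P det, of "()"] by (auto simp: Units_def ring_mat_def)
  have eq: "A = ?P * D * Q"
  proof -
    have "?P * D * Q = A * (?P * Q)"
      unfolding AP[symmetric] by (rule assoc_mult_mat[OF A P Q(1)])
    then show ?thesis using Q A by simp
  qed
  have "similar_mat A D"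
    by (rule similar_matI[OF _ Q(3,2) eq]) (use A D P Q in auto)
  with Q det AP show ?thesis using that by blast
qed

section \<open>The Gantmacher--Krein property and dominant eigenvectors of compounds\<close>

text \<open>With decreasing positive eigenvalues the product over \<open>{0..<j}\<close> is strictly
  larger than any other \<open>j\<close>-fold product, hence a simple dominant eigenvalue of the
  compound. Its eigenvector has minors of the first \<open>j\<close> eigenvectors as coordinates;
  the Markov property gives them one sign, which the factor \<open>e\<close> turns positive.\<close>

lemma GK_property_strong_PF:
  assumes A: "A \<in> carrier_mat n n" and GK: "GK_property A" and j: "1 \<le> j" "j \<le> n"
  shows "strong_PF (compound A j)"
proof -
  obtain lam x where dec: "\<And>i k. i < k \<Longrightarrow> k < n \<Longrightarrow> lam k < lam i"
    and lam: "\<And>i. i < n \<Longrightarrow> lam i > 0 \<and> eigenvector A (x i) (lam i)"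
    and mk: "markov_system n n x"
  proof -
    from GK A obtain lam x where "\<forall>i k. i < k \<and> k < n \<longrightarrow> lam i > lam k"
      "\<forall>i<n. lam i > 0 \<and> order (lam i) (char_poly A) = 1 \<and> eigenvector A (x i) (lam i)"
      "markov_system n n x" unfolding GK_property_def by auto
    then show ?thesis using that[of lam x] by blast
  qed
  let ?P = "eigen_mat n x"
  define D where "D = mat n n (\<lambda>(i, k). if i = k then lam i else 0)"
  have P: "?P \<in> carrier_mat n n" and D: "D \<in> carrier_mat n n" and ut: "upper_triangular D"
    by (auto simp: D_def upper_triangular_def)
  have dist: "lam i \<noteq> lam k" if "i < k" "k < n" for i k using dec[OF that] by simp
  obtain det: "det ?P \<noteq> 0" and AP: "A * ?P = ?P * D" and sim: "similar_mat A D"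
  proof (rule eigenbasis[OF A, of x lam, folded D_def])
    show "eigenvector A (x i) (lam i)" if "i < n" for i using lam[OF that] by blast
    show "lam i \<noteq> lam k" if "i < k" "k < n" for i k by (rule dist[OF that])
  qed (use that in blast)
  let ?KK = "{I. I \<subseteq> {0..<n} \<and> card I = j}"
  let ?S = "index_sets n j"
  have N: "0 < length ?S" "?S ! 0 = {0..<j}" using index_sets_0[OF j(2)] by auto
  have finK: "finite ?KK" by (rule finite_subset[of _ "Pow {0..<n}"]) auto
  have cp: "char_poly (compound A j) = (\<Prod>I\<in>?KK. [:- (\<Prod>i\<in>I. lam i), 1:])"
    unfolding char_poly_compound[OF A sim ut]
    by (intro prod.cong refl) (auto simp: D_def intro!: prod.cong)
  define r where "r = (\<Prod>i = 0..<j. lam i)"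
  have r: "r > 0" unfolding r_def using lam j by (intro prod_pos) auto
  have less: "(\<Prod>i\<in>I. lam i) < r" if "I \<in> ?KK" "I \<noteq> {0..<j}" for I
    unfolding r_def by (rule prod_subset_less_initial[OF dec]) (use lam that in auto)
  have pos: "(\<Prod>i\<in>I. lam i) > 0" if "I \<in> ?KK" for I
    using lam that by (intro prod_pos) auto
  have "{I \<in> ?KK. (\<Prod>i\<in>I. lam i) = r} = {{0..<j}}"
  proof -
    have "{0..<j} \<in> ?KK" using j by auto
    moreover have "I = {0..<j}" if "I \<in> ?KK" "(\<Prod>i\<in>I. lam i) = r" for I
      using less[OF that(1)] that(2) by auto
    ultimately show ?thesis by (auto simp: r_def)
  qed
  then have ord: "order r (char_poly (compound A j)) = 1"
    unfolding cp order_prod_linear[OF finK] by simp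
  have dom: "cmod \<mu> < r"
    if \<mu>: "eigenvalue (map_mat complex_of_real (compound A j)) \<mu>" "\<mu> \<noteq> complex_of_real r" for \<mu>
  proof -
    have "poly (char_poly (map_mat complex_of_real (compound A j))) \<mu> = 0"
      using \<mu>(1) eigenvalue_root_char_poly[of "map_mat complex_of_real (compound A j)" "length ?S"] A
      by simp
    then have "poly (\<Prod>I\<in>?KK. [:- complex_of_real (\<Prod>i\<in>I. lam i), 1:]) \<mu> = 0"
      unfolding of_real_hom.char_poly_hom[OF compound_carrier[OF A]] cp
        map_poly_of_real_prod_linear .
    then obtain I where I: "I \<in> ?KK" "\<mu> = complex_of_real (\<Prod>i\<in>I. lam i)"
      unfolding poly_prod_linear_root[OF finK] by blast
    then have "I \<noteq> {0..<j}" using \<mu>(2) by (auto simp: r_def)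
    then show ?thesis using less[OF I(1)] pos[OF I(1)] unfolding I(2) norm_of_real by simp
  qed
  obtain e where e: "\<And>I. I \<subseteq> {0..<n} \<Longrightarrow> card I = j \<Longrightarrow> e * det (submatrix ?P I {0..<j}) > 0"
    using markov_system_minors[OF mk det[unfolded eigen_mat_def] j] unfolding eigen_mat_def by blast
  define v where "v = e \<cdot>\<^sub>v col (compound ?P j) 0"
  have col: "col (compound ?P j) 0 \<in> carrier_vec (length ?S)"
    by (rule col_carrier_vec[OF N(1) compound_carrier[OF P]])
  then have v: "v \<in> carrier_vec (length ?S)" by (simp add: v_def)
  have vpos: "v $ i > 0" if "i < length ?S" for i
    using that e[OF index_setsD(1,2)[OF that]] N P by (simp add: v_def compound_index[OF P])
  have "compound A j *\<^sub>v v = r \<cdot>\<^sub>v v"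
  proof -
    have "(\<Prod>i = 0..<j. D $$ (i, i)) = r" unfolding r_def using j by (intro prod.cong) (auto simp: D_def)
    then have "compound A j *\<^sub>v col (compound ?P j) 0 = r \<cdot>\<^sub>v col (compound ?P j) 0"
      using compound_eigenvector[OF A P D AP ut j(2)] by simp
    then show ?thesis
      unfolding v_def mult_mat_vec[OF compound_carrier[OF A] col]
      by (simp add: smult_smult_assoc mult.commute)
  qed
  moreover have "v \<noteq> 0\<^sub>v (length ?S)" using vpos[OF N(1)] N(1) by auto
  ultimately have ev: "eigenvector (compound A j) v r" using v A by (simp add: eigenvector_def)
  show ?thesis
    unfolding strong_PF_def
    using r ord dom ev vpos v by (intro exI[of _ r]) (auto simp: eigenvalue_def)
qed

text \<open>\<open>schur_decomposition\<close> puts the eigenvalues on the diagonal in the order of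
  the given list. Sorting them by decreasing modulus first makes the product over
  \<open>{0..<j}\<close> maximal in modulus among all \<open>j\<close>-fold products.\<close>

lemma sorted_schur:
  fixes A :: "complex mat"
  assumes A: "A \<in> carrier_mat n n"
  obtains T where "T \<in> carrier_mat n n" "similar_mat A T" "upper_triangular T"
    "\<And>i k. i \<le> k \<Longrightarrow> k < n \<Longrightarrow> cmod (T $$ (k, k)) \<le> cmod (T $$ (i, i))"
    "char_poly A = (\<Prod>i = 0..<n. [:- T $$ (i, i), 1:])"
proof -
  obtain es where es: "char_poly A = (\<Prod>a\<leftarrow>es. [:- a, 1:])" "length es = n"
    using char_poly_factorized[OF A] by auto
  define fs where "fs = sort_key (\<lambda>z. - cmod z) es"
  have "mset (map (\<lambda>a. [:- a, 1:]) fs) = mset (map (\<lambda>a. [:- a, 1:]) es)"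
    by (simp add: fs_def)
  then have "(\<Prod>a\<leftarrow>fs. [:- a, 1:]) = (\<Prod>a\<leftarrow>es. [:- a, 1:])"
    by (metis prod_mset_prod_list)
  then have fs: "char_poly A = (\<Prod>a\<leftarrow>fs. [:- a, 1:])" "length fs = n"
    using es by (simp_all add: fs_def)
  obtain T P Q where "schur_decomposition A fs = (T, P, Q)" by (cases "schur_decomposition A fs") auto
  from schur_decomposition[OF A fs(1) this]
  have T: "similar_mat_wit A T P Q" "upper_triangular T" "diag_mat T = fs" by auto
  have Tc: "T \<in> carrier_mat n n" by (rule similar_mat_witD2(5)[OF A T(1)])
  have Ti: "T $$ (i, i) = fs ! i" if "i < n" for i
    using T(3) Tc that by (auto simp: diag_mat_def)
  have "sorted (map (\<lambda>z. - cmod z) fs)" by (simp add: fs_def)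
  then have "cmod (fs ! k) \<le> cmod (fs ! i)" if "i \<le> k" "k < n" for i k
    using sorted_nth_mono[of "map (\<lambda>z. - cmod z) fs" i k] that fs(2) by simp
  moreover have "char_poly A = (\<Prod>i = 0..<n. [:- T $$ (i, i), 1:])"
    unfolding fs(1) using Ti fs(2) by (simp add: prod.list_conv_set_nth)
  ultimately show ?thesis
    using that[OF Tc _ T(2)] T(1) Ti by (auto simp: similar_mat_def)
qed

text \<open>The product \<open>E j\<close> of the \<open>j\<close> eigenvalues of largest modulus
  has to be the dominant eigenvalue of the \<open>j\<close>-th compound, hence positive. Successive
  quotients \<open>E (Suc i) / E i\<close> show that every eigenvalue is positive; uniqueness of the
  dominant product makes them strictly decreasing.\<close>

lemma strong_PF_compounds_eigenvalues:
  fixes A :: "real mat"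
  assumes A: "A \<in> carrier_mat n n"
    and PF: "\<And>j. 1 \<le> j \<Longrightarrow> j \<le> n \<Longrightarrow> strong_PF (compound A j)"
  obtains lam where "\<And>i k. i < k \<Longrightarrow> k < n \<Longrightarrow> lam k < lam i" "\<And>i. i < n \<Longrightarrow> lam i > 0"
    "char_poly A = (\<Prod>i = 0..<n. [:- lam i, 1:])"
proof -
  let ?h = complex_of_real
  let ?A = "map_mat ?h A"
  have Ac: "?A \<in> carrier_mat n n" using A by simp
  obtain T where T: "T \<in> carrier_mat n n" "similar_mat ?A T" "upper_triangular T"
    and anti: "\<And>i k. i \<le> k \<Longrightarrow> k < n \<Longrightarrow> cmod (T $$ (k, k)) \<le> cmod (T $$ (i, i))"
    and cpA: "char_poly ?A = (\<Prod>i = 0..<n. [:- T $$ (i, i), 1:])"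
    using sorted_schur[OF Ac] by blast
  define e where "e i = T $$ (i, i)" for i
  define E where "E j = (\<Prod>i = 0..<j. e i)" for j
  have key: "\<exists>r>0. E j = ?h r \<and> (\<forall>I. I \<subseteq> {0..<n} \<longrightarrow> card I = j \<longrightarrow> I \<noteq> {0..<j} \<longrightarrow>
      cmod (\<Prod>i\<in>I. e i) < r)" if j: "1 \<le> j" "j \<le> n" for j
  proof -
    let ?KK = "{I. I \<subseteq> {0..<n} \<and> card I = j}"
    have finK: "finite ?KK" by (rule finite_subset[of _ "Pow {0..<n}"]) auto
    let ?B = "map_mat ?h (compound A j)"
    have Bc: "?B \<in> carrier_mat (length (index_sets n j)) (length (index_sets n j))" using A by simp
    obtain r where r: "r > 0" "order r (char_poly (compound A j)) = 1"
      and dom: "\<And>\<mu>. eigenvalue ?B \<mu> \<Longrightarrow> \<mu> \<noteq> ?h r \<Longrightarrow> cmod \<mu> < r"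
      using PF[OF j] by (auto simp: strong_PF_def)
    have "?B = compound ?A j" by (rule compound_hom[OF of_real_hom.comm_ring_hom_axioms A])
    then have cp: "char_poly ?B = (\<Prod>I\<in>?KK. [:- (\<Prod>i\<in>I. e i), 1:])"
      unfolding e_def by (simp only: char_poly_compound[OF Ac T(2,3)])
    have "order (?h r) (char_poly ?B) = 1"
      unfolding of_real_hom.char_poly_hom[OF compound_carrier[OF A]] order_of_real by (rule r(2))
    then have card1: "card {I \<in> ?KK. (\<Prod>i\<in>I. e i) = ?h r} = 1"
      unfolding cp order_prod_linear[OF finK] .
    then obtain I0 where I0: "{I \<in> ?KK. (\<Prod>i\<in>I. e i) = ?h r} = {I0}" by (auto simp: card_1_singleton_iff)
    have evI: "eigenvalue ?B (\<Prod>i\<in>I. e i)" if "I \<in> ?KK" for I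
      unfolding eigenvalue_root_char_poly[OF Bc] cp poly_prod_linear_root[OF finK] using that by blast
    have init: "{0..<j} \<in> ?KK" using j by auto
    from I0 have I0m: "I0 \<subseteq> {0..<n}" "card I0 = j" "(\<Prod>i\<in>I0. e i) = ?h r" by blast+
    \<comment> \<open>\<open>I0\<close> is the subset whose product is \<open>r\<close>. As
      \<open>E j\<close> is an eigenvalue of modulus at least \<open>r\<close>, strict dominance
      leaves only \<open>E j = r\<close>.\<close>
    have "(\<Prod>i\<in>I0. cmod (e i)) \<le> (\<Prod>i = 0..<j. cmod (e i))"
      by (rule prod_subset_le_initial[OF _ _ I0m(1,2)]) (use anti in \<open>auto simp: e_def\<close>)
    then have "cmod (?h r) \<le> cmod (E j)"
      unfolding prod_norm I0m(3) E_def .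
    then have "r \<le> cmod (E j)" using r(1) by simp
    then have Ej: "E j = ?h r"
      using dom[OF evI[OF init]] by (simp add: E_def not_less[symmetric]) blast
    then have "{0..<j} \<in> {I \<in> ?KK. (\<Prod>i\<in>I. e i) = ?h r}" using init by (simp add: E_def)
    then have I0j: "I0 = {0..<j}" unfolding I0 by simp
    have "cmod (\<Prod>i\<in>I. e i) < r" if "I \<in> ?KK" "I \<noteq> {0..<j}" for I
    proof -
      have "I \<notin> {I \<in> ?KK. (\<Prod>i\<in>I. e i) = ?h r}" unfolding I0 using that(2) I0j by simp
      then have "(\<Prod>i\<in>I. e i) \<noteq> ?h r" using that(1) by simp
      then show ?thesis by (rule dom[OF evI[OF that(1)]])
    qed
    then show ?thesis using r(1) Ej by blast
  qed
  \<comment> \<open>The empty product starts the quotients, since the hypothesis speaks of compounds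
    with \<open>j \<ge> 1\<close>.\<close>
  have E0: "E 0 = ?h 1" by (simp add: E_def)
  have real: "\<exists>r>0. E j = ?h r" if "j \<le> n" for j
    using key[of j] that E0 by (cases "j = 0") (auto intro: exI[of _ 1])
  have ESuc: "E (Suc j) = E j * e j" for j by (simp add: E_def mult.commute)
  have elam: "e i = ?h (Re (e i))" "Re (e i) > 0" if i: "i < n" for i
  proof -
    obtain r s where rs: "r > 0" "s > 0" "E i = ?h r" "E (Suc i) = ?h s"
      using real[of i] real[of "Suc i"] i by auto
    then have "e i = ?h (s / r)" using ESuc[of i] by (simp add: field_simps)
    then show "e i = ?h (Re (e i))" "Re (e i) > 0" using rs by auto
  qed
  have step: "Re (e (Suc i)) < Re (e i)" if i: "Suc i < n" for i
  proof -
    \<comment> \<open>This set differs from \<open>{0..<Suc i}\<close> in the last element alone, so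
      comparing the two products compares \<open>e (Suc i)\<close> with \<open>e i\<close>.\<close>
    let ?I = "insert (Suc i) {0..<i}"
    obtain r where r: "E (Suc i) = ?h r" "r > 0" and lt: "cmod (\<Prod>k\<in>?I. e k) < r"
    proof -
      obtain r where "E (Suc i) = ?h r" "r > 0"
        "\<And>I. I \<subseteq> {0..<n} \<Longrightarrow> card I = Suc i \<Longrightarrow> I \<noteq> {0..<Suc i} \<Longrightarrow> cmod (\<Prod>k\<in>I. e k) < r"
        using key[of "Suc i"] i by auto
      moreover have "?I \<subseteq> {0..<n}" "card ?I = Suc i" "?I \<noteq> {0..<Suc i}" using i by auto
      ultimately show ?thesis using that by blast
    qed
    have "cmod (E i) * cmod (e (Suc i)) < cmod (E i) * cmod (e i)"
      using lt r ESuc[of i] by (simp add: E_def norm_mult mult.commute flip: norm_mult) 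
    then have "cmod (e (Suc i)) < cmod (e i)" by (simp add: mult_less_cancel_left)
    moreover have "cmod (e k) = Re (e k)" if "k < n" for k
      using elam[OF that] by (metis abs_of_pos norm_of_real)
    ultimately show ?thesis using i by simp
  qed
  define lam where "lam i = Re (e i)" for i
  have dec: "lam k < lam i" if "i < k" "k < n" for i k
    using that
  proof (induction k)
    case (Suc k)
    then show ?case using step[of k] by (cases "i = k") (auto simp: lam_def)
  qed simp
  have "map_poly ?h (char_poly A) = map_poly ?h (\<Prod>i = 0..<n. [:- lam i, 1:])"
    unfolding map_poly_of_real_prod_linear of_real_hom.char_poly_hom[OF A, symmetric] cpA
    using elam(1) by (intro prod.cong) (auto simp: e_def lam_def)
  then have "char_poly A = (\<Prod>i = 0..<n. [:- lam i, 1:])"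
    by (simp only: map_poly_of_real_eq_iff)
  then show ?thesis using that[OF dec _] elam(2) by (auto simp: lam_def)
qed

text \<open>The wedge of the first \<open>j\<close> eigenvectors is an eigenvector of the compound
  for the product of the first \<open>j\<close> eigenvalues. This is the dominant eigenvalue, whose
  eigenspace is spanned by a positive vector; so the wedge has coordinates of one sign, and the
  eigenvectors form a Markov system.\<close>

lemma strong_PF_GK_property:
  fixes A :: "real mat"
  assumes A: "A \<in> carrier_mat n n"
    and PF: "\<And>j. 1 \<le> j \<Longrightarrow> j \<le> n \<Longrightarrow> strong_PF (compound A j) \<and> strong_PF ((compound A j)\<^sup>T)"
  shows "GK_property A"
proof -
  obtain lam where dec: "\<And>i k. i < k \<Longrightarrow> k < n \<Longrightarrow> lam k < lam i" and pos: "\<And>i. i < n \<Longrightarrow> lam i > 0"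
    and cp: "char_poly A = (\<Prod>i = 0..<n. [:- lam i, 1:])"
    using strong_PF_compounds_eigenvalues[OF A] PF by blast
  have "{k \<in> {0..<n}. lam k = lam i} = {i}" if "i < n" for i
    using dec that by (auto) (metis less_irrefl linorder_neqE_nat)
  then have ord: "order (lam i) (char_poly A) = 1" if "i < n" for i
    unfolding cp using that by (simp add: order_prod_linear)
  have "eigenvalue A (lam i)" if "i < n" for i
    unfolding eigenvalue_root_char_poly[OF A] cp using that by (auto simp: poly_prod)
  then obtain x where x: "\<And>i. i < n \<Longrightarrow> eigenvector A (x i) (lam i)"
    unfolding eigenvalue_def by metis
  let ?P = "eigen_mat n x"
  define D where "D = mat n n (\<lambda>(i, k). if i = k then lam i else 0)"
  have P: "?P \<in> carrier_mat n n" and D: "D \<in> carrier_mat n n" and ut: "upper_triangular D"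
    by (auto simp: D_def upper_triangular_def)
  have dist: "lam i \<noteq> lam k" if "i < k" "k < n" for i k using dec[OF that] by simp
  obtain Q where Q: "Q \<in> carrier_mat n n" "Q * ?P = 1\<^sub>m n" and AP: "A * ?P = ?P * D"
    and sim: "similar_mat A D"
  proof (rule eigenbasis[OF A, of x lam, folded D_def])
    show "eigenvector A (x i) (lam i)" if "i < n" for i by (rule x[OF that])
    show "lam i \<noteq> lam k" if "i < k" "k < n" for i k by (rule dist[OF that])
  qed (use that in blast)
  have "markov_system n n x"
  proof (rule minors_markov_system)
    show "x i \<in> carrier_vec n \<and> x i \<noteq> 0\<^sub>v n" if "i < n" for i
      using x[OF that] A by (auto simp: eigenvector_def)
    fix j assume j: "1 \<le> j" "j \<le> n"
    let ?S = "index_sets n j"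
    let ?u = "col (compound ?P j) 0"
    have N: "0 < length ?S" "?S ! 0 = {0..<j}" using index_sets_0[OF j(2)] by auto
    have u: "?u \<in> carrier_vec (length ?S)" 
      by (rule col_carrier_vec[OF N(1) compound_carrier[OF P]])
    obtain r v w where pair: "eigenpair (length ?S) (compound A j) r v w" and r: "r > 0"
      and ordr: "order r (char_poly (compound A j)) = 1"
      and vpos: "\<And>i. i < length ?S \<Longrightarrow> v $ i > 0" and "\<And>i. i < length ?S \<Longrightarrow> w $ i > 0"
      and dom: "\<And>\<mu>. eigenvalue (map_mat complex_of_real (compound A j)) \<mu> \<Longrightarrow>
        \<mu> \<noteq> complex_of_real r \<Longrightarrow> cmod \<mu> < r"
    proof (rule strong_PF_pair[OF compound_carrier[OF A] N(1)])
      show "strong_PF (compound A j)" "strong_PF ((compound A j)\<^sup>T)" using PF[OF j] by auto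
    qed (rule that, assumption+)
    interpret eigenpair "length ?S" "compound A j" r v w by (rule pair)
    define s where "s = (\<Prod>i = 0..<j. lam i)"
    have "(\<Prod>i = 0..<j. D $$ (i, i)) = s" unfolding s_def using j by (intro prod.cong) (auto simp: D_def)
    then have Au: "compound A j *\<^sub>v ?u = s \<cdot>\<^sub>v ?u"
      using compound_eigenvector[OF A P D AP ut j(2)] by simp
    \<comment> \<open>The compound of \<open>Q\<close> is a left inverse of the compound of
      \<open>?P\<close>, which therefore has no zero column.\<close>
    have u0: "?u \<noteq> 0\<^sub>v (length ?S)"
    proof
      assume "?u = 0\<^sub>v (length ?S)"
      then have "compound ?P j $$ (k, 0) = 0" if "k < length ?S" for k
        using that N P by (metis carrier_matD compound_carrier index_col index_zero_vec(1))
      then have "(compound Q j * compound ?P j) $$ (0, 0) = 0"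
        using N P Q by (simp add: scalar_prod_def)
      moreover have "compound Q j * compound ?P j = 1\<^sub>m (length ?S)"
        using compound_mult[OF Q(1) P] Q(2) by (simp add: compound_one)
      ultimately show False using N by simp
    qed
    \<comment> \<open>\<open>r\<close> is a product over some \<open>j\<close>-subset and so at most
      \<open>s\<close>; an eigenvalue \<open>s > r\<close> would contradict dominance.\<close>
    have "s = r"
    proof -
      let ?KK = "{I. I \<subseteq> {0..<n} \<and> card I = j}"
      have finK: "finite ?KK" by (rule finite_subset[of _ "Pow {0..<n}"]) auto
      have cpj: "char_poly (compound A j) = (\<Prod>I\<in>?KK. [:- (\<Prod>i\<in>I. lam i), 1:])"
        unfolding char_poly_compound[OF A sim ut]
        by (intro prod.cong refl) (auto simp: D_def intro!: prod.cong)
      have "poly (char_poly (compound A j)) r = 0" using ordr order_root[of _ r] by (metis zero_neq_one)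
      then obtain I where I: "I \<subseteq> {0..<n}" "card I = j" "r = (\<Prod>i\<in>I. lam i)"
        unfolding cpj poly_prod_linear_root[OF finK] by blast
      have "r \<le> s"
      proof (cases "I = {0..<j}")
        case False
        have "(\<Prod>i\<in>I. lam i) < (\<Prod>i = 0..<j. lam i)"
          by (rule prod_subset_less_initial[OF _ _ I(1,2) False]) (use dec pos in auto)
        then show ?thesis using I(3) by (simp add: s_def)
      qed (simp add: I s_def)
      moreover have "s \<le> r"
      proof (rule ccontr)
        assume "\<not> s \<le> r"
        have "eigenvector (compound A j) ?u s" using Au u u0 A by (simp add: eigenvector_def)
        then have "eigenvalue (map_mat complex_of_real (compound A j)) (complex_of_real s)"
          using of_real_hom.eigenvalue_hom[OF compound_carrier[OF A]] by (auto simp: eigenvalue_def)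
        then show False using dom[of "complex_of_real s"] \<open>\<not> s \<le> r\<close> by simp
      qed
      ultimately show ?thesis by simp
    qed
    then obtain t where t: "?u = t \<cdot>\<^sub>v v"
      using eigenspace_simple[OF _ ordr u] Au r by auto
    have "t \<noteq> 0" using t u0 v by auto
    show "\<exists>e :: real. \<forall>I. I \<subseteq> {0..<n} \<longrightarrow> card I = j \<longrightarrow>
      e * det (submatrix (mat n n (\<lambda>(l, i). x i $ l)) I {0..<j}) > 0"
    \<comment> \<open>Each minor equals \<open>t\<close> times a positive coordinate of
      \<open>v\<close>, so \<open>t\<close> has the common sign.\<close>
    proof (intro exI[of _ t] allI impI)
      fix I assume "I \<subseteq> {0..<n}" "card I = j"
      then have "I \<in> set ?S" by (simp add: set_index_sets)
      then obtain k where k: "k < length ?S" "I = ?S ! k" by (auto simp: in_set_conv_nth)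
      have "det (submatrix ?P I {0..<j}) = ?u $ k"
        using k N P by (simp add: compound_index[OF P])
      also have "\<dots> = t * v $ k" unfolding t using k v by simp
      finally have "t * det (submatrix ?P I {0..<j}) = t\<^sup>2 * v $ k"
        by (simp add: power2_eq_square)
      also have "\<dots> > 0" using vpos[OF k(1)] \<open>t \<noteq> 0\<close> by simp
      finally show "t * det (submatrix (mat n n (\<lambda>(l, i). x i $ l)) I {0..<j}) > 0"
        by (simp add: eigen_mat_def)
    qed
  qed
  then show ?thesis
    unfolding GK_property_def using A dec pos ord x by (intro exI[of _ lam] exI[of _ x]) auto
qed

section \<open>Strict total positivity through compounds\<close>

lemma STP_iff_compounds_positive:
  assumes A: "A \<in> carrier_mat n n"
  shows "STP A \<longleftrightarrow> (\<forall>j\<in>{1..n}. positive_mat (compound A j))"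
proof
  assume "STP A"
  then show "\<forall>j\<in>{1..n}. positive_mat (compound A j)"
    using A index_setsD by (auto simp: positive_mat_def STP_def compound_index[OF A])
next
  assume pos: "\<forall>j\<in>{1..n}. positive_mat (compound A j)"
  show "STP A"
    unfolding STP_def
  proof (intro allI impI)
    fix I J assume IJ: "I \<subseteq> {0..<dim_row A} \<and> J \<subseteq> {0..<dim_col A} \<and> card I = card J \<and> card I \<ge> 1"
    define j where "j = card I"
    have "I \<in> set (index_sets n j)" "J \<in> set (index_sets n j)"
      using IJ A by (auto simp: set_index_sets j_def)
    then obtain r c where rc: "r < length (index_sets n j)" "I = index_sets n j ! r"
      "c < length (index_sets n j)" "J = index_sets n j ! c"
      by (metis in_set_conv_nth)
    have "j \<in> {1..n}" using IJ A card_mono[of "{0..<n}" I] by (auto simp: j_def)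
    then have "positive_mat (compound A j)" using pos by blast
    then show "det (submatrix A I J) > 0"
      using rc A by (auto simp: positive_mat_def compound_index[OF A])
  qed
qed

text \<open>Powers commute with compounds. \<open>ESTP\<close> asks for one threshold valid for all
  orders, while each compound has its own; as there are finitely many orders, the two requirements
  agree.\<close>

lemma ESTP_iff_compounds_eventually_positive:
  assumes A: "A \<in> carrier_mat n n"
  shows "ESTP A \<longleftrightarrow> (\<forall>j\<in>{1..n}. eventually_positive (compound A j))"
proof -
  have "ESTP A \<longleftrightarrow> (\<forall>\<^sub>F k in sequentially. \<forall>j\<in>{1..n}. positive_mat (compound A j ^\<^sub>m k))"
    unfolding ESTP_def eventually_sequentially
    by (simp add: STP_iff_compounds_positive[OF pow_carrier_mat[OF A]] compound_pow[OF A])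
  also have "\<dots> \<longleftrightarrow> (\<forall>j\<in>{1..n}. \<forall>\<^sub>F k in sequentially. positive_mat (compound A j ^\<^sub>m k))"
    by (rule eventually_ball_finite_distrib) simp
  finally show ?thesis by (simp add: eventually_positive_def eventually_sequentially)
qed

theorem theorem7:
  fixes A :: "real mat" and n :: nat
  assumes "A \<in> carrier_mat n n"
  shows "((GK_property A \<and> GK_property (A\<^sup>T))
           \<longleftrightarrow> (\<forall>j \<in> {1..n}. strong_PF (compound_mat A j) \<and> strong_PF ((compound_mat A j)\<^sup>T)))
       \<and> ((\<forall>j \<in> {1..n}. strong_PF (compound_mat A j) \<and> strong_PF ((compound_mat A j)\<^sup>T))
           \<longleftrightarrow> (\<forall>j \<in> {1..n}. eventually_positive (compound_mat A j)))
       \<and> ((\<forall>j \<in> {1..n}. eventually_positive (compound_mat A j)) \<longleftrightarrow> ESTP A)"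
proof (unfold compound_mat_eq_compound, intro conjI)
  have AT: "A\<^sup>T \<in> carrier_mat n n" using assms by simp
  \<comment> \<open>Compounds commute with transposition, so the strong Perron--Frobenius condition
    for the transpose is the same condition with its two halves exchanged.\<close>
  note tr = compound_transpose[OF assms] compound_transpose[OF AT, unfolded transpose_transpose]
  show "(GK_property A \<and> GK_property (A\<^sup>T))
      \<longleftrightarrow> (\<forall>j \<in> {1..n}. strong_PF (compound A j) \<and> strong_PF ((compound A j)\<^sup>T))"
  proof
    assume "GK_property A \<and> GK_property (A\<^sup>T)"
    then show "\<forall>j \<in> {1..n}. strong_PF (compound A j) \<and> strong_PF ((compound A j)\<^sup>T)"
      using GK_property_strong_PF[OF assms] GK_property_strong_PF[OF AT] by (simp add: tr(1))
  next
    assume PF: "\<forall>j \<in> {1..n}. strong_PF (compound A j) \<and> strong_PF ((compound A j)\<^sup>T)"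
    show "GK_property A \<and> GK_property (A\<^sup>T)"
      using strong_PF_GK_property[OF assms] strong_PF_GK_property[OF AT] PF by (simp add: tr)
  qed
  have car: "compound A j \<in> carrier_mat (length (index_sets n j)) (length (index_sets n j))" for j
    by (rule compound_carrier[OF assms])
  \<comment> \<open>Compounds of order at most \<open>n\<close> have positive dimension, as the
    Perron--Frobenius lemmas require.\<close>
  have N: "0 < length (index_sets n j)" if "j \<in> {1..n}" for j using index_sets_0(1) that by simp
  have "strong_PF (compound A j) \<and> strong_PF ((compound A j)\<^sup>T) \<longleftrightarrow> eventually_positive (compound A j)"
    if j: "j \<in> {1..n}" for j
    using strong_PF_eventually_positive[OF car N[OF j]]
      eventually_positive_strong_PF[OF car N[OF j]]
      eventually_positive_strong_PF[OF _ N[OF j] eventually_positive_transpose[OF car]] car by auto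
  then show "(\<forall>j \<in> {1..n}. strong_PF (compound A j) \<and> strong_PF ((compound A j)\<^sup>T))
      \<longleftrightarrow> (\<forall>j \<in> {1..n}. eventually_positive (compound A j))" by blast
  show "(\<forall>j \<in> {1..n}. eventually_positive (compound A j)) \<longleftrightarrow> ESTP A"
    using ESTP_iff_compounds_eventually_positive[OF assms] by simp
qed

end
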